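(* Let $\mathcal{H}$ be a committee space. Let $x^{(1)},x^{(2)},\ldots$ be an infinite sequence of independent identically distributed random points, and let $X_n=(x^{(1)},\ldots,x^{(n)})$. Let $v=(v_\gamma)_\gamma$ be a random multiplier model for $\mathcal{H}$. Then, almost surely (with respect to the sequence of random points), $$\|R_v\|=\lim_{n\to\infty}\|R_v^{X_n}\|\le\lim_{n\to\infty}\|C_v^{X_n}\|=\|C_v\|.$$
   Context: A committee space is a Hilbert space $\mathcal{H}$ of formal power series (in commuting or noncommuting variables, in one, several or infinitely many variables) in which polynomials are dense, such that (1) $\langle z^\alpha,z^\beta\rangle=0$ whenever $\alpha\ne\beta$; (2) (committee inequality) $\|z^\alpha\|\,\|z^\beta\|\ge\|z^{\alpha+\beta}\|$ for all multi-indices $\alpha,\beta$. Here multi-indices index the monomials $z^\alpha$ and $z^{\alpha+\beta}=z^\alpha z^\beta$; in the noncommutative case multi-indices are words and $\alpha+\beta$ denotes concatenation. The Hilbert space dimension of $\mathcal{H}$ is countable. A multiplier of $\mathcal{H}$ is a power series $f$ such that $M_f:h\mapsto fh$ is a bounded operator on $\mathcal{H}$. A random multiplier model is a family of scalar random variables $v_\gamma$ indexed by multi-indices $\gamma$ such that (1) $E(v_\gamma)=0$; (2) $E(|v_\gamma|^2)=w_\gamma<\infty$; (3) $E(\overline{v_\gamma}v_{\gamma'})=0$ if $\gamma\ne\gamma'$; (4) there is a constant $C>0$ such that $f_v=\sum_\gamma v_\gamma z^\gamma$ satisfies $\|M_{f_v}\|\le C$ almost surely. The natural domain of the multiplier algebra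 of $\mathcal{H}$ is the set of all tuples of matrices $x=(x_1,x_2,\ldots)$ such that the map taking $M_{z_i}\mapsto x_i$ is a completely contractive homomorphism. For $h\in\mathcal{H}$, $h(x)$ denotes the value of $h$ at $x$; for the points considered, evaluation $h\mapsto h(x)$ is a well-defined bounded linear map from $\mathcal{H}$ to matrices, and $(fh)(x)=f(x)h(x)$ for multipliers $f$. A random point is a random variable $x$ taking values in the natural domain such that $P(h(x)=0)<1$ for every nonzero $h\in\mathcal{H}$. For a finite sequence $X=(x^{(1)},\ldots,x^{(m)})$ of points in the natural domain, $P_X$ is the orthogonal projection onto $\{h\in\mathcal{H}: h(x^{(k)})=0\text{ for all }k\}^\perp$. Define $$R_v=E(M_{f_v}M_{f_v}^* ),\qquad C_v=E(M_{f_v}^*M_{f_v}),$$ $$R_v^X=E(P_XM_{f_v}P_XM_{f_v}^*P_X),\qquad C_v^X=E(P_XM_{f_v}^*P_XM_{f_v}P_X),$$ where the expectations are over $v$ only, with $X$ held fixed, and are taken in the weak sense: $\langle E(T)g,h\rangle=E\langle Tg,h\rangle$ for all $g,h\in\mathcal{H}$. Norms of operators are operator norms.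
   Formalization: The formal theorem additionally assumes ‖1‖ = 1 in the committee space; with ‖1‖ > 1 the inequality ‖R_v‖ ≤ ‖C_v‖ can fail. Coefficient functionals of the Hilbert space of power series are taken to be continuous, as is standard. *)

theory Defs
  imports
    "HOL-Probability.Probability"
    "HOL-Library.Multiset"
    "HOL-Library.Function_Algebras"
    "Jordan_Normal_Form.Matrix"
begin

text \<open>
  Multi-indices form a type \<open>'m :: monoid_add\<close>, where \<open>var i\<close> is the multi-index of the
  variable with label \<open>i\<close> and \<open>z\<^sup>\<alpha> z\<^sup>\<beta> = z\<^sup>\<alpha>\<^sup>+\<^sup>\<beta>\<close>. For noncommuting variables they are
  the words (the free monoid), for commuting variables the finite multisets of labels (the
  free commutative monoid), both up to isomorphism.
\<close>

definition noncommuting_indices :: "('i \<Rightarrow> 'm::monoid_add) \<Rightarrow> bool" where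
  "noncommuting_indices var \<longleftrightarrow> bij (\<lambda>w. \<Sum>i\<leftarrow>w. var i)"

definition commuting_indices :: "('i \<Rightarrow> 'm::monoid_add) \<Rightarrow> bool" where
  "commuting_indices var \<longleftrightarrow> (\<exists>\<phi> :: 'i multiset \<Rightarrow> 'm. bij \<phi> \<and> (\<forall>w. (\<Sum>i\<leftarrow>w. var i) = \<phi> (mset w)))"

definition multi_indices :: "('i \<Rightarrow> 'm::monoid_add) \<Rightarrow> bool" where
  "multi_indices var \<longleftrightarrow> commuting_indices var \<or> noncommuting_indices var"

lemma commuting_indices_multiset: "commuting_indices (\<lambda>i. {#i#})"
proof -
  have "(\<Sum>i\<leftarrow>w. {#i#}) = mset w" for w :: "'a list"
    by (induction w) auto
  then show ?thesis
    unfolding commuting_indices_def by (intro exI[of _ id]) auto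
qed

instantiation list :: (type) monoid_add
begin

definition zero_list :: "'a list" where "zero_list = []"

definition plus_list :: "'a list \<Rightarrow> 'a list \<Rightarrow> 'a list" where "plus_list u v = u @ v"

instance
  by standard (simp_all add: zero_list_def plus_list_def)

end

lemma noncommuting_indices_list: "noncommuting_indices (\<lambda>i. [i])"
proof -
  have "(\<Sum>i\<leftarrow>w. [i]) = w" for w :: "'a list"
    by (induction w) (auto simp: zero_list_def plus_list_def)
  then show ?thesis
    unfolding noncommuting_indices_def using bij_id by (simp add: id_def)
qed

type_synonym 'm series = "'m \<Rightarrow> complex"

definition monomial :: "'m \<Rightarrow> 'm series" where
  "monomial \<alpha> = (\<lambda>\<gamma>. if \<gamma> = \<alpha> then 1 else 0)"

definition polynomial :: "'m series \<Rightarrow> bool" where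
  "polynomial p \<longleftrightarrow> finite {\<alpha>. p \<alpha> \<noteq> 0}"

definition scale :: "complex \<Rightarrow> 'm series \<Rightarrow> 'm series" where
  "scale c h = (\<lambda>\<alpha>. c * h \<alpha>)"

text \<open>
  The product of formal power series. The sum is finite, since a multi-index has only
  finitely many decompositions. (The pointwise product and the constant one that
  \<^theory>\<open>HOL-Library.Function_Algebras\<close> puts on functions are not used.)
\<close>

definition series_mult :: "('m::monoid_add) series \<Rightarrow> 'm series \<Rightarrow> 'm series" where
  "series_mult f g = (\<lambda>\<gamma>. \<Sum>(\<alpha>, \<beta>) \<in> {(\<alpha>, \<beta>). \<alpha> + \<beta> = \<gamma>}. f \<alpha> * g \<beta>)"


section \<open>Hilbert spaces of formal power series\<close>

text \<open>The inner product is linear in its first argument.\<close>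

record 'm series_space =
  elems :: "'m series set"
  ip :: "'m series \<Rightarrow> 'm series \<Rightarrow> complex"

definition ser_norm :: "'m series_space \<Rightarrow> 'm series \<Rightarrow> real" where
  "ser_norm \<H> h = sqrt (Re (ip \<H> h h))"

text \<open>
  As usual for a Hilbert space of formal power series, the coefficient functionals are
  required to be continuous, so that a norm limit of polynomials is the series whose
  coefficients are the limits of their coefficients.
\<close>

locale hilbert_series_space =
  fixes \<H> :: "'m series_space"
  assumes zero_mem: "0 \<in> elems \<H>"
    and add_mem: "g \<in> elems \<H> \<Longrightarrow> h \<in> elems \<H> \<Longrightarrow> g + h \<in> elems \<H>"
    and scale_mem: "h \<in> elems \<H> \<Longrightarrow> scale c h \<in> elems \<H>"
    and ip_add: "f \<in> elems \<H> \<Longrightarrow> g \<in> elems \<H> \<Longrightarrow> h \<in> elems \<H> \<Longrightarrow>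
      ip \<H> (f + g) h = ip \<H> f h + ip \<H> g h"
    and ip_scale: "g \<in> elems \<H> \<Longrightarrow> h \<in> elems \<H> \<Longrightarrow> ip \<H> (scale c g) h = c * ip \<H> g h"
    and ip_cnj: "g \<in> elems \<H> \<Longrightarrow> h \<in> elems \<H> \<Longrightarrow> ip \<H> h g = cnj (ip \<H> g h)"
    and ip_pos: "h \<in> elems \<H> \<Longrightarrow> h \<noteq> 0 \<Longrightarrow> 0 < Re (ip \<H> h h)"
    and complete: "(\<And>n. s n \<in> elems \<H>) \<Longrightarrow>
      (\<And>e. e > 0 \<Longrightarrow> \<exists>N. \<forall>m\<ge>N. \<forall>n\<ge>N. ser_norm \<H> (s m - s n) < e) \<Longrightarrow>
      \<exists>h\<in>elems \<H>. (\<lambda>n. ser_norm \<H> (s n - h)) \<longlonglongrightarrow> 0"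
    and coeff_continuous: "\<exists>K. \<forall>h\<in>elems \<H>. cmod (h \<alpha>) \<le> K * ser_norm \<H> h"

text \<open>
  The committee inequality with \<open>\<alpha> = \<beta> = 0\<close> only yields \<open>\<parallel>1\<parallel> \<ge> 1\<close>; the normalization
  \<open>\<parallel>1\<parallel> = 1\<close> is not part of this definition.
\<close>

locale committee_space = hilbert_series_space \<H>
  for \<H> :: "('m::monoid_add) series_space" +
  assumes polynomial_mem: "polynomial p \<Longrightarrow> p \<in> elems \<H>"
    and polynomials_dense:
      "h \<in> elems \<H> \<Longrightarrow> e > 0 \<Longrightarrow> \<exists>p. polynomial p \<and> ser_norm \<H> (h - p) < e"
    and monomials_orthogonal: "\<alpha> \<noteq> \<beta> \<Longrightarrow> ip \<H> (monomial \<alpha>) (monomial \<beta>) = 0"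
    and committee_inequality:
      "ser_norm \<H> (monomial \<alpha>) * ser_norm \<H> (monomial \<beta>) \<ge> ser_norm \<H> (monomial (\<alpha> + \<beta>))"


section \<open>Operators\<close>

text \<open>
  Operators on \<open>\<H>\<close> are functions on all formal power series of which only the restriction to
  \<open>elems \<H>\<close> is relevant.
\<close>

type_synonym 'm operator = "'m series \<Rightarrow> 'm series"

definition opnorm :: "'m series_space \<Rightarrow> 'm operator \<Rightarrow> real" where
  "opnorm \<H> T = (SUP h \<in> {h \<in> elems \<H>. ser_norm \<H> h \<le> 1}. ser_norm \<H> (T h))"

definition adj :: "'m series_space \<Rightarrow> 'm operator \<Rightarrow> 'm operator" where
  "adj \<H> T = (\<lambda>h. THE k. k \<in> elems \<H> \<and> (\<forall>g\<in>elems \<H>. ip \<H> (T g) h = ip \<H> g k))"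

definition orth_compl :: "'m series_space \<Rightarrow> 'm series set \<Rightarrow> 'm series set" where
  "orth_compl \<H> K = {g \<in> elems \<H>. \<forall>h\<in>K. ip \<H> g h = 0}"

definition orth_proj :: "'m series_space \<Rightarrow> 'm series set \<Rightarrow> 'm operator" where
  "orth_proj \<H> K = (\<lambda>h. THE k. k \<in> K \<and> h - k \<in> orth_compl \<H> K)"

definition multiplier :: "('m::monoid_add) series_space \<Rightarrow> 'm series \<Rightarrow> bool" where
  "multiplier \<H> f \<longleftrightarrow> (\<forall>h\<in>elems \<H>. series_mult f h \<in> elems \<H>) \<and>
     (\<exists>K. \<forall>h\<in>elems \<H>. ser_norm \<H> (series_mult f h) \<le> K * ser_norm \<H> h)"

text \<open>
  The operator \<open>M\<^sub>f\<close>. The value \<open>0\<close> for a series \<open>f\<close> that is not a multiplier keeps random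
  multiplication operators measurable on the null set where the random series is not a
  multiplier.
\<close>

definition mult_op :: "('m::monoid_add) series_space \<Rightarrow> 'm series \<Rightarrow> 'm operator" where
  "mult_op \<H> f = (if multiplier \<H> f then series_mult f else (\<lambda>h. 0))"

text \<open>The expectation of a random operator \<open>T\<close> in the weak sense.\<close>

definition weak_expectation ::
  "'m series_space \<Rightarrow> 'w measure \<Rightarrow> ('w \<Rightarrow> 'm operator) \<Rightarrow> 'm operator" where
  "weak_expectation \<H> N T = (\<lambda>g. THE k. k \<in> elems \<H> \<and>
     (\<forall>h\<in>elems \<H>. integrable N (\<lambda>\<omega>. ip \<H> (T \<omega> g) h) \<and>
       ip \<H> k h = (\<integral>\<omega>. ip \<H> (T \<omega> g) h \<partial>N)))"


section \<open>Matrix tuples and the natural domain\<close>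

text \<open>A point assigns a matrix \<open>x i\<close> to each variable, all of them of the same size.\<close>

type_synonym 'i point = "'i \<Rightarrow> complex mat"

definition point_dim :: "'i point \<Rightarrow> nat" where
  "point_dim x = (THE n. \<forall>i. x i \<in> carrier_mat n n)"

definition word_at :: "'i point \<Rightarrow> 'i list \<Rightarrow> complex mat" where
  "word_at x w = foldr (\<lambda>i A. x i * A) w (1\<^sub>m (point_dim x))"

text \<open>
  The power \<open>x\<^sup>\<alpha>\<close>. The choice of a word that represents \<open>\<alpha>\<close> is immaterial on the natural
  domain: for commuting variables the matrices \<open>x i\<close> commute there.
\<close>

definition monomial_at :: "('i \<Rightarrow> 'm::monoid_add) \<Rightarrow> 'i point \<Rightarrow> 'm \<Rightarrow> complex mat" where
  "monomial_at var x \<alpha> = word_at x (SOME w. (\<Sum>i\<leftarrow>w. var i) = \<alpha>)"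

definition series_at :: "('i \<Rightarrow> 'm::monoid_add) \<Rightarrow> 'm series \<Rightarrow> 'i point \<Rightarrow> complex mat" where
  "series_at var h x = mat (point_dim x) (point_dim x)
     (\<lambda>(a, b). \<Sum>\<^sub>\<infinity>\<alpha>. h \<alpha> * monomial_at var x \<alpha> $$ (a, b))"

definition vanishes_at :: "('i \<Rightarrow> 'm::monoid_add) \<Rightarrow> 'm series \<Rightarrow> 'i point \<Rightarrow> bool" where
  "vanishes_at var h x \<longleftrightarrow> series_at var h x = 0\<^sub>m (point_dim x) (point_dim x)"

definition l2_norm_vec :: "complex vec \<Rightarrow> real" where
  "l2_norm_vec u = sqrt (\<Sum>j<dim_vec u. (cmod (vec_index u j))\<^sup>2)"

definition mat_opnorm :: "complex mat \<Rightarrow> real" where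
  "mat_opnorm A = (SUP u \<in> {u \<in> carrier_vec (dim_col A). l2_norm_vec u \<le> 1}. l2_norm_vec (A *\<^sub>v u))"

text \<open>
  The \<open>k \<times> k\<close> block matrix with \<open>n \<times> n\<close> blocks \<open>A a b\<close>, and the norm of a \<open>k \<times> k\<close> matrix of
  operators acting on the Hilbert space direct sum of \<open>k\<close> copies of \<open>\<H>\<close>.
\<close>

definition block_mat :: "nat \<Rightarrow> nat \<Rightarrow> (nat \<Rightarrow> nat \<Rightarrow> complex mat) \<Rightarrow> complex mat" where
  "block_mat k n A = mat (k * n) (k * n) (\<lambda>(r, c). A (r div n) (c div n) $$ (r mod n, c mod n))"

definition block_opnorm :: "'m series_space \<Rightarrow> nat \<Rightarrow> (nat \<Rightarrow> nat \<Rightarrow> 'm operator) \<Rightarrow> real" where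
  "block_opnorm \<H> k T =
     (SUP h \<in> {h. (\<forall>b<k. h b \<in> elems \<H>) \<and> (\<Sum>b<k. (ser_norm \<H> (h b))\<^sup>2) \<le> 1}.
        sqrt (\<Sum>a<k. (ser_norm \<H> (\<Sum>b<k. T a b (h b)))\<^sup>2))"

text \<open>The unital operator algebra generated by the multiplication operators of the variables.\<close>

definition polynomial_ops :: "('m::monoid_add) series_space \<Rightarrow> 'm operator set" where
  "polynomial_ops \<H> = mult_op \<H> ` {p. polynomial p}"

definition algebra_hom :: "('m::monoid_add) series_space \<Rightarrow> nat \<Rightarrow> ('m operator \<Rightarrow> complex mat) \<Rightarrow> bool" where
  "algebra_hom \<H> n \<pi> \<longleftrightarrow>
     (\<forall>T\<in>polynomial_ops \<H>. \<pi> T \<in> carrier_mat n n) \<and>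
     \<pi> id = 1\<^sub>m n \<and>
     (\<forall>S\<in>polynomial_ops \<H>. \<forall>T\<in>polynomial_ops \<H>. \<pi> (S + T) = \<pi> S + \<pi> T \<and> \<pi> (S \<circ> T) = \<pi> S * \<pi> T) \<and>
     (\<forall>c. \<forall>T\<in>polynomial_ops \<H>. \<pi> (scale c \<circ> T) = c \<cdot>\<^sub>m \<pi> T)"

definition completely_contractive ::
  "('m::monoid_add) series_space \<Rightarrow> nat \<Rightarrow> ('m operator \<Rightarrow> complex mat) \<Rightarrow> bool" where
  "completely_contractive \<H> n \<pi> \<longleftrightarrow>
     (\<forall>k T. (\<forall>a<k. \<forall>b<k. T a b \<in> polynomial_ops \<H>) \<longrightarrow>
        mat_opnorm (block_mat k n (\<lambda>a b. \<pi> (T a b))) \<le> block_opnorm \<H> k T)"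

definition natural_domain :: "('m::monoid_add) series_space \<Rightarrow> ('i \<Rightarrow> 'm) \<Rightarrow> 'i point set" where
  "natural_domain \<H> var = {x. \<exists>n>0. (\<forall>i. x i \<in> carrier_mat n n) \<and>
     (\<exists>\<pi>. algebra_hom \<H> n \<pi> \<and> completely_contractive \<H> n \<pi> \<and>
        (\<forall>i. \<pi> (mult_op \<H> (monomial (var i))) = x i))}"

definition bounded_evaluation :: "('m::monoid_add) series_space \<Rightarrow> ('i \<Rightarrow> 'm) \<Rightarrow> 'i point \<Rightarrow> bool" where
  "bounded_evaluation \<H> var x \<longleftrightarrow>
     (\<forall>h\<in>elems \<H>. \<forall>a<point_dim x. \<forall>b<point_dim x.
        (\<lambda>\<alpha>. h \<alpha> * monomial_at var x \<alpha> $$ (a, b)) summable_on UNIV) \<and>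
     (\<exists>K. \<forall>h\<in>elems \<H>. mat_opnorm (series_at var h x) \<le> K * ser_norm \<H> h)"

text \<open>
  The measurable space of all matrix tuples: the sizes of the matrices and all their entries
  are measurable.
\<close>

definition point_space :: "'i point measure" where
  "point_space = sigma UNIV
     ({{x. x i \<in> carrier_mat m n} | i m n. True} \<union>
      {{x. x i \<in> carrier_mat m n \<and> x i $$ (a, b) \<in> B} | i m n a b B. a < m \<and> b < n \<and> open B})"


section \<open>Random points and random multipliers\<close>

definition random_point ::
  "('m::monoid_add) series_space \<Rightarrow> ('i \<Rightarrow> 'm) \<Rightarrow> 's measure \<Rightarrow> ('s \<Rightarrow> 'i point) \<Rightarrow> bool" where
  "random_point \<H> var S x \<longleftrightarrow> prob_space S \<and> x \<in> measurable S point_space \<and>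
     (\<forall>\<omega>\<in>space S. x \<omega> \<in> natural_domain \<H> var \<and> bounded_evaluation \<H> var (x \<omega>)) \<and>
     (\<forall>h\<in>elems \<H>. h \<noteq> 0 \<longrightarrow> measure S {\<omega>\<in>space S. vanishes_at var h (x \<omega>)} < 1)"

text \<open>The random series \<open>f\<^sub>v\<close> is \<open>\<lambda>\<omega> \<gamma>. v \<gamma> \<omega>\<close>.\<close>

definition random_multiplier_model ::
  "('m::monoid_add) series_space \<Rightarrow> 'w measure \<Rightarrow> ('m \<Rightarrow> 'w \<Rightarrow> complex) \<Rightarrow> bool" where
  "random_multiplier_model \<H> N v \<longleftrightarrow> prob_space N \<and>
     (\<forall>\<gamma>. v \<gamma> \<in> borel_measurable N) \<and>
     (\<forall>\<gamma>. integrable N (\<lambda>\<omega>. (cmod (v \<gamma> \<omega>))\<^sup>2)) \<and>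
     (\<forall>\<gamma>. (\<integral>\<omega>. v \<gamma> \<omega> \<partial>N) = 0) \<and>
     (\<forall>\<gamma> \<gamma>'. \<gamma> \<noteq> \<gamma>' \<longrightarrow> (\<integral>\<omega>. cnj (v \<gamma> \<omega>) * v \<gamma>' \<omega> \<partial>N) = 0) \<and>
     (\<exists>C>0. AE \<omega> in N. multiplier \<H> (\<lambda>\<gamma>. v \<gamma> \<omega>) \<and> opnorm \<H> (mult_op \<H> (\<lambda>\<gamma>. v \<gamma> \<omega>)) \<le> C)"

definition proj_points ::
  "('m::monoid_add) series_space \<Rightarrow> ('i \<Rightarrow> 'm) \<Rightarrow> 'i point list \<Rightarrow> 'm operator" where
  "proj_points \<H> var X =
     orth_proj \<H> (orth_compl \<H> {h \<in> elems \<H>. \<forall>x\<in>set X. vanishes_at var h x})"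

definition row_op ::
  "('m::monoid_add) series_space \<Rightarrow> 'w measure \<Rightarrow> ('m \<Rightarrow> 'w \<Rightarrow> complex) \<Rightarrow> 'm operator" where
  "row_op \<H> N v = weak_expectation \<H> N
     (\<lambda>\<omega>. let M = mult_op \<H> (\<lambda>\<gamma>. v \<gamma> \<omega>) in M \<circ> adj \<H> M)"

definition col_op ::
  "('m::monoid_add) series_space \<Rightarrow> 'w measure \<Rightarrow> ('m \<Rightarrow> 'w \<Rightarrow> complex) \<Rightarrow> 'm operator" where
  "col_op \<H> N v = weak_expectation \<H> N
     (\<lambda>\<omega>. let M = mult_op \<H> (\<lambda>\<gamma>. v \<gamma> \<omega>) in adj \<H> M \<circ> M)"

definition row_op_at :: "('m::monoid_add) series_space \<Rightarrow> ('i \<Rightarrow> 'm) \<Rightarrow>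
    'w measure \<Rightarrow> ('m \<Rightarrow> 'w \<Rightarrow> complex) \<Rightarrow> 'i point list \<Rightarrow> 'm operator" where
  "row_op_at \<H> var N v X = weak_expectation \<H> N
     (\<lambda>\<omega>. let M = mult_op \<H> (\<lambda>\<gamma>. v \<gamma> \<omega>); P = proj_points \<H> var X
          in P \<circ> M \<circ> P \<circ> adj \<H> M \<circ> P)"

definition col_op_at :: "('m::monoid_add) series_space \<Rightarrow> ('i \<Rightarrow> 'm) \<Rightarrow>
    'w measure \<Rightarrow> ('m \<Rightarrow> 'w \<Rightarrow> complex) \<Rightarrow> 'i point list \<Rightarrow> 'm operator" where
  "col_op_at \<H> var N v X = weak_expectation \<H> N
     (\<lambda>\<omega>. let M = mult_op \<H> (\<lambda>\<gamma>. v \<gamma> \<omega>); P = proj_points \<H> var X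
          in P \<circ> adj \<H> M \<circ> P \<circ> M \<circ> P)"

end

theory Submission
  imports Defs
begin

text \<open>
  All the operators involved are weak expectations \<open>E(Q\<^sup>* Q)\<close>, whose norm is the supremum of the
  energies \<open>E(\<parallel>Q g\<parallel>\<^sup>2)\<close> over the unit ball. Replacing \<open>Q\<close> by a compression \<open>P Q P\<close> does not increase
  this supremum, and by dominated convergence the energies converge when projections \<open>P\<^sub>n\<close> increase
  strongly to the identity; hence so do the norms.

  For \<open>P\<^sub>n = P\<close> at the first \<open>n\<close> random points, strong convergence to the identity means that only
  \<open>h = 0\<close> vanishes at all points. On evaluation functionals of norm at most \<open>l\<close>, weak convergence is
  governed by the values on a countable dense set of polynomials, so there are countably many cells of
  evaluation functionals, and almost surely the points hit each cell that has positive probability.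
  If \<open>h\<close> vanishes at all of them, it therefore vanishes at almost every point of their distribution.

  Finally, \<open>\<parallel>C\<^sub>v\<parallel> \<ge> \<langle>C\<^sub>v 1, 1\<rangle> = \<Sum>\<^sub>\<gamma> w\<^sub>\<gamma> \<parallel>z\<^sup>\<gamma>\<parallel>\<^sup>2\<close>, while \<open>R\<^sub>v\<close> is diagonal in the monomials and the committee
  inequality bounds each of its diagonal entries \<open>\<Sum> w\<^sub>\<gamma> \<parallel>z\<^sup>\<gamma>\<^sup>+\<^sup>\<beta>\<parallel>\<^sup>2 / \<parallel>z\<^sup>\<beta>\<parallel>\<^sup>2\<close> (over \<open>\<gamma> + \<beta>\<close> fixed) by the same sum.
\<close>

section \<open>Hilbert spaces of formal power series\<close>

text \<open>The operator \<open>Q\<close> is \<open>M\<close> for the columns and the adjoint of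
  \<open>M\<close> for the rows. Since \<open>P\<close> is a self-adjoint idempotent,
  \<open>P Q* P Q P\<close> is again \<open>T* T\<close>, with \<open>T = P Q P\<close>, so one
  convergence result serves both.

  For a single nonzero \<open>h\<close>, independence shows at once that almost surely some point
  does not annihilate \<open>h\<close>; but the exceptional null set depends on \<open>h\<close>,
  and there are uncountably many \<open>h\<close>. The cells are chosen before \<open>h\<close>,
  which removes this dependence. Each cell fixes the bound \<open>l\<close>, because the value at a
  nearby polynomial says something about the value at \<open>h\<close> only when the norm of the
  evaluation functional is controlled.

  Commuting and noncommuting variables are treated together: the indices are countable, each has
  finitely many decompositions, and addition cancels on both sides. Right cancellation turns the
  coefficients of \<open>f z^\<beta>\<close> into copies of those of \<open>f\<close>; left
  cancellation ensures that each \<open>w_\<gamma>\<close> occurs at most once in a diagonal entry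
  of \<open>R_v\<close>.\<close>

definition closed_subspace :: "'m series_space \<Rightarrow> 'm series set \<Rightarrow> bool" where
  "closed_subspace \<H> V \<longleftrightarrow> V \<subseteq> elems \<H> \<and> 0 \<in> V \<and> (\<forall>g\<in>V. \<forall>h\<in>V. g + h \<in> V) \<and>
     (\<forall>c. \<forall>h\<in>V. scale c h \<in> V) \<and>
     (\<forall>s h. (\<forall>n. s n \<in> V) \<longrightarrow> h \<in> elems \<H> \<longrightarrow> (\<lambda>n. ser_norm \<H> (s n - h)) \<longlonglongrightarrow> 0 \<longrightarrow> h \<in> V)"

text \<open>A relation instead of the operator \<open>adj\<close>: it records that both maps
  preserve \<open>elems \<H>\<close>, it is symmetric, and linearity of both maps follows from it. A
  multiplication operator and its adjoint can thus exchange roles.\<close>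

definition adjoint_pair :: "'m series_space \<Rightarrow> 'm operator \<Rightarrow> 'm operator \<Rightarrow> bool" where
  "adjoint_pair \<H> A B \<longleftrightarrow> (\<forall>h\<in>elems \<H>. A h \<in> elems \<H> \<and> B h \<in> elems \<H>) \<and>
     (\<forall>g\<in>elems \<H>. \<forall>h\<in>elems \<H>. ip \<H> (A g) h = ip \<H> g (B h))"

lemma scale_0 [simp]: "scale 0 h = 0"
  and scale_1 [simp]: "scale 1 h = h"
  and scale_minus_1: "scale (-1) h = - h"
  and scale_scale [simp]: "scale a (scale b h) = scale (a * b) h"
  by (auto simp: scale_def fun_eq_iff)

lemma scale_0_right [simp]: "scale c 0 = 0"
  by (auto simp: scale_def fun_eq_iff)

context hilbert_series_space
begin

abbreviation H :: "'m series set" where "H \<equiv> elems \<H>"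
abbreviation inner_series :: "'m series \<Rightarrow> 'm series \<Rightarrow> complex" (\<open>\<langle>_, _\<rangle>\<close>) where
  "\<langle>g, h\<rangle> \<equiv> ip \<H> g h"
abbreviation norm_series :: "'m series \<Rightarrow> real" (\<open>\<parallel>_\<parallel>\<close>) where
  "\<parallel>h\<parallel> \<equiv> ser_norm \<H> h"

section \<open>Algebra of the inner product and the norm\<close>

lemma minus_mem: "h \<in> H \<Longrightarrow> - h \<in> H"
  using scale_mem[of h "-1"] by (simp add: scale_minus_1)

lemma diff_mem: "g \<in> H \<Longrightarrow> h \<in> H \<Longrightarrow> g - h \<in> H"
  using add_mem[of g "- h"] minus_mem[of h] by simp

lemma sum_mem: "(\<And>i. i \<in> I \<Longrightarrow> f i \<in> H) \<Longrightarrow> sum f I \<in> H"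
  by (induction I rule: infinite_finite_induct) (auto simp: zero_mem add_mem)

lemmas mems = zero_mem add_mem minus_mem diff_mem scale_mem sum_mem

lemma ip_zero_left: "h \<in> H \<Longrightarrow> \<langle>0, h\<rangle> = 0"
  using ip_scale[of 0 h 0] by (simp add: zero_mem)

lemma ip_zero_right: "h \<in> H \<Longrightarrow> \<langle>h, 0\<rangle> = 0"
  using ip_cnj[of 0 h] by (simp add: zero_mem ip_zero_left)

lemma ip_add_right: "f \<in> H \<Longrightarrow> g \<in> H \<Longrightarrow> h \<in> H \<Longrightarrow> \<langle>h, f + g\<rangle> = \<langle>h, f\<rangle> + \<langle>h, g\<rangle>"
  by (metis ip_cnj add_mem ip_add complex_cnj_add)

lemma ip_scale_right: "g \<in> H \<Longrightarrow> h \<in> H \<Longrightarrow> \<langle>g, scale c h\<rangle> = cnj c * \<langle>g, h\<rangle>"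
  by (metis ip_cnj scale_mem ip_scale complex_cnj_mult)

lemma ip_diff: "f \<in> H \<Longrightarrow> g \<in> H \<Longrightarrow> h \<in> H \<Longrightarrow> \<langle>f - g, h\<rangle> = \<langle>f, h\<rangle> - \<langle>g, h\<rangle>"
  using ip_add[of f "scale (-1) g" h] ip_scale[of g h "-1"] by (simp add: scale_mem scale_minus_1 minus_mem)

lemma ip_diff_right: "f \<in> H \<Longrightarrow> g \<in> H \<Longrightarrow> h \<in> H \<Longrightarrow> \<langle>h, f - g\<rangle> = \<langle>h, f\<rangle> - \<langle>h, g\<rangle>"
  by (metis ip_cnj diff_mem ip_diff complex_cnj_diff)

lemma ip_sum: "(\<And>i. i \<in> I \<Longrightarrow> f i \<in> H) \<Longrightarrow> h \<in> H \<Longrightarrow> \<langle>sum f I, h\<rangle> = (\<Sum>i\<in>I. \<langle>f i, h\<rangle>)"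
  by (induction I rule: infinite_finite_induct) (auto simp: ip_zero_left ip_add sum_mem)

lemma ip_sum_right: "(\<And>i. i \<in> I \<Longrightarrow> f i \<in> H) \<Longrightarrow> h \<in> H \<Longrightarrow> \<langle>h, sum f I\<rangle> = (\<Sum>i\<in>I. \<langle>h, f i\<rangle>)"
  by (induction I rule: infinite_finite_induct) (auto simp: ip_zero_right ip_add_right sum_mem)

lemma ip_self_nonneg: "h \<in> H \<Longrightarrow> 0 \<le> Re \<langle>h, h\<rangle>"
  using ip_pos[of h] ip_zero_left[of 0] by (cases "h = 0") (auto simp: zero_mem)

lemma norm_nonneg: "h \<in> H \<Longrightarrow> 0 \<le> \<parallel>h\<parallel>"
  by (simp add: ser_norm_def ip_self_nonneg)

lemma norm_sq: "h \<in> H \<Longrightarrow> \<parallel>h\<parallel>\<^sup>2 = Re \<langle>h, h\<rangle>"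
  by (simp add: ser_norm_def ip_self_nonneg)

lemma ip_self: "h \<in> H \<Longrightarrow> \<langle>h, h\<rangle> = of_real (\<parallel>h\<parallel>\<^sup>2)"
  using ip_cnj[of h h] by (simp add: norm_sq complex_eq_iff)

lemma norm_zero [simp]: "\<parallel>0\<parallel> = 0"
  by (simp add: ser_norm_def ip_zero_left zero_mem)

lemma norm_eq_0: "h \<in> H \<Longrightarrow> \<parallel>h\<parallel> = 0 \<longleftrightarrow> h = 0"
  using ip_pos[of h] norm_sq[of h] by (cases "h = 0") auto

lemma norm_pos: "h \<in> H \<Longrightarrow> h \<noteq> 0 \<Longrightarrow> 0 < \<parallel>h\<parallel>"
  using norm_eq_0[of h] norm_nonneg[of h] by linarith

lemma norm_scale: "h \<in> H \<Longrightarrow> \<parallel>scale c h\<parallel> = cmod c * \<parallel>h\<parallel>"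
proof -
  assume h: "h \<in> H"
  have "\<langle>scale c h, scale c h\<rangle> = of_real ((cmod c)\<^sup>2 * \<parallel>h\<parallel>\<^sup>2)"
    using h by (simp add: ip_scale ip_scale_right scale_mem ip_self[OF h] complex_norm_square mult.assoc del: of_real_power)
  then have "\<parallel>scale c h\<parallel>\<^sup>2 = (cmod c * \<parallel>h\<parallel>)\<^sup>2"
    using h by (simp add: norm_sq scale_mem power_mult_distrib)
  then show ?thesis
    using h by (simp add: norm_nonneg scale_mem power2_eq_iff_nonneg)
qed

lemma norm_minus: "h \<in> H \<Longrightarrow> \<parallel>- h\<parallel> = \<parallel>h\<parallel>"
  using norm_scale[of h "-1"] by (simp add: scale_minus_1)

lemma norm_minus_commute: "g \<in> H \<Longrightarrow> h \<in> H \<Longrightarrow> \<parallel>g - h\<parallel> = \<parallel>h - g\<parallel>"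
  using norm_minus[of "g - h"] by (simp add: diff_mem)

lemma norm_add_sq: "g \<in> H \<Longrightarrow> h \<in> H \<Longrightarrow> \<parallel>g + h\<parallel>\<^sup>2 = \<parallel>g\<parallel>\<^sup>2 + 2 * Re \<langle>g, h\<rangle> + \<parallel>h\<parallel>\<^sup>2"
  using ip_cnj[of g h] by (simp add: norm_sq add_mem ip_add ip_add_right)

lemma norm_diff_sq: "g \<in> H \<Longrightarrow> h \<in> H \<Longrightarrow> \<parallel>g - h\<parallel>\<^sup>2 = \<parallel>g\<parallel>\<^sup>2 - 2 * Re \<langle>g, h\<rangle> + \<parallel>h\<parallel>\<^sup>2"
  using ip_cnj[of g h] by (simp add: norm_sq diff_mem ip_diff ip_diff_right)

lemma Cauchy_Schwarz:
  assumes "g \<in> H" "h \<in> H"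
  shows "cmod \<langle>g, h\<rangle> \<le> \<parallel>g\<parallel> * \<parallel>h\<parallel>"
proof (cases "h = 0")
  case True
  then show ?thesis using assms by (simp add: ip_zero_right)
next
  case False
  \<comment> \<open>With this coefficient, \<open>scale c h\<close> is the orthogonal projection of
    \<open>g\<close> onto the line through \<open>h\<close>.\<close>
  define c where "c = \<langle>g, h\<rangle> / of_real (\<parallel>h\<parallel>\<^sup>2)"
  have p: "\<parallel>h\<parallel> > 0" using False assms norm_pos by blast
  have "0 \<le> \<parallel>g - scale c h\<parallel>\<^sup>2" by simp
  also have "\<dots> = \<parallel>g\<parallel>\<^sup>2 - 2 * Re (cnj c * \<langle>g, h\<rangle>) + (cmod c)\<^sup>2 * \<parallel>h\<parallel>\<^sup>2"
    using assms by (simp add: norm_diff_sq scale_mem ip_scale_right norm_scale power_mult_distrib)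
  also have "cnj c * \<langle>g, h\<rangle> = of_real ((cmod \<langle>g, h\<rangle>)\<^sup>2 / \<parallel>h\<parallel>\<^sup>2)"
    by (simp add: c_def complex_norm_square[symmetric] mult.commute)
  also have "(cmod c)\<^sup>2 * \<parallel>h\<parallel>\<^sup>2 = (cmod \<langle>g, h\<rangle>)\<^sup>2 / \<parallel>h\<parallel>\<^sup>2"
    using p by (simp add: c_def norm_divide norm_power power_divide) (simp add: power2_eq_square power4_eq_xxxx)
  finally have "(cmod \<langle>g, h\<rangle>)\<^sup>2 / \<parallel>h\<parallel>\<^sup>2 \<le> \<parallel>g\<parallel>\<^sup>2"
    by simp
  then have "(cmod \<langle>g, h\<rangle>)\<^sup>2 \<le> (\<parallel>g\<parallel> * \<parallel>h\<parallel>)\<^sup>2"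
    using p by (simp add: divide_le_eq power_mult_distrib)
  then show ?thesis
    using assms norm_nonneg by (meson mult_nonneg_nonneg power2_le_imp_le)
qed

lemma norm_triangle: "g \<in> H \<Longrightarrow> h \<in> H \<Longrightarrow> \<parallel>g + h\<parallel> \<le> \<parallel>g\<parallel> + \<parallel>h\<parallel>"
proof (rule power2_le_imp_le)
  assume gh: "g \<in> H" "h \<in> H"
  have "Re \<langle>g, h\<rangle> \<le> \<parallel>g\<parallel> * \<parallel>h\<parallel>"
    using Cauchy_Schwarz[OF gh] complex_Re_le_cmod order_trans by blast
  then show "\<parallel>g + h\<parallel>\<^sup>2 \<le> (\<parallel>g\<parallel> + \<parallel>h\<parallel>)\<^sup>2"
    using gh by (simp add: norm_add_sq power2_sum)
  show "0 \<le> \<parallel>g\<parallel> + \<parallel>h\<parallel>"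
    using gh by (simp add: norm_nonneg)
qed

lemma norm_triangle_sub: "g \<in> H \<Longrightarrow> h \<in> H \<Longrightarrow> \<parallel>g\<parallel> \<le> \<parallel>h\<parallel> + \<parallel>g - h\<parallel>"
  using norm_triangle[of h "g - h"] by (simp add: diff_mem)

lemma norm_diff_triangle: "f \<in> H \<Longrightarrow> g \<in> H \<Longrightarrow> h \<in> H \<Longrightarrow> \<parallel>f - h\<parallel> \<le> \<parallel>f - g\<parallel> + \<parallel>g - h\<parallel>"
  using norm_triangle[of "f - g" "g - h"] by (simp add: diff_mem)

lemma abs_norm_diff: "g \<in> H \<Longrightarrow> h \<in> H \<Longrightarrow> \<bar>\<parallel>g\<parallel> - \<parallel>h\<parallel>\<bar> \<le> \<parallel>g - h\<parallel>"
  using norm_triangle_sub[of g h] norm_triangle_sub[of h g] by (simp add: norm_minus_commute)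

section \<open>Continuity and completeness\<close>

lemma norm_tendsto:
  assumes "\<And>n. s n \<in> H" "h \<in> H" "(\<lambda>n. \<parallel>s n - h\<parallel>) \<longlonglongrightarrow> 0"
  shows "(\<lambda>n. \<parallel>s n\<parallel>) \<longlonglongrightarrow> \<parallel>h\<parallel>"
proof -
  have "(\<lambda>n. \<parallel>s n\<parallel> - \<parallel>h\<parallel>) \<longlonglongrightarrow> 0"
    by (rule Lim_null_comparison[OF _ assms(3)]) (use assms abs_norm_diff in auto)
  then show ?thesis by (simp add: LIM_zero_iff)
qed

lemma ip_tendsto:
  assumes "\<And>n. s n \<in> H" "h \<in> H" "(\<lambda>n. \<parallel>s n - h\<parallel>) \<longlonglongrightarrow> 0" "g \<in> H"
  shows "(\<lambda>n. \<langle>s n, g\<rangle>) \<longlonglongrightarrow> \<langle>h, g\<rangle>"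
proof -
  have "(\<lambda>n. \<langle>s n, g\<rangle> - \<langle>h, g\<rangle>) \<longlonglongrightarrow> 0"
  proof (rule Lim_null_comparison)
    show "\<forall>\<^sub>F n in sequentially. cmod (\<langle>s n, g\<rangle> - \<langle>h, g\<rangle>) \<le> \<parallel>s n - h\<parallel> * \<parallel>g\<parallel>"
      using assms Cauchy_Schwarz[of "s _ - h" g] by (auto simp: ip_diff[symmetric] diff_mem)
    show "(\<lambda>n. \<parallel>s n - h\<parallel> * \<parallel>g\<parallel>) \<longlonglongrightarrow> 0"
      using tendsto_mult_left_zero[OF assms(3)] .
  qed
  then show ?thesis by (simp add: LIM_zero_iff)
qed

lemma ip_tendsto_right:
  assumes "\<And>n. s n \<in> H" "h \<in> H" "(\<lambda>n. \<parallel>s n - h\<parallel>) \<longlonglongrightarrow> 0" "g \<in> H"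
  shows "(\<lambda>n. \<langle>g, s n\<rangle>) \<longlonglongrightarrow> \<langle>g, h\<rangle>"
  using tendsto_cnj[OF ip_tendsto[OF assms]] assms by (simp add: ip_cnj[symmetric])

lemma coeff_tendsto:
  assumes "\<And>n. s n \<in> H" "h \<in> H" "(\<lambda>n. \<parallel>s n - h\<parallel>) \<longlonglongrightarrow> 0"
  shows "(\<lambda>n. s n \<alpha>) \<longlonglongrightarrow> h \<alpha>"
proof -
  obtain K where K: "\<forall>h\<in>H. cmod (h \<alpha>) \<le> K * \<parallel>h\<parallel>"
    using coeff_continuous by blast
  have "(\<lambda>n. s n \<alpha> - h \<alpha>) \<longlonglongrightarrow> 0"
  proof (rule Lim_null_comparison)
    show "\<forall>\<^sub>F n in sequentially. cmod (s n \<alpha> - h \<alpha>) \<le> K * \<parallel>s n - h\<parallel>"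
      using assms K[rule_format, OF diff_mem] by auto
    show "(\<lambda>n. K * \<parallel>s n - h\<parallel>) \<longlonglongrightarrow> 0"
      using tendsto_mult_right_zero[OF assms(3)] .
  qed
  then show ?thesis by (simp add: LIM_zero_iff)
qed

text \<open>The squared increments are differences of a monotone bounded real sequence, so the
  Cauchy property is inherited from that sequence. This covers both projections onto increasing
  subspaces and partial sums over growing sets of monomials.\<close>

lemma convergent_of_increments:
  assumes sH: "\<And>n. s n \<in> H" and diff: "\<And>m n. m \<le> n \<Longrightarrow> \<parallel>s n - s m\<parallel>\<^sup>2 = t n - t m"
    and bd: "\<And>n. \<bar>t n\<bar> \<le> B"
  shows "\<exists>k\<in>H. (\<lambda>n. \<parallel>s n - k\<parallel>) \<longlonglongrightarrow> 0"
proof (rule complete[OF sH])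
  have inc: "incseq t" by (rule monoI) (use diff in \<open>metis diff_ge_0_iff_ge zero_le_power2\<close>)
  have "Bseq t" by (rule BseqI'[of t B]) (simp add: bd)
  then have "convergent t" using inc by (intro Bseq_mono_convergent) (auto simp: mono_def)
  then have C: "Cauchy t" by (simp add: Cauchy_convergent_iff)
  fix e :: real assume "e > 0"
  then obtain N where N: "\<And>m n. m \<ge> N \<Longrightarrow> n \<ge> N \<Longrightarrow> \<bar>t m - t n\<bar> < e\<^sup>2"
    using CauchyD[OF C, of "e\<^sup>2"] zero_less_power[of e 2] unfolding real_norm_def by blast
  have "\<parallel>s m - s n\<parallel> < e" if "m \<ge> N" "n \<ge> N" for m n
  proof (rule power2_less_imp_less)
    show "\<parallel>s m - s n\<parallel>\<^sup>2 < e\<^sup>2"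
      using N[OF that] diff[of m n] diff[of n m] norm_minus_commute[OF sH sH, of m n]
      by (cases "m \<le> n") (auto simp: abs_less_iff)
  qed (use \<open>e > 0\<close> in simp)
  then show "\<exists>N. \<forall>m\<ge>N. \<forall>n\<ge>N. \<parallel>s m - s n\<parallel> < e" by blast
qed

lemma approximating_sequence:
  assumes D: "D \<subseteq> H" and dense: "\<And>e. e > 0 \<Longrightarrow> \<exists>p\<in>D. \<parallel>h - p\<parallel> < e" and h: "h \<in> H"
  obtains p where "\<And>n. p n \<in> D" "\<And>n. p n \<in> H" "(\<lambda>n. \<parallel>p n - h\<parallel>) \<longlonglongrightarrow> 0"
proof -
  have "\<exists>p\<in>D. \<parallel>h - p\<parallel> < inverse (real (Suc n))" for n
    by (rule dense) simp
  then obtain p where p: "\<And>n. p n \<in> D" "\<And>n. \<parallel>h - p n\<parallel> < inverse (real (Suc n))"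
    by metis
  have pH: "p n \<in> H" for n using p(1) D by blast
  have "(\<lambda>n. \<parallel>p n - h\<parallel>) \<longlonglongrightarrow> 0"
  proof (rule Lim_null_comparison[OF _ LIMSEQ_inverse_real_of_nat])
    show "\<forall>\<^sub>F n in sequentially. norm \<parallel>p n - h\<parallel> \<le> inverse (real (Suc n))"
      using p(2) norm_minus_commute[OF h pH] norm_nonneg[OF diff_mem[OF h pH]]
      by (auto intro!: always_eventually less_imp_le simp del: of_nat_Suc)
  qed
  then show thesis using that p(1) pH by blast
qed

lemma eq_zero_of_ip: "h \<in> H \<Longrightarrow> (\<And>g. g \<in> H \<Longrightarrow> \<langle>h, g\<rangle> = 0) \<Longrightarrow> h = 0"
  using ip_self norm_eq_0 by fastforce

lemma eq_of_ip: "g \<in> H \<Longrightarrow> h \<in> H \<Longrightarrow> (\<And>f. f \<in> H \<Longrightarrow> \<langle>g, f\<rangle> = \<langle>h, f\<rangle>) \<Longrightarrow> g = h"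
  using eq_zero_of_ip[of "g - h"] by (simp add: ip_diff diff_mem)

lemma eq_of_ip_right:
  assumes "g \<in> H" "h \<in> H" "\<And>f. f \<in> H \<Longrightarrow> \<langle>f, g\<rangle> = \<langle>f, h\<rangle>"
  shows "g = h"
proof (rule eq_of_ip[OF assms(1,2)])
  fix f assume f: "f \<in> H"
  show "\<langle>g, f\<rangle> = \<langle>h, f\<rangle>"
    using ip_cnj[OF f assms(1)] ip_cnj[OF f assms(2)] assms(3)[OF f] by simp
qed

section \<open>Closed subspaces and the projection theorem\<close>

lemma closed_subspaceD:
  assumes "closed_subspace \<H> V"
  shows "V \<subseteq> H" "0 \<in> V" "g \<in> V \<Longrightarrow> h \<in> V \<Longrightarrow> g + h \<in> V" "h \<in> V \<Longrightarrow> scale c h \<in> V"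
    "g \<in> V \<Longrightarrow> h \<in> V \<Longrightarrow> g - h \<in> V"
    "(\<And>n. s n \<in> V) \<Longrightarrow> h \<in> H \<Longrightarrow> (\<lambda>n. \<parallel>s n - h\<parallel>) \<longlonglongrightarrow> 0 \<Longrightarrow> h \<in> V"
proof -
  show "g \<in> V \<Longrightarrow> h \<in> V \<Longrightarrow> g - h \<in> V"
    using assms unfolding closed_subspace_def
    by (metis diff_conv_add_uminus scale_minus_1)
  show "(\<And>n. s n \<in> V) \<Longrightarrow> h \<in> H \<Longrightarrow> (\<lambda>n. \<parallel>s n - h\<parallel>) \<longlonglongrightarrow> 0 \<Longrightarrow> h \<in> V" for s :: "nat \<Rightarrow> 'm series"
    using assms unfolding closed_subspace_def by blast
qed (use assms in \<open>auto simp: closed_subspace_def\<close>)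

lemma parallelogram:
  "g \<in> H \<Longrightarrow> h \<in> H \<Longrightarrow> \<parallel>g + h\<parallel>\<^sup>2 + \<parallel>g - h\<parallel>\<^sup>2 = 2 * \<parallel>g\<parallel>\<^sup>2 + 2 * \<parallel>h\<parallel>\<^sup>2"
  by (simp add: norm_add_sq norm_diff_sq)

text \<open>The parallelogram law makes every minimizing sequence Cauchy; completeness of the space
  and closedness of \<open>V\<close> then give the minimizer.\<close>

lemma nearest_point_exists:
  assumes V: "closed_subspace \<H> V" and h: "h \<in> H"
  shows "\<exists>k\<in>V. \<forall>g\<in>V. \<parallel>h - k\<parallel> \<le> \<parallel>h - g\<parallel>"
proof -
  note VD = closed_subspaceD[OF V]
  have VH: "g \<in> V \<Longrightarrow> g \<in> H" for g using VD(1) by blast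
  define d where "d = (INF g\<in>V. \<parallel>h - g\<parallel>)"
  have bdd: "bdd_below ((\<lambda>g. \<parallel>h - g\<parallel>) ` V)"
    by (intro bdd_belowI[of _ 0]) (auto simp: norm_nonneg diff_mem h VH)
  have d_le: "d \<le> \<parallel>h - g\<parallel>" if "g \<in> V" for g
    unfolding d_def using bdd that by (rule cINF_lower)
  have d0: "0 \<le> d"
    unfolding d_def using VD(2) by (intro cINF_greatest) (auto simp: norm_nonneg diff_mem h VH)
  have "\<exists>g\<in>V. \<parallel>h - g\<parallel> < d + inverse (real (Suc n))" for n
    using cInf_lessD[of "(\<lambda>g. \<parallel>h - g\<parallel>) ` V" "d + inverse (real (Suc n))"] VD(2)
    by (force simp: d_def)
  then obtain s where s: "\<And>n. s n \<in> V" "\<And>n. \<parallel>h - s n\<parallel> < d + inverse (real (Suc n))"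
    by metis
  have lim: "(\<lambda>n. \<parallel>h - s n\<parallel>) \<longlonglongrightarrow> d"
  proof (rule tendsto_sandwich[OF _ _ tendsto_const])
    show "(\<lambda>n. d + inverse (real (Suc n))) \<longlonglongrightarrow> d"
      using tendsto_add[OF tendsto_const LIMSEQ_inverse_real_of_nat, of d] by simp
  qed (use s d_le in \<open>auto intro!: always_eventually less_imp_le simp del: of_nat_Suc\<close>)
  \<comment> \<open>The midpoint of \<open>s m\<close> and \<open>s n\<close> lies in
    \<open>V\<close>, hence is at distance at least \<open>d\<close> from \<open>h\<close>; this
    bounds the first term of the parallelogram law from below.\<close>
  have mid: "\<parallel>s m - s n\<parallel>\<^sup>2 \<le> 2 * \<parallel>h - s m\<parallel>\<^sup>2 + 2 * \<parallel>h - s n\<parallel>\<^sup>2 - 4 * d\<^sup>2" for m n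
  proof -
    define c where "c = scale (1/2) (s m + s n)"
    have cV: "c \<in> V" unfolding c_def using VD s by auto
    have e: "(h - s m) + (h - s n) = scale 2 (h - c)"
      by (auto simp: c_def scale_def fun_eq_iff field_simps)
    have "\<parallel>(h - s m) + (h - s n)\<parallel> = 2 * \<parallel>h - c\<parallel>"
      unfolding e using h VH[OF cV] by (simp add: norm_scale diff_mem)
    then have "2 * d \<le> \<parallel>(h - s m) + (h - s n)\<parallel>"
      using d_le[OF cV] by simp
    then have "(2 * d)\<^sup>2 \<le> \<parallel>(h - s m) + (h - s n)\<parallel>\<^sup>2"
      by (rule power_mono) (use d0 in simp)
    moreover have "\<parallel>(h - s m) - (h - s n)\<parallel> = \<parallel>s m - s n\<parallel>"
      using norm_minus_commute[of "s n" "s m"] VH s by simp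
    ultimately show ?thesis
      using parallelogram[of "h - s m" "h - s n"] h VH s by (simp add: diff_mem power_mult_distrib)
  qed
  have "\<exists>N. \<forall>m\<ge>N. \<forall>n\<ge>N. \<parallel>s m - s n\<parallel> < e" if "e > 0" for e
  proof -
    have "(\<lambda>n. \<parallel>h - s n\<parallel>\<^sup>2) \<longlonglongrightarrow> d\<^sup>2"
      using lim by (intro tendsto_intros)
    then have "\<forall>\<^sub>F n in sequentially. \<parallel>h - s n\<parallel>\<^sup>2 < d\<^sup>2 + e\<^sup>2 / 4"
      by (rule order_tendstoD) (use that in simp)
    \<comment> \<open>With this margin the right-hand side of \<open>mid\<close> is below
      \<open>4 * (d\<^sup>2 + e\<^sup>2 / 4) - 4 * d\<^sup>2\<close>, which equals
      \<open>e\<^sup>2\<close>.\<close>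
    then obtain N where N: "\<And>n. n \<ge> N \<Longrightarrow> \<parallel>h - s n\<parallel>\<^sup>2 < d\<^sup>2 + e\<^sup>2 / 4"
      by (auto simp: eventually_sequentially)
    have "\<parallel>s m - s n\<parallel> < e" if "m \<ge> N" "n \<ge> N" for m n
    proof (rule power2_less_imp_less)
      show "\<parallel>s m - s n\<parallel>\<^sup>2 < e\<^sup>2"
        using mid[of m n] N[OF that(1)] N[OF that(2)] by simp
    qed (use \<open>e > 0\<close> in simp)
    then show ?thesis by blast
  qed
  then obtain k where k: "k \<in> H" "(\<lambda>n. \<parallel>s n - k\<parallel>) \<longlonglongrightarrow> 0"
    using complete[of s] VH s by blast
  have kV: "k \<in> V" using VD(6) s k by blast
  have "(\<lambda>n. \<parallel>s n - h\<parallel>) \<longlonglongrightarrow> d"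
    using lim norm_minus_commute[OF h VH[OF s(1)]] by simp
  moreover have "(\<lambda>n. \<parallel>s n - h\<parallel>) \<longlonglongrightarrow> \<parallel>k - h\<parallel>"
    using norm_tendsto[of "\<lambda>n. s n - h" "k - h"] k VH s h by (simp add: diff_mem)
  ultimately have "\<parallel>k - h\<parallel> = d"
    using LIMSEQ_unique by blast
  then show ?thesis
    using d_le kV k(1) h norm_minus_commute by metis
qed

text \<open>Subtracting the projection of \<open>e\<close> onto the line of \<open>g\<close> lowers
  the squared norm by \<open>|ip e g|^2 / |g|^2\<close>, which the hypothesis permits only if this
  quantity is zero.\<close>

lemma orthogonal_of_norm_le:
  assumes "e \<in> H" "g \<in> H" "\<And>c. \<parallel>e\<parallel> \<le> \<parallel>e - scale c g\<parallel>"
  shows "\<langle>e, g\<rangle> = 0"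
proof (cases "g = 0")
  case True
  then show ?thesis using assms by (simp add: ip_zero_right)
next
  case False
  define c where "c = \<langle>e, g\<rangle> / of_real (\<parallel>g\<parallel>\<^sup>2)"
  have p: "\<parallel>g\<parallel> > 0" using False assms norm_pos by blast
  have "\<parallel>e\<parallel>\<^sup>2 \<le> \<parallel>e - scale c g\<parallel>\<^sup>2"
    using assms by (intro power_mono) (auto simp: norm_nonneg)
  also have "\<dots> = \<parallel>e\<parallel>\<^sup>2 - 2 * Re (cnj c * \<langle>e, g\<rangle>) + (cmod c)\<^sup>2 * \<parallel>g\<parallel>\<^sup>2"
    using assms by (simp add: norm_diff_sq scale_mem ip_scale_right norm_scale power_mult_distrib)
  also have "cnj c * \<langle>e, g\<rangle> = of_real ((cmod \<langle>e, g\<rangle>)\<^sup>2 / \<parallel>g\<parallel>\<^sup>2)"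
    by (simp add: c_def complex_norm_square[symmetric] mult.commute)
  also have "(cmod c)\<^sup>2 * \<parallel>g\<parallel>\<^sup>2 = (cmod \<langle>e, g\<rangle>)\<^sup>2 / \<parallel>g\<parallel>\<^sup>2"
    using p by (simp add: c_def norm_divide norm_power power_divide) (simp add: power2_eq_square power4_eq_xxxx)
  finally have "(cmod \<langle>e, g\<rangle>)\<^sup>2 / \<parallel>g\<parallel>\<^sup>2 \<le> 0"
    by simp
  then show ?thesis
    using p by (simp add: divide_le_eq)
qed

lemma projection_exists:
  assumes V: "closed_subspace \<H> V" and h: "h \<in> H"
  shows "\<exists>k\<in>V. h - k \<in> orth_compl \<H> V"
proof -
  note VD = closed_subspaceD[OF V]
  have VH: "g \<in> V \<Longrightarrow> g \<in> H" for g using VD(1) by blast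
  obtain k where k: "k \<in> V" and near: "\<And>g. g \<in> V \<Longrightarrow> \<parallel>h - k\<parallel> \<le> \<parallel>h - g\<parallel>"
    using nearest_point_exists[OF V h] by blast
  have "\<langle>h - k, g\<rangle> = 0" if g: "g \<in> V" for g
  proof (rule orthogonal_of_norm_le)
    show "\<parallel>h - k\<parallel> \<le> \<parallel>h - k - scale c g\<parallel>" for c
      using near[of "k + scale c g"] VD k g by (simp add: diff_diff_add)
  qed (use h k g VH in \<open>auto simp: diff_mem\<close>)
  then show ?thesis
    using k h VH unfolding orth_compl_def by (auto simp: diff_mem)
qed

lemma orth_projI:
  assumes V: "closed_subspace \<H> V" and "h \<in> H" "k \<in> V" "h - k \<in> orth_compl \<H> V"
  shows "orth_proj \<H> V h = k"
  unfolding orth_proj_def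
proof (rule the_equality)
  fix l assume l: "l \<in> V \<and> h - l \<in> orth_compl \<H> V"
  have H: "k \<in> H" "l \<in> H" using assms l closed_subspaceD[OF V] by auto
  have "l - k \<in> V" using assms l closed_subspaceD(5)[OF V] by blast
  then have "\<langle>h - k, l - k\<rangle> = 0" "\<langle>h - l, l - k\<rangle> = 0"
    using assms l by (auto simp: orth_compl_def)
  then have "\<langle>l - k, l - k\<rangle> = 0"
    using H assms(2) ip_diff[of "h - k" "h - l" "l - k"] by (simp add: diff_mem)
  then show "l = k"
    using H ip_self[of "l - k"] norm_eq_0[of "l - k"] by (simp add: diff_mem)
qed (use assms in auto)

lemma
  assumes V: "closed_subspace \<H> V" and h: "h \<in> H"
  shows orth_proj_mem: "orth_proj \<H> V h \<in> V"
    and orth_proj_orth: "h - orth_proj \<H> V h \<in> orth_compl \<H> V"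
  using projection_exists[OF V h] orth_projI[OF V h] by auto

lemma orth_compl_closed:
  assumes K: "K \<subseteq> H"
  shows "closed_subspace \<H> (orth_compl \<H> K)"
  unfolding closed_subspace_def
proof (intro conjI allI impI)
  fix s h assume *: "\<forall>n. s n \<in> orth_compl \<H> K" "h \<in> H" "(\<lambda>n. \<parallel>s n - h\<parallel>) \<longlonglongrightarrow> 0"
  then have "\<langle>h, k\<rangle> = 0" if "k \<in> K" for k
    using ip_tendsto[of s h k] that K LIMSEQ_unique[OF tendsto_const, of 0 "\<langle>h, k\<rangle>"]
    by (auto simp: orth_compl_def subset_iff)
  then show "h \<in> orth_compl \<H> K" using * by (auto simp: orth_compl_def)
qed (use K in \<open>auto simp: orth_compl_def mems ip_zero_left ip_add ip_scale subset_iff\<close>)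

text \<open>For \<open>h\<close> in the double complement, \<open>h - k\<close> with
  \<open>k\<close> the projection of \<open>h\<close> is orthogonal to \<open>h\<close> as well as
  to \<open>k\<close>, hence to itself.\<close>

lemma orth_compl_orth_compl:
  assumes V: "closed_subspace \<H> V"
  shows "orth_compl \<H> (orth_compl \<H> V) = V"
proof
  have VH: "V \<subseteq> H" using closed_subspaceD(1)[OF V] .
  show "V \<subseteq> orth_compl \<H> (orth_compl \<H> V)"
    using VH ip_cnj by (fastforce simp: orth_compl_def)
  show "orth_compl \<H> (orth_compl \<H> V) \<subseteq> V"
  proof
    fix h assume h: "h \<in> orth_compl \<H> (orth_compl \<H> V)"
    then have hH: "h \<in> H" by (simp add: orth_compl_def)
    define k where "k = orth_proj \<H> V h"
    have k: "k \<in> V" "h - k \<in> orth_compl \<H> V"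
      unfolding k_def using orth_proj_mem[OF V hH] orth_proj_orth[OF V hH] by auto
    have kH: "k \<in> H" using k VH by auto
    have "\<langle>h, h - k\<rangle> = 0" using h k by (simp add: orth_compl_def)
    moreover have "\<langle>h - k, k\<rangle> = 0" using k by (simp add: orth_compl_def)
    then have "\<langle>k, h - k\<rangle> = 0" using ip_cnj[of "h - k" k] hH kH by (simp add: diff_mem)
    ultimately have "\<langle>h - k, h - k\<rangle> = 0"
      using hH kH by (simp add: ip_diff diff_mem)
    then have "h = k"
      using hH kH ip_self[of "h - k"] norm_eq_0[of "h - k"] by (simp add: diff_mem)
    then show "h \<in> V" using k by simp
  qed
qed

section \<open>Adjoint pairs and projections as operators\<close>

lemma adjoint_pairD:
  assumes "adjoint_pair \<H> A B"
  shows "h \<in> H \<Longrightarrow> A h \<in> H" "h \<in> H \<Longrightarrow> B h \<in> H"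
    "g \<in> H \<Longrightarrow> h \<in> H \<Longrightarrow> \<langle>A g, h\<rangle> = \<langle>g, B h\<rangle>"
    "g \<in> H \<Longrightarrow> h \<in> H \<Longrightarrow> \<langle>B g, h\<rangle> = \<langle>g, A h\<rangle>"
proof -
  show *: "h \<in> H \<Longrightarrow> A h \<in> H" "h \<in> H \<Longrightarrow> B h \<in> H" for h
    using assms by (auto simp: adjoint_pair_def)
  show **: "g \<in> H \<Longrightarrow> h \<in> H \<Longrightarrow> \<langle>A g, h\<rangle> = \<langle>g, B h\<rangle>" for g h
    using assms by (auto simp: adjoint_pair_def)
  assume "g \<in> H" "h \<in> H"
  then show "\<langle>B g, h\<rangle> = \<langle>g, A h\<rangle>"
    using **[of h g] ip_cnj[of "B g" h] ip_cnj[of g "A h"] * by simp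
qed

lemma adjoint_pair_sym: "adjoint_pair \<H> A B \<Longrightarrow> adjoint_pair \<H> B A"
  using adjoint_pairD[of A B] unfolding adjoint_pair_def by blast

text \<open>Linearity is automatic: moved to the other side of the inner product, \<open>A\<close>
  becomes \<open>B\<close>, and the inner product is additive.\<close>

lemma adjoint_pair_diff:
  assumes "adjoint_pair \<H> A B" "g \<in> H" "h \<in> H"
  shows "A (g - h) = A g - A h"
  using adjoint_pairD[OF assms(1)] assms(2,3)
  by (intro eq_of_ip) (auto simp: diff_mem ip_diff)

text \<open>The squared norm of \<open>B h\<close> is \<open>Re (ip \<H> (A (B h)) h)\<close>;
  Cauchy-Schwarz and the bound on \<open>A\<close> leave one factor to cancel.\<close>

lemma adjoint_bound:
  assumes "adjoint_pair \<H> A B" "\<And>h. h \<in> H \<Longrightarrow> \<parallel>A h\<parallel> \<le> C * \<parallel>h\<parallel>" and h: "h \<in> H"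
  shows "\<parallel>B h\<parallel> \<le> C * \<parallel>h\<parallel>"
proof (cases "B h = 0")
  case True
  then show ?thesis
    using assms(2)[OF h] norm_nonneg[of "A h"] adjoint_pairD(1)[OF assms(1) h] by simp
next
  case False
  have B: "B h \<in> H" and AB: "A (B h) \<in> H"
    using adjoint_pairD[OF assms(1)] h by auto
  have "\<parallel>B h\<parallel>\<^sup>2 = Re \<langle>A (B h), h\<rangle>"
    using adjoint_pairD(3)[OF assms(1) B h] B by (simp add: norm_sq)
  also have "\<dots> \<le> \<parallel>A (B h)\<parallel> * \<parallel>h\<parallel>"
    using Cauchy_Schwarz[OF AB h] complex_Re_le_cmod order_trans by blast
  also have "\<dots> \<le> C * \<parallel>B h\<parallel> * \<parallel>h\<parallel>"
    using assms(2)[OF B] norm_nonneg[OF h] by (rule mult_right_mono)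
  finally have "\<parallel>B h\<parallel> * \<parallel>B h\<parallel> \<le> (C * \<parallel>h\<parallel>) * \<parallel>B h\<parallel>"
    by (simp add: power2_eq_square mult_ac)
  then show ?thesis
    using norm_pos[OF B False] by simp
qed

lemma orth_proj_self_adjoint:
  assumes V: "closed_subspace \<H> V"
  shows "adjoint_pair \<H> (orth_proj \<H> V) (orth_proj \<H> V)"
proof -
  let ?P = "orth_proj \<H> V"
  have PH: "?P h \<in> H" if "h \<in> H" for h
    using orth_proj_mem[OF V that] closed_subspaceD(1)[OF V] by blast
  have e: "\<langle>g, ?P h\<rangle> = \<langle>?P g, ?P h\<rangle>" if "g \<in> H" "h \<in> H" for g h
    using orth_proj_orth[OF V that(1)] orth_proj_mem[OF V that(2)] that PH
    by (auto simp: orth_compl_def ip_diff)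
  have "\<langle>?P g, h\<rangle> = \<langle>g, ?P h\<rangle>" if "g \<in> H" "h \<in> H" for g h
    using e[OF that] e[OF that(2,1)] that PH ip_cnj by metis
  then show ?thesis using PH unfolding adjoint_pair_def by blast
qed

lemma orth_proj_fixes: "closed_subspace \<H> V \<Longrightarrow> h \<in> V \<Longrightarrow> orth_proj \<H> V h = h"
  using closed_subspaceD(1,2)[of V] by (intro orth_projI) (auto simp: orth_compl_def zero_mem ip_zero_left)

lemma orth_proj_idem: "closed_subspace \<H> V \<Longrightarrow> h \<in> H \<Longrightarrow> orth_proj \<H> V (orth_proj \<H> V h) = orth_proj \<H> V h"
  by (simp add: orth_proj_fixes orth_proj_mem)

lemma orth_proj_Pythagoras:
  assumes V: "closed_subspace \<H> V" and h: "h \<in> H"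
  shows "\<parallel>h\<parallel>\<^sup>2 = \<parallel>orth_proj \<H> V h\<parallel>\<^sup>2 + \<parallel>h - orth_proj \<H> V h\<parallel>\<^sup>2"
proof -
  let ?k = "orth_proj \<H> V h"
  have k: "?k \<in> H" using orth_proj_mem[OF V h] closed_subspaceD(1)[OF V] by blast
  have "\<langle>h - ?k, ?k\<rangle> = 0"
    using orth_proj_orth[OF V h] orth_proj_mem[OF V h] by (simp add: orth_compl_def)
  then have "\<langle>h, ?k\<rangle> = \<langle>?k, ?k\<rangle>" using h k by (simp add: ip_diff)
  then show ?thesis using h k by (simp add: norm_diff_sq norm_sq)
qed

lemma orth_proj_norm_le:
  assumes "closed_subspace \<H> V" "h \<in> H"
  shows "\<parallel>orth_proj \<H> V h\<parallel> \<le> \<parallel>h\<parallel>"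
proof (rule power2_le_imp_le)
  show "\<parallel>orth_proj \<H> V h\<parallel>\<^sup>2 \<le> \<parallel>h\<parallel>\<^sup>2"
    using orth_proj_Pythagoras[OF assms] by simp
qed (rule norm_nonneg[OF assms(2)])

text \<open>As the subspaces increase, Pythagoras makes the squared increments telescope, so the
  projections of \<open>h\<close> have a limit \<open>k\<close>. The difference \<open>h - k\<close>
  is orthogonal to every \<open>L m\<close>, hence zero by \<open>dense\<close>, which expresses
  that the union of the \<open>L n\<close> is dense.\<close>

lemma orth_proj_tendsto:
  fixes L :: "nat \<Rightarrow> 'm series set"
  assumes L: "\<And>n. closed_subspace \<H> (L n)" and mono: "incseq L"
    and dense: "\<And>g. g \<in> H \<Longrightarrow> (\<And>n. g \<in> orth_compl \<H> (L n)) \<Longrightarrow> g = 0"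
    and h: "h \<in> H"
  shows "(\<lambda>n. \<parallel>orth_proj \<H> (L n) h - h\<parallel>) \<longlonglongrightarrow> 0"
proof -
  define s where "s n = orth_proj \<H> (L n) h" for n
  have sL: "s n \<in> L n" for n unfolding s_def using orth_proj_mem[OF L h] .
  have sH: "s n \<in> H" for n using sL closed_subspaceD(1)[OF L] by blast
  have orth: "\<langle>h - s n, g\<rangle> = 0" if "g \<in> L n" for g n
    using orth_proj_orth[OF L h] that unfolding s_def orth_compl_def by blast
  have diff: "\<parallel>s n - s m\<parallel>\<^sup>2 = \<parallel>s n\<parallel>\<^sup>2 - \<parallel>s m\<parallel>\<^sup>2" if "m \<le> n" for m n
  proof -
    have "s m \<in> L n" using sL[of m] monoD[OF mono that] by blast
    then have "\<langle>h - s n, s m\<rangle> = 0" "\<langle>h - s m, s m\<rangle> = 0" using orth sL by auto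
    then have "\<langle>s n, s m\<rangle> = \<langle>s m, s m\<rangle>" using sH h by (simp add: ip_diff)
    then show ?thesis using sH by (simp add: norm_diff_sq norm_sq)
  qed
  have "\<parallel>s n\<parallel>\<^sup>2 \<le> \<parallel>h\<parallel>\<^sup>2" for n
    unfolding s_def using orth_proj_Pythagoras[OF L h, of n] by simp
  then obtain k where k: "k \<in> H" "(\<lambda>n. \<parallel>s n - k\<parallel>) \<longlonglongrightarrow> 0"
    using convergent_of_increments[where s = s and t = "\<lambda>n. \<parallel>s n\<parallel>\<^sup>2", OF sH diff, of "\<parallel>h\<parallel>\<^sup>2"] by auto
  have "h - k \<in> orth_compl \<H> (L m)" for m
  proof -
    have "\<langle>h - k, g\<rangle> = 0" if g: "g \<in> L m" for g
    proof -
      have gH: "g \<in> H" using g closed_subspaceD(1)[OF L] by blast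
      have "\<langle>s n, g\<rangle> = \<langle>h, g\<rangle>" if "m \<le> n" for n
        using orth[of g n] g monoD[OF mono that] sH[of n] h gH by (auto simp: ip_diff)
      then have "\<forall>\<^sub>F n in sequentially. \<langle>s n, g\<rangle> = \<langle>h, g\<rangle>"
        by (rule eventually_sequentiallyI)
      then have "(\<lambda>n. \<langle>s n, g\<rangle>) \<longlonglongrightarrow> \<langle>h, g\<rangle>" by (rule tendsto_eventually)
      then have "\<langle>k, g\<rangle> = \<langle>h, g\<rangle>"
        using ip_tendsto[OF sH k gH] LIMSEQ_unique by blast
      then show ?thesis using h k gH by (simp add: ip_diff)
    qed
    then show ?thesis using h k by (auto simp: orth_compl_def diff_mem)
  qed
  then have "h - k = 0" using dense[of "h - k"] h k by (simp add: diff_mem)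
  then show ?thesis using k(2) unfolding s_def by simp
qed

text \<open>The representing vector is a multiple of \<open>w\<close>, the part orthogonal to the
  kernel of any \<open>u\<close> on which the functional does not vanish. Boundedness is what makes
  the kernel closed, so that \<open>w\<close> exists.\<close>

lemma Riesz_representation:
  assumes add: "\<And>g h. g \<in> H \<Longrightarrow> h \<in> H \<Longrightarrow> \<phi> (g + h) = \<phi> g + \<phi> h"
    and sc: "\<And>c h. h \<in> H \<Longrightarrow> \<phi> (scale c h) = c * \<phi> h"
    and bd: "\<And>h. h \<in> H \<Longrightarrow> cmod (\<phi> h) \<le> K * \<parallel>h\<parallel>"
  shows "\<exists>k\<in>H. \<forall>h\<in>H. \<phi> h = \<langle>h, k\<rangle>"
proof (cases "\<forall>h\<in>H. \<phi> h = 0")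
  case True
  then show ?thesis using zero_mem ip_zero_right by force
next
  case False
  then obtain u where u: "u \<in> H" "\<phi> u \<noteq> 0" by blast
  define V where "V = {h \<in> H. \<phi> h = 0}"
  have \<phi>0: "\<phi> 0 = 0" using sc[of 0 0] zero_mem by simp
  have \<phi>d: "\<phi> (g - h) = \<phi> g - \<phi> h" if "g \<in> H" "h \<in> H" for g h
    using add[of g "scale (-1) h"] sc[of h "-1"] that by (simp add: scale_mem scale_minus_1 minus_mem)
  have V: "closed_subspace \<H> V"
    unfolding closed_subspace_def
  proof (intro conjI allI impI)
    fix s h assume *: "\<forall>n. s n \<in> V" "h \<in> H" "(\<lambda>n. \<parallel>s n - h\<parallel>) \<longlonglongrightarrow> 0"
    have "(\<lambda>n. - \<phi> h) \<longlonglongrightarrow> 0"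
    proof (rule Lim_null_comparison)
      show "\<forall>\<^sub>F n in sequentially. cmod (- \<phi> h) \<le> K * \<parallel>s n - h\<parallel>"
        using * bd[of "s _ - h"] by (auto simp: V_def \<phi>d diff_mem)
      show "(\<lambda>n. K * \<parallel>s n - h\<parallel>) \<longlonglongrightarrow> 0"
        using tendsto_mult_right_zero[OF *(3)] .
    qed
    then show "h \<in> V" using * by (simp add: V_def LIMSEQ_const_iff)
  qed (auto simp: V_def \<phi>0 add sc mems)
  define w where "w = u - orth_proj \<H> V u"
  have pu: "orth_proj \<H> V u \<in> H" "\<phi> (orth_proj \<H> V u) = 0"
    using orth_proj_mem[OF V u(1)] by (auto simp: V_def)
  have w: "w \<in> H" "\<phi> w \<noteq> 0" "w \<noteq> 0"
    using u pu \<phi>d[of u "orth_proj \<H> V u"] \<phi>0 unfolding w_def by (auto simp: diff_mem)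
  have orth: "\<langle>w, h\<rangle> = 0" if "h \<in> H" "\<phi> h = 0" for h
    using orth_proj_orth[OF V u(1)] that unfolding w_def orth_compl_def V_def by blast
  define k where "k = scale (cnj (\<phi> w) / of_real (\<parallel>w\<parallel>\<^sup>2)) w"
  have wp: "\<parallel>w\<parallel> > 0" using w norm_pos by blast
  have "\<phi> h = \<langle>h, k\<rangle>" if h: "h \<in> H" for h
  proof -
    \<comment> \<open>This combination lies in the kernel by construction; its orthogonality to
      \<open>w\<close> is the desired formula up to the factor in \<open>k\<close>.\<close>
    define g where "g = scale (\<phi> w) h - scale (\<phi> h) w"
    have "\<phi> g = 0" "g \<in> H" unfolding g_def using h w by (auto simp: \<phi>d sc mems)
    then have "\<langle>g, w\<rangle> = 0" using orth[of g] ip_cnj[of w g] w by simp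
    then have "\<phi> w * \<langle>h, w\<rangle> = \<phi> h * of_real (\<parallel>w\<parallel>\<^sup>2)"
      unfolding g_def using h w by (simp add: ip_diff ip_scale mems ip_self)
    then show ?thesis
      unfolding k_def using h w wp by (simp add: ip_scale_right field_simps)
  qed
  moreover have "k \<in> H" unfolding k_def using w(1) by (rule scale_mem)
  ultimately show ?thesis by blast
qed

lemma adj_eqI:
  assumes T: "adjoint_pair \<H> T B" and h: "h \<in> H"
  shows "adj \<H> T h = B h"
  unfolding adj_def
proof (rule the_equality)
  show "B h \<in> H \<and> (\<forall>g\<in>H. \<langle>T g, h\<rangle> = \<langle>g, B h\<rangle>)"
    using adjoint_pairD[OF T] h by blast
  fix k assume k: "k \<in> H \<and> (\<forall>g\<in>H. \<langle>T g, h\<rangle> = \<langle>g, k\<rangle>)"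
  show "k = B h"
  proof (rule eq_of_ip_right)
    show "\<langle>f, k\<rangle> = \<langle>f, B h\<rangle>" if "f \<in> H" for f
      using k that adjoint_pairD(3)[OF T that h] by simp
  qed (use k adjoint_pairD(2)[OF T h] in auto)
qed

text \<open>Riesz representation of the functionals \<open>ip \<H> (T g) h\<close> in
  \<open>g\<close> supplies the vector that the definite description in \<open>adj\<close> refers
  to.\<close>

lemma adjoint_pair_adj:
  assumes mem: "\<And>h. h \<in> H \<Longrightarrow> T h \<in> H"
    and add: "\<And>g h. g \<in> H \<Longrightarrow> h \<in> H \<Longrightarrow> T (g + h) = T g + T h"
    and sc: "\<And>c h. h \<in> H \<Longrightarrow> T (scale c h) = scale c (T h)"
    and bd: "\<And>h. h \<in> H \<Longrightarrow> \<parallel>T h\<parallel> \<le> K * \<parallel>h\<parallel>"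
  shows "adjoint_pair \<H> T (adj \<H> T)"
proof -
  have "\<exists>k\<in>H. \<forall>g\<in>H. \<langle>T g, h\<rangle> = \<langle>g, k\<rangle>" if h: "h \<in> H" for h
  proof (rule Riesz_representation[where \<phi> = "\<lambda>g. \<langle>T g, h\<rangle>" and K = "K * \<parallel>h\<parallel>"])
    fix g assume g: "g \<in> H"
    have "cmod \<langle>T g, h\<rangle> \<le> \<parallel>T g\<parallel> * \<parallel>h\<parallel>" by (rule Cauchy_Schwarz[OF mem[OF g] h])
    also have "\<dots> \<le> K * \<parallel>g\<parallel> * \<parallel>h\<parallel>" using bd[OF g] norm_nonneg[OF h] by (rule mult_right_mono)
    finally show "cmod \<langle>T g, h\<rangle> \<le> (K * \<parallel>h\<parallel>) * \<parallel>g\<parallel>" by (simp add: mult_ac)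
    show "\<langle>T (scale c g), h\<rangle> = c * \<langle>T g, h\<rangle>" for c
      by (simp only: sc[OF g] ip_scale[OF mem[OF g] h])
    fix f assume f: "f \<in> H"
    show "\<langle>T (g + f), h\<rangle> = \<langle>T g, h\<rangle> + \<langle>T f, h\<rangle>"
      by (simp only: add[OF g f] ip_add[OF mem[OF g] mem[OF f] h])
  qed
  then have "\<forall>h\<in>H. \<exists>k. k \<in> H \<and> (\<forall>g\<in>H. \<langle>T g, h\<rangle> = \<langle>g, k\<rangle>)"
    by blast
  from bchoice[OF this] obtain B where B: "\<forall>h\<in>H. B h \<in> H \<and> (\<forall>g\<in>H. \<langle>T g, h\<rangle> = \<langle>g, B h\<rangle>)"
    by blast
  have *: "adjoint_pair \<H> T B"
    unfolding adjoint_pair_def using B by (simp add: mem)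
  then show ?thesis
    using adj_eqI[OF *] by (simp add: adjoint_pair_def)
qed

section \<open>Operator norms as suprema over the unit ball\<close>

lemma opnorm_le:
  assumes "\<And>h. h \<in> H \<Longrightarrow> \<parallel>h\<parallel> \<le> 1 \<Longrightarrow> \<parallel>T h\<parallel> \<le> c"
  shows "opnorm \<H> T \<le> c"
  unfolding opnorm_def
proof (rule cSUP_least)
  have "0 \<in> {h \<in> H. \<parallel>h\<parallel> \<le> 1}" by (simp add: zero_mem)
  then show "{h \<in> H. \<parallel>h\<parallel> \<le> 1} \<noteq> {}" by blast
qed (use assms in auto)

text \<open>Some bound \<open>K\<close> must be supplied: a real supremum dominates its elements
  only when the set is bounded above.\<close>

lemma le_opnorm:
  assumes "\<And>h. h \<in> H \<Longrightarrow> \<parallel>T h\<parallel> \<le> K * \<parallel>h\<parallel>" "K \<ge> 0" "h \<in> H" "\<parallel>h\<parallel> \<le> 1"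
  shows "\<parallel>T h\<parallel> \<le> opnorm \<H> T"
  unfolding opnorm_def
proof (rule cSUP_upper)
  have "\<parallel>T h\<parallel> \<le> K" if "h \<in> H" "\<parallel>h\<parallel> \<le> 1" for h
    using assms(1)[OF that(1)] mult_left_mono[OF that(2) assms(2)] by simp
  then show "bdd_above ((\<lambda>h. \<parallel>T h\<parallel>) ` {h \<in> H. \<parallel>h\<parallel> \<le> 1})"
    by (intro bdd_aboveI) auto
qed (use assms in auto)

lemma norm_le_opnorm:
  assumes "\<And>h. h \<in> H \<Longrightarrow> T h \<in> H" "\<And>c h. h \<in> H \<Longrightarrow> T (scale c h) = scale c (T h)"
    and "\<And>h. h \<in> H \<Longrightarrow> \<parallel>T h\<parallel> \<le> K * \<parallel>h\<parallel>" "K \<ge> 0" and h: "h \<in> H"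
  shows "\<parallel>T h\<parallel> \<le> opnorm \<H> T * \<parallel>h\<parallel>"
proof (cases "h = 0")
  case True
  then show ?thesis using assms(3)[OF zero_mem] by simp
next
  case False
  have p: "\<parallel>h\<parallel> > 0" using norm_pos h False by blast
  define u where "u = scale (of_real (inverse \<parallel>h\<parallel>)) h"
  have "\<parallel>u\<parallel> = 1" "u \<in> H" unfolding u_def using h p by (simp_all add: norm_scale scale_mem norm_inverse)
  then have "\<parallel>T u\<parallel> \<le> opnorm \<H> T" using le_opnorm[OF assms(3,4), of u] by simp
  moreover have "\<parallel>T u\<parallel> = inverse \<parallel>h\<parallel> * \<parallel>T h\<parallel>"
    unfolding u_def assms(2)[OF h] norm_scale[OF assms(1)[OF h]] using p by (simp add: norm_inverse)
  ultimately show ?thesis using p by (simp add: field_simps)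
qed

end

section \<open>Committee spaces\<close>

text \<open>Words present both kinds of indices, so the facts are read off from words or from
  multisets. A fibre of \<open>f\<close> consists of the rearrangements of one word in the commuting
  case and of a single word otherwise.\<close>

lemma multi_indices_words:
  fixes var :: "'i \<Rightarrow> 'm::monoid_add"
  assumes "multi_indices var"
  defines "f \<equiv> \<lambda>w. \<Sum>i\<leftarrow>w. var i"
  shows "surj f" "finite {u. f u = f w}" "f (u @ v) = f (u' @ v) \<Longrightarrow> f u = f u'"
    "f (u @ v) = f (u @ v') \<Longrightarrow> f v = f v'"
proof -
  have "surj f \<and> finite {u. f u = f w} \<and> (f (u @ v) = f (u' @ v) \<longrightarrow> f u = f u') \<and>
      (f (u @ v) = f (u @ v') \<longrightarrow> f v = f v')"
    using assms(1) unfolding multi_indices_def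
  proof
    assume "commuting_indices var"
    then obtain \<phi> :: "'i multiset \<Rightarrow> 'm" where \<phi>: "bij \<phi>" "\<And>w. f w = \<phi> (mset w)"
      unfolding commuting_indices_def f_def by blast
    have "surj (\<lambda>w::'i list. mset w)" using ex_mset by (metis surj_def)
    then have "surj (\<phi> \<circ> mset)" using \<phi>(1) by (intro comp_surj) (auto simp: bij_def)
    moreover have "{u. f u = f w} = {u. mset u = mset w}"
      using \<phi> by (auto simp: bij_def inj_eq)
    ultimately show ?thesis
      using \<phi> mset_eq_finite[of w] by (auto simp: bij_def inj_eq comp_def)
  next
    assume "noncommuting_indices var"
    then have b: "bij f" unfolding noncommuting_indices_def f_def .
    then have "{u. f u = f w} = {w}" by (auto simp: bij_def inj_eq)
    then show ?thesis using b by (auto simp: bij_def inj_eq)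
  qed
  then show "surj f" "finite {u. f u = f w}" "f (u @ v) = f (u' @ v) \<Longrightarrow> f u = f u'"
      "f (u @ v) = f (u @ v') \<Longrightarrow> f v = f v'"
    by blast+
qed

lemma multi_indices_countable:
  fixes var :: "'i::countable \<Rightarrow> 'm::monoid_add"
  assumes "multi_indices var"
  shows "countable (UNIV :: 'm set)"
  using multi_indices_words(1)[OF assms] by (metis countableI_type countable_image)

text \<open>Every decomposition arises by cutting some word for \<open>\<gamma>\<close> in two;
  there are finitely many such words, and each has finitely many cuts.\<close>

lemma multi_indices_finite_decompositions:
  fixes var :: "'i \<Rightarrow> 'm::monoid_add" and \<gamma> :: 'm
  assumes "multi_indices var"
  shows "finite {(\<alpha>, \<beta>). \<alpha> + \<beta> = \<gamma>}"
proof -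
  let ?f = "\<lambda>w. \<Sum>i\<leftarrow>w. var i"
  note words = multi_indices_words[OF assms]
  obtain w where w: "\<gamma> = ?f w" using words(1) by (metis surjD)
  let ?E = "{u. ?f u = ?f w}"
  have "{(\<alpha>, \<beta>). \<alpha> + \<beta> = \<gamma>} \<subseteq> (\<lambda>(u, k). (?f (take k u), ?f (drop k u))) ` (SIGMA u:?E. {..length u})"
  proof clarify
    fix \<alpha> \<beta> assume g: "\<gamma> = \<alpha> + \<beta>"
    obtain u v where "\<alpha> = ?f u" "\<beta> = ?f v" using words(1) by (metis surjD)
    then show "(\<alpha>, \<beta>) \<in> (\<lambda>(u, k). (?f (take k u), ?f (drop k u))) ` (SIGMA u:?E. {..length u})"
      using g w by (intro image_eqI[of _ _ "(u @ v, length u)"]) auto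
  qed
  moreover have "finite (SIGMA u:?E. {..length u})" using words(2) by (intro finite_SigmaI) auto
  ultimately show ?thesis using finite_surj by blast
qed

lemma multi_indices_cancel_right:
  fixes var :: "'i \<Rightarrow> 'm::monoid_add" and \<beta> \<gamma> \<gamma>' :: 'm
  assumes "multi_indices var" "\<gamma> + \<beta> = \<gamma>' + \<beta>"
  shows "\<gamma> = \<gamma>'"
proof -
  let ?f = "\<lambda>w. \<Sum>i\<leftarrow>w. var i"
  obtain u v u' where "\<gamma> = ?f u" "\<beta> = ?f v" "\<gamma>' = ?f u'"
    using multi_indices_words(1)[OF assms(1)] by (metis surjD)
  then show ?thesis using multi_indices_words(3)[OF assms(1), of u v u'] assms(2) by simp
qed

lemma multi_indices_cancel_left:
  fixes var :: "'i \<Rightarrow> 'm::monoid_add" and \<beta> \<beta>' \<gamma> :: 'm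
  assumes "multi_indices var" "\<gamma> + \<beta> = \<gamma> + \<beta>'"
  shows "\<beta> = \<beta>'"
proof -
  let ?f = "\<lambda>w. \<Sum>i\<leftarrow>w. var i"
  obtain u v v' where "\<gamma> = ?f u" "\<beta> = ?f v" "\<beta>' = ?f v'"
    using multi_indices_words(1)[OF assms(1)] by (metis surjD)
  then show ?thesis using multi_indices_words(4)[OF assms(1), of u v v'] assms(2) by simp
qed

section \<open>Truncations and a countable dense set of polynomials\<close>

definition truncation :: "'m set \<Rightarrow> 'm series \<Rightarrow> 'm series" where
  "truncation F h = (\<lambda>\<alpha>. if \<alpha> \<in> F then h \<alpha> else 0)"

lemma sum_series_apply: "(\<Sum>i\<in>I. f i) \<alpha> = (\<Sum>i\<in>I. f i \<alpha> :: complex)"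
  by (induction I rule: infinite_finite_induct) auto

lemma truncation_eq_sum: "finite F \<Longrightarrow> truncation F h = (\<Sum>\<alpha>\<in>F. scale (h \<alpha>) (monomial \<alpha>))"
  by (auto simp: fun_eq_iff truncation_def sum_series_apply scale_def monomial_def if_distrib[of "\<lambda>x. _ * x"] sum.delta' cong: if_cong)

lemma truncation_diff: "truncation F (g - h) = truncation F g - truncation F h"
  by (auto simp: truncation_def fun_eq_iff)

lemma polynomial_truncation: "finite F \<Longrightarrow> polynomial (truncation F h)"
  unfolding polynomial_def by (rule finite_subset[of _ F]) (auto simp: truncation_def)

lemma polynomial_monomial: "polynomial (monomial \<alpha>)"
  unfolding polynomial_def by (rule finite_subset[of _ "{\<alpha>}"]) (auto simp: monomial_def)

lemma truncation_superset: "{\<alpha>. p \<alpha> \<noteq> 0} \<subseteq> F \<Longrightarrow> truncation F p = p"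
  by (auto simp: truncation_def fun_eq_iff)

lemma monomial_nonzero: "monomial \<alpha> \<noteq> 0"
  by (auto simp: monomial_def fun_eq_iff)

definition dense_coeffs :: "complex set" where
  "dense_coeffs = (SOME Q. countable Q \<and> (\<forall>X. open X \<longrightarrow> X \<noteq> {} \<longrightarrow> (\<exists>q\<in>Q. q \<in> X)))"

text \<open>Lists of terms are used instead of finitely supported functions: countability is then
  that of a set of lists, and repeated indices are harmless because the terms are added up.\<close>

definition dense_polys :: "('m::monoid_add) series set" where
  "dense_polys = (\<lambda>l. \<Sum>(\<alpha>, c)\<leftarrow>l. scale c (monomial \<alpha>)) ` lists (UNIV \<times> dense_coeffs)"

lemma dense_coeffs: "countable dense_coeffs" "open X \<Longrightarrow> X \<noteq> {} \<Longrightarrow> \<exists>q\<in>dense_coeffs. q \<in> X"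
proof -
  have "\<exists>Q :: complex set. countable Q \<and> (\<forall>X. open X \<longrightarrow> X \<noteq> {} \<longrightarrow> (\<exists>q\<in>Q. q \<in> X))"
    using countable_dense_exists .
  then have "countable dense_coeffs \<and> (\<forall>X. open X \<longrightarrow> X \<noteq> {} \<longrightarrow> (\<exists>q\<in>dense_coeffs. q \<in> X))"
    unfolding dense_coeffs_def by (rule someI_ex)
  then show "countable dense_coeffs" "open X \<Longrightarrow> X \<noteq> {} \<Longrightarrow> \<exists>q\<in>dense_coeffs. q \<in> X"
    by auto
qed

lemma dense_coeffs_near: "e > 0 \<Longrightarrow> \<exists>q\<in>dense_coeffs. cmod (c - q) < e"
  using dense_coeffs(2)[of "ball c e"] by (auto simp: dist_norm)

lemma countable_dense_polys: "countable (UNIV :: 'm set) \<Longrightarrow> countable (dense_polys :: ('m::monoid_add) series set)"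
  unfolding dense_polys_def using dense_coeffs(1) by (intro countable_image countable_lists countable_SIGMA) auto

lemma dense_polys_zero: "0 \<in> dense_polys"
  unfolding dense_polys_def by (rule image_eqI[of _ _ "[]"]) auto

lemma dense_polys_add_monomial:
  assumes "p \<in> dense_polys" "q \<in> dense_coeffs"
  shows "scale q (monomial \<alpha>) + p \<in> dense_polys"
proof -
  obtain l where "p = (\<Sum>(\<alpha>, c)\<leftarrow>l. scale c (monomial \<alpha>))" "l \<in> lists (UNIV \<times> dense_coeffs)"
    using assms(1) unfolding dense_polys_def by blast
  then show ?thesis unfolding dense_polys_def
    using assms(2) by (intro image_eqI[of _ _ "(\<alpha>, q) # l"]) auto
qed

lemma dense_polys_polynomial: "p \<in> dense_polys \<Longrightarrow> polynomial p"
proof -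
  have "polynomial (\<Sum>(\<alpha>, c)\<leftarrow>l. scale c (monomial \<alpha> :: 'm series))" for l
  proof (induction l)
    case Nil
    then show ?case by (simp add: polynomial_def)
  next
    case (Cons a l)
    let ?p = "\<Sum>(\<alpha>, c)\<leftarrow>l. scale c (monomial \<alpha>)"
    have "{\<alpha>. (\<Sum>(\<alpha>, c)\<leftarrow>a # l. scale c (monomial \<alpha>)) \<alpha> \<noteq> 0} \<subseteq> insert (fst a) {\<alpha>. ?p \<alpha> \<noteq> 0}"
      by (auto simp: scale_def monomial_def split: prod.splits if_splits)
    then show ?case using Cons unfolding polynomial_def by (meson finite_insert finite_subset)
  qed
  then show "p \<in> dense_polys \<Longrightarrow> polynomial p" unfolding dense_polys_def by blast
qed

context committee_space
begin

abbreviation weight :: "'m \<Rightarrow> real" where "weight \<alpha> \<equiv> \<parallel>monomial \<alpha>\<parallel>"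

lemma monomial_mem: "monomial \<alpha> \<in> H"
  by (simp add: polynomial_mem polynomial_monomial)

lemma weight_pos: "0 < weight \<alpha>"
  by (simp add: norm_pos monomial_mem monomial_nonzero)

lemma truncation_mem: "finite F \<Longrightarrow> truncation F h \<in> H"
  by (simp add: polynomial_mem polynomial_truncation)

lemma ip_truncation_monomial:
  assumes F: "finite F"
  shows "\<langle>truncation F h, monomial \<alpha>\<rangle> = truncation F h \<alpha> * of_real ((weight \<alpha>)\<^sup>2)"
proof -
  have "\<langle>truncation F h, monomial \<alpha>\<rangle> = (\<Sum>\<beta>\<in>F. h \<beta> * \<langle>monomial \<beta>, monomial \<alpha>\<rangle>)"
    using F by (simp add: truncation_eq_sum ip_sum scale_mem monomial_mem ip_scale)
  also have "\<dots> = (\<Sum>\<beta>\<in>F. if \<beta> = \<alpha> then h \<alpha> * of_real ((weight \<alpha>)\<^sup>2) else 0)"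
    by (intro sum.cong) (auto simp: monomials_orthogonal ip_self monomial_mem)
  also have "\<dots> = truncation F h \<alpha> * of_real ((weight \<alpha>)\<^sup>2)"
    using F by (simp add: truncation_def)
  finally show ?thesis .
qed

text \<open>Orthogonality of the monomials gives this for polynomials. Continuity of the coefficient
  functionals lets both sides pass to norm limits.\<close>

lemma ip_monomial:
  assumes h: "h \<in> H"
  shows "\<langle>h, monomial \<alpha>\<rangle> = h \<alpha> * of_real ((weight \<alpha>)\<^sup>2)"
proof -
  obtain p where p: "\<And>n. p n \<in> Collect polynomial" and pH: "\<And>n. p n \<in> H" and lim: "(\<lambda>n. \<parallel>p n - h\<parallel>) \<longlonglongrightarrow> 0"
    using approximating_sequence[of "Collect polynomial" h] polynomials_dense[OF h] polynomial_mem h by blast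
  have "\<langle>p n, monomial \<alpha>\<rangle> = p n \<alpha> * of_real ((weight \<alpha>)\<^sup>2)" for n
    using ip_truncation_monomial[of "{\<beta>. p n \<beta> \<noteq> 0}" "p n" \<alpha>] p[of n]
    by (simp add: polynomial_def truncation_superset)
  then have "(\<lambda>n. p n \<alpha> * of_real ((weight \<alpha>)\<^sup>2)) \<longlonglongrightarrow> \<langle>h, monomial \<alpha>\<rangle>"
    using ip_tendsto[OF pH h lim monomial_mem, of \<alpha>] by simp
  moreover have "(\<lambda>n. p n \<alpha> * of_real ((weight \<alpha>)\<^sup>2)) \<longlonglongrightarrow> h \<alpha> * of_real ((weight \<alpha>)\<^sup>2)"
    by (intro tendsto_intros coeff_tendsto pH h lim)
  ultimately show ?thesis using LIMSEQ_unique by blast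
qed

lemma ip_truncation:
  assumes "finite F" "h \<in> H"
  shows "\<langle>h, truncation F g\<rangle> = (\<Sum>\<alpha>\<in>F. h \<alpha> * cnj (g \<alpha>) * of_real ((weight \<alpha>)\<^sup>2))"
  using assms by (simp add: truncation_eq_sum ip_sum_right scale_mem monomial_mem ip_scale_right ip_monomial mult_ac)

lemma norm_truncation_sq:
  assumes "finite F"
  shows "\<parallel>truncation F h\<parallel>\<^sup>2 = (\<Sum>\<alpha>\<in>F. (cmod (h \<alpha>))\<^sup>2 * (weight \<alpha>)\<^sup>2)"
proof -
  have "of_real (\<parallel>truncation F h\<parallel>\<^sup>2) = (\<Sum>\<alpha>\<in>F. h \<alpha> * cnj (h \<alpha>) * of_real ((weight \<alpha>)\<^sup>2))"
    using ip_truncation[OF assms truncation_mem[OF assms], of h h] ip_self[OF truncation_mem[OF assms], of h]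
    by (simp add: truncation_def cong: sum.cong)
  also have "\<dots> = of_real (\<Sum>\<alpha>\<in>F. (cmod (h \<alpha>))\<^sup>2 * (weight \<alpha>)\<^sup>2)"
    by (simp add: complex_norm_square[symmetric])
  finally show ?thesis using of_real_eq_iff by blast
qed

lemma truncation_orthogonal:
  assumes "finite F" "h \<in> H"
  shows "\<langle>h - truncation F h, truncation F g\<rangle> = 0"
  using assms by (simp add: ip_truncation diff_mem truncation_mem) (simp add: truncation_def)

text \<open>By orthogonality of the monomials, \<open>truncation F\<close> is the orthogonal
  projection onto the span of those with index in \<open>F\<close>.\<close>

lemma truncation_best_approximation:
  assumes "finite F" "h \<in> H"
  shows "\<parallel>h - truncation F h\<parallel> \<le> \<parallel>h - truncation F p\<parallel>"
proof (rule power2_le_imp_le)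
  have e: "h - truncation F p = (h - truncation F h) + truncation F (h - p)" by (simp add: truncation_diff)
  have "\<parallel>h - truncation F p\<parallel>\<^sup>2 = \<parallel>h - truncation F h\<parallel>\<^sup>2 + \<parallel>truncation F (h - p)\<parallel>\<^sup>2"
    unfolding e using assms by (simp add: norm_add_sq truncation_mem diff_mem truncation_orthogonal)
  then show "\<parallel>h - truncation F h\<parallel>\<^sup>2 \<le> \<parallel>h - truncation F p\<parallel>\<^sup>2" by simp
qed (use assms in \<open>simp add: norm_nonneg diff_mem truncation_mem\<close>)

lemma norm_truncation_le:
  assumes "finite F" "h \<in> H"
  shows "\<parallel>truncation F h\<parallel> \<le> \<parallel>h\<parallel>"
proof (rule power2_le_imp_le)
  have "\<parallel>(h - truncation F h) + truncation F h\<parallel>\<^sup>2 = \<parallel>h - truncation F h\<parallel>\<^sup>2 + \<parallel>truncation F h\<parallel>\<^sup>2"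
    using assms by (simp only: norm_add_sq truncation_mem diff_mem truncation_orthogonal) simp
  then show "\<parallel>truncation F h\<parallel>\<^sup>2 \<le> \<parallel>h\<parallel>\<^sup>2" by simp
qed (use assms in \<open>simp add: norm_nonneg\<close>)

lemma dense_polys_mem: "p \<in> dense_polys \<Longrightarrow> p \<in> H"
  by (simp add: dense_polys_polynomial polynomial_mem)

lemma dense_polys_dense:
  assumes h: "h \<in> H" and "e > 0"
  shows "\<exists>p\<in>dense_polys. \<parallel>h - p\<parallel> < e"
proof -
  have *: "\<exists>p\<in>dense_polys. \<parallel>(\<Sum>\<alpha>\<in>F. scale (c \<alpha>) (monomial \<alpha>)) - p\<parallel> < e"
    if "finite F" "e > 0" for F e and c :: "'m \<Rightarrow> complex"
    using that
  proof (induction F arbitrary: e)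
    case empty
    then show ?case using dense_polys_zero by (intro bexI[of _ 0]) (simp_all only: sum.empty diff_self norm_zero)
  next
    case (insert \<alpha> F)
    let ?s = "\<Sum>\<alpha>\<in>F. scale (c \<alpha>) (monomial \<alpha>)"
    have sH: "?s \<in> H" by (intro mems monomial_mem)
    obtain p where p: "p \<in> dense_polys" "\<parallel>?s - p\<parallel> < e / 2"
      using insert.IH[of "e / 2"] half_gt_zero[OF insert.prems] by blast
    \<comment> \<open>Dividing by the weight compensates for the norm of the monomial, so that this
      term contributes less than \<open>e / 2\<close>.\<close>
    obtain q where q: "q \<in> dense_coeffs" "cmod (c \<alpha> - q) < e / (2 * weight \<alpha>)"
      using dense_coeffs_near[of "e / (2 * weight \<alpha>)" "c \<alpha>"] insert.prems weight_pos by auto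
    have e: "(\<Sum>\<alpha>\<in>insert \<alpha> F. scale (c \<alpha>) (monomial \<alpha>)) - (scale q (monomial \<alpha>) + p)
        = scale (c \<alpha> - q) (monomial \<alpha>) + (?s - p)"
      using insert.hyps by (simp add: scale_def fun_eq_iff algebra_simps)
    have "\<parallel>scale (c \<alpha> - q) (monomial \<alpha>) + (?s - p)\<parallel>
        \<le> \<parallel>scale (c \<alpha> - q) (monomial \<alpha>)\<parallel> + \<parallel>?s - p\<parallel>"
      using sH p(1) by (intro norm_triangle mems monomial_mem dense_polys_mem)
    also have "\<parallel>scale (c \<alpha> - q) (monomial \<alpha>)\<parallel> < e / 2"
      using q(2) weight_pos[of \<alpha>] by (simp add: norm_scale monomial_mem field_simps)
    finally have "\<parallel>scale (c \<alpha> - q) (monomial \<alpha>) + (?s - p)\<parallel> < e"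
      using p(2) by linarith
    then show ?case
      unfolding e[symmetric] by (rule bexI[OF _ dense_polys_add_monomial[OF p(1) q(1)]])
  qed
  obtain g where g: "polynomial g" "\<parallel>h - g\<parallel> < e / 2"
    using polynomials_dense[OF h, of "e / 2"] \<open>e > 0\<close> by auto
  have gs: "g = (\<Sum>\<alpha>\<in>{\<alpha>. g \<alpha> \<noteq> 0}. scale (g \<alpha>) (monomial \<alpha>))"
    using truncation_eq_sum[of "{\<alpha>. g \<alpha> \<noteq> 0}" g] g(1) by (simp add: polynomial_def truncation_superset)
  obtain p where p: "p \<in> dense_polys" "\<parallel>g - p\<parallel> < e / 2"
    using *[of "{\<alpha>. g \<alpha> \<noteq> 0}" "e / 2" g] g(1) \<open>e > 0\<close> gs by (auto simp: polynomial_def)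
  have "\<parallel>h - p\<parallel> \<le> \<parallel>h - g\<parallel> + \<parallel>g - p\<parallel>"
    by (rule norm_diff_triangle[OF h polynomial_mem[OF g(1)] dense_polys_mem[OF p(1)]])
  then show ?thesis using g p by (intro bexI[of _ p]) auto
qed

end

locale indexed_committee_space = committee_space \<H>
  for \<H> :: "('m::monoid_add) series_space" +
  assumes countable_indices: "countable (UNIV :: 'm set)"
    and finite_decompositions: "finite {(\<alpha>, \<beta>). \<alpha> + \<beta> = (\<gamma> :: 'm)}"
    and cancel_right: "\<gamma> + \<beta> = \<gamma>' + \<beta> \<Longrightarrow> \<gamma> = (\<gamma>' :: 'm)"
    and cancel_left: "\<gamma> + \<beta> = \<gamma> + \<beta>' \<Longrightarrow> \<beta> = (\<beta>' :: 'm)"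
begin

section \<open>Exhaustion of the index set and membership by coefficients\<close>

definition first_indices :: "nat \<Rightarrow> 'm set" where "first_indices n = from_nat_into UNIV ` {..<n}"

lemma finite_first_indices [simp]: "finite (first_indices n)"
  by (simp add: first_indices_def)

lemma first_indices_mono: "m \<le> n \<Longrightarrow> first_indices m \<subseteq> first_indices n"
  by (auto simp: first_indices_def)

lemma mem_first_indices: "\<exists>n. \<alpha> \<in> first_indices n"
proof -
  obtain k where "from_nat_into UNIV k = \<alpha>"
    using from_nat_into_surj[OF countable_indices, of \<alpha>] by auto
  then show ?thesis by (intro exI[of _ "Suc k"]) (auto simp: first_indices_def)
qed

lemma finite_subset_first_indices: "finite F \<Longrightarrow> \<exists>n. F \<subseteq> first_indices n"
proof (induction F rule: finite_induct)
  case (insert \<alpha> F)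
  then obtain m n where "\<alpha> \<in> first_indices m" "F \<subseteq> first_indices n" using mem_first_indices by blast
  then have "insert \<alpha> F \<subseteq> first_indices (max m n)"
    using first_indices_mono[of m "max m n"] first_indices_mono[of n "max m n"] by auto
  then show ?case by blast
qed auto

lemma truncation_tendsto:
  assumes h: "h \<in> H"
  shows "(\<lambda>n. \<parallel>truncation (first_indices n) h - h\<parallel>) \<longlonglongrightarrow> 0"
proof (rule LIMSEQ_I)
  fix e :: real assume "e > 0"
  then obtain p where p: "polynomial p" "\<parallel>h - p\<parallel> < e" using polynomials_dense[OF h] by blast
  obtain N where N: "{\<alpha>. p \<alpha> \<noteq> 0} \<subseteq> first_indices N" using finite_subset_first_indices p(1) by (auto simp: polynomial_def)
  have "norm (\<parallel>truncation (first_indices n) h - h\<parallel> - 0) < e" if "n \<ge> N" for n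
  proof -
    have "truncation (first_indices n) p = p" using N first_indices_mono[OF that] by (intro truncation_superset) auto
    then have "\<parallel>h - truncation (first_indices n) h\<parallel> < e"
      using truncation_best_approximation[OF finite_first_indices h, of n p] p(2) by simp
    then show ?thesis
      using norm_minus_commute[OF h truncation_mem[OF finite_first_indices]] norm_nonneg[of "h - truncation (first_indices n) h"] h
      by (simp add: diff_mem truncation_mem)
  qed
  then show "\<exists>N. \<forall>n\<ge>N. norm (\<parallel>truncation (first_indices n) h - h\<parallel> - 0) < e" by blast
qed

text \<open>The truncations converge by completeness, and continuity of the coefficients identifies
  the limit with \<open>g\<close>. This is how a formal product, given only by its coefficients, is
  recognized as an element of the space.\<close>

lemma square_summable_mem:
  assumes bd: "\<And>n. (\<Sum>\<alpha>\<in>first_indices n. (cmod (g \<alpha>))\<^sup>2 * (weight \<alpha>)\<^sup>2) \<le> B\<^sup>2" and B: "B \<ge> 0"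
  shows "g \<in> H" "\<parallel>g\<parallel> \<le> B"
proof -
  define s where "s n = truncation (first_indices n) g" for n
  define t where "t n = (\<Sum>\<alpha>\<in>first_indices n. (cmod (g \<alpha>))\<^sup>2 * (weight \<alpha>)\<^sup>2)" for n
  have sH: "s n \<in> H" for n unfolding s_def by (rule truncation_mem) simp
  have st: "\<parallel>s n\<parallel>\<^sup>2 = t n" for n unfolding s_def t_def by (rule norm_truncation_sq) simp
  have diff: "\<parallel>s n - s m\<parallel>\<^sup>2 = t n - t m" if "m \<le> n" for m n
  proof -
    have "s n - s m = truncation (first_indices n - first_indices m) g"
      using first_indices_mono[OF that] by (auto simp: s_def truncation_def fun_eq_iff)
    then have "\<parallel>s n - s m\<parallel>\<^sup>2 = (\<Sum>\<alpha>\<in>first_indices n - first_indices m. (cmod (g \<alpha>))\<^sup>2 * (weight \<alpha>)\<^sup>2)"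
      by (simp add: norm_truncation_sq)
    then show ?thesis unfolding t_def using first_indices_mono[OF that] by (simp add: sum_diff)
  qed
  have tB: "\<bar>t n\<bar> \<le> B\<^sup>2" for n using bd[of n] st[of n] zero_le_power2[of "\<parallel>s n\<parallel>"] unfolding t_def by linarith
  then obtain k where k: "k \<in> H" "(\<lambda>n. \<parallel>s n - k\<parallel>) \<longlonglongrightarrow> 0"
    using convergent_of_increments[where s = s and t = t, OF sH diff tB] by auto
  have "k \<alpha> = g \<alpha>" for \<alpha>
  proof -
    obtain N where N: "\<alpha> \<in> first_indices N" using mem_first_indices by blast
    have "s n \<alpha> = g \<alpha>" if "n \<ge> N" for n
      using first_indices_mono[OF that] N by (auto simp: s_def truncation_def)
    then have "(\<lambda>n. s n \<alpha>) \<longlonglongrightarrow> g \<alpha>"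
      by (intro tendsto_eventually eventually_sequentiallyI)
    then show ?thesis using coeff_tendsto[OF sH k] LIMSEQ_unique by blast
  qed
  then have kg: "k = g" by blast
  show "g \<in> H" using k kg by simp
  have "\<parallel>s n\<parallel> \<le> B" for n
    by (rule power2_le_imp_le[OF _ B]) (use bd[of n] st[of n] in \<open>simp add: t_def\<close>)
  then show "\<parallel>g\<parallel> \<le> B"
    using norm_tendsto[OF sH k] kg LIMSEQ_le_const2 by blast
qed

section \<open>Multiplication operators\<close>

lemma series_mult_alt: "series_mult f g \<gamma> = (\<Sum>x\<in>{(\<alpha>, \<beta>). \<alpha> + \<beta> = \<gamma>}. f (fst x) * g (snd x))"
  unfolding series_mult_def by (intro sum.cong) auto

lemma series_mult_add: "series_mult f (g + h) = series_mult f g + series_mult f h"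
  by (auto simp: fun_eq_iff series_mult_alt algebra_simps sum.distrib)

lemma series_mult_scale: "series_mult f (scale c h) = scale c (series_mult f h)"
  by (auto simp: fun_eq_iff series_mult_alt scale_def sum_distrib_left algebra_simps)

text \<open>By right cancellation, \<open>(\<gamma>, \<beta>)\<close> is the only decomposition of
  \<open>\<gamma> + \<beta>\<close> with second part \<open>\<beta>\<close>.\<close>

lemma series_mult_monomial:
  fixes \<gamma> \<beta> :: 'm
  shows "series_mult f (monomial \<beta>) (\<gamma> + \<beta>) = f \<gamma>"
proof -
  have "series_mult f (monomial \<beta>) (\<gamma> + \<beta>) = (\<Sum>x\<in>{(\<gamma>, \<beta>)}. f (fst x) * monomial \<beta> (snd x))"
    unfolding series_mult_alt
  proof (rule sum.mono_neutral_right)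
    show "finite {(\<alpha>, \<beta>'). \<alpha> + \<beta>' = \<gamma> + \<beta>}" by (rule finite_decompositions)
    show "\<forall>x\<in>{(\<alpha>, \<beta>'). \<alpha> + \<beta>' = \<gamma> + \<beta>} - {(\<gamma>, \<beta>)}. f (fst x) * monomial \<beta> (snd x) = 0"
      using cancel_right[of _ \<beta> \<gamma>] by (auto simp: monomial_def)
  qed auto
  then show ?thesis by (simp add: monomial_def)
qed

lemma series_mult_monomial_eq_0: "(\<And>\<gamma>. \<alpha> \<noteq> \<gamma> + \<beta>) \<Longrightarrow> series_mult f (monomial \<beta>) \<alpha> = 0"
  unfolding series_mult_alt by (intro sum.neutral) (auto simp: monomial_def)

lemma series_mult_one:
  fixes f :: "'m series"
  shows "series_mult f (monomial 0) = f"
  using series_mult_monomial[of f 0] by (simp add: fun_eq_iff)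

lemma multiplier_bound:
  obtains K where "K \<ge> 0" "\<And>h. h \<in> H \<Longrightarrow> \<parallel>mult_op \<H> f h\<parallel> \<le> K * \<parallel>h\<parallel>"
proof (cases "multiplier \<H> f")
  case True
  then obtain K where K: "\<And>h. h \<in> H \<Longrightarrow> \<parallel>series_mult f h\<parallel> \<le> K * \<parallel>h\<parallel>"
    unfolding multiplier_def by blast
  have "\<parallel>mult_op \<H> f h\<parallel> \<le> max K 0 * \<parallel>h\<parallel>" if "h \<in> H" for h
    using K[OF that] mult_right_mono[of K "max K 0" "\<parallel>h\<parallel>"] norm_nonneg[OF that] True
    by (simp add: mult_op_def)
  then show ?thesis using that[of "max K 0"] by simp
next
  case False
  then show ?thesis using that[of 0] by (simp add: mult_op_def)
qed

lemma mult_op_mem: "h \<in> H \<Longrightarrow> mult_op \<H> f h \<in> H"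
  by (auto simp: mult_op_def multiplier_def zero_mem)

lemma mult_op_scale: "mult_op \<H> f (scale c h) = scale c (mult_op \<H> f h)"
  by (simp add: mult_op_def series_mult_scale)

lemma mult_op_pair: "adjoint_pair \<H> (mult_op \<H> f) (adj \<H> (mult_op \<H> f))"
proof -
  obtain K where K: "\<And>h. h \<in> H \<Longrightarrow> \<parallel>mult_op \<H> f h\<parallel> \<le> K * \<parallel>h\<parallel>" using multiplier_bound[of f] by blast
  show ?thesis
  proof (rule adjoint_pair_adj[OF mult_op_mem _ mult_op_scale K])
    show "mult_op \<H> f (g + h) = mult_op \<H> f g + mult_op \<H> f h" for g h
      by (simp add: mult_op_def series_mult_add)
  qed
qed

lemma mult_op_le_opnorm: "h \<in> H \<Longrightarrow> \<parallel>mult_op \<H> f h\<parallel> \<le> opnorm \<H> (mult_op \<H> f) * \<parallel>h\<parallel>"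
proof -
  obtain K where "K \<ge> 0" and K: "\<And>h. h \<in> H \<Longrightarrow> \<parallel>mult_op \<H> f h\<parallel> \<le> K * \<parallel>h\<parallel>" using multiplier_bound[of f] by blast
  then show "h \<in> H \<Longrightarrow> ?thesis"
    using norm_le_opnorm[OF mult_op_mem mult_op_scale K] by blast
qed

text \<open>Being a multiplier quantifies over the whole space; here it becomes a countable
  combination of inequalities in finitely many coefficients each. For a random series this is what
  makes the property a measurable event.\<close>

lemma multiplier_iff:
  "multiplier \<H> f \<longleftrightarrow> (\<exists>K::nat. \<forall>p\<in>dense_polys. \<forall>n.
     (\<Sum>\<alpha>\<in>first_indices n. (cmod (series_mult f p \<alpha>))\<^sup>2 * (weight \<alpha>)\<^sup>2) \<le> (real K * \<parallel>p\<parallel>)\<^sup>2)" (is "_ \<longleftrightarrow> ?R")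
proof
  assume m: "multiplier \<H> f"
  obtain K where K: "\<And>h. h \<in> H \<Longrightarrow> \<parallel>mult_op \<H> f h\<parallel> \<le> K * \<parallel>h\<parallel>" using multiplier_bound[of f] by blast
  obtain k :: nat where k: "K \<le> real k" using real_arch_simple by blast
  have "(\<Sum>\<alpha>\<in>first_indices n. (cmod (series_mult f p \<alpha>))\<^sup>2 * (weight \<alpha>)\<^sup>2) \<le> (real k * \<parallel>p\<parallel>)\<^sup>2"
    if "p \<in> dense_polys" for p n
  proof -
    have p: "p \<in> H" using dense_polys_mem that .
    have "series_mult f p \<in> H" using m p by (auto simp: multiplier_def)
    then have "\<parallel>truncation (first_indices n) (series_mult f p)\<parallel> \<le> \<parallel>series_mult f p\<parallel>"
      by (intro norm_truncation_le) simp
    also have "\<dots> \<le> K * \<parallel>p\<parallel>" using K[OF p] m by (simp add: mult_op_def)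
    also have "\<dots> \<le> real k * \<parallel>p\<parallel>" using k norm_nonneg[OF p] by (rule mult_right_mono)
    finally show ?thesis
      unfolding norm_truncation_sq[OF finite_first_indices, symmetric]
      by (intro power_mono) (auto intro!: norm_nonneg truncation_mem)
  qed
  then show ?R by blast
next
  assume ?R
  then obtain K :: nat where K: "\<And>p n. p \<in> dense_polys \<Longrightarrow>
     (\<Sum>\<alpha>\<in>first_indices n. (cmod (series_mult f p \<alpha>))\<^sup>2 * (weight \<alpha>)\<^sup>2) \<le> (real K * \<parallel>p\<parallel>)\<^sup>2" by blast
  have "series_mult f h \<in> H \<and> \<parallel>series_mult f h\<parallel> \<le> K * \<parallel>h\<parallel>" if h: "h \<in> H" for h
  proof -
    obtain p where p: "\<And>n. p n \<in> dense_polys" and pH: "\<And>n. p n \<in> H" and lim: "(\<lambda>n. \<parallel>p n - h\<parallel>) \<longlonglongrightarrow> 0"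
      using approximating_sequence[OF _ dense_polys_dense[OF h] h] dense_polys_mem by blast
    \<comment> \<open>Each coefficient of a product is a finite sum, hence continuous in the second
      factor, so for fixed \<open>n\<close> the bound passes from dense polynomials to
      \<open>h\<close>.\<close>
    have "(\<Sum>\<alpha>\<in>first_indices n. (cmod (series_mult f h \<alpha>))\<^sup>2 * (weight \<alpha>)\<^sup>2) \<le> (real K * \<parallel>h\<parallel>)\<^sup>2" for n
    proof (rule LIMSEQ_le)
      show "(\<lambda>m. (real K * \<parallel>p m\<parallel>)\<^sup>2) \<longlonglongrightarrow> (real K * \<parallel>h\<parallel>)\<^sup>2"
        by (intro tendsto_intros norm_tendsto pH h lim)
      show "(\<lambda>m. \<Sum>\<alpha>\<in>first_indices n. (cmod (series_mult f (p m) \<alpha>))\<^sup>2 * (weight \<alpha>)\<^sup>2)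
          \<longlonglongrightarrow> (\<Sum>\<alpha>\<in>first_indices n. (cmod (series_mult f h \<alpha>))\<^sup>2 * (weight \<alpha>)\<^sup>2)"
        unfolding series_mult_alt by (intro tendsto_intros coeff_tendsto pH h lim)
      show "\<exists>N. \<forall>m\<ge>N. (\<Sum>\<alpha>\<in>first_indices n. (cmod (series_mult f (p m) \<alpha>))\<^sup>2 * (weight \<alpha>)\<^sup>2) \<le> (real K * \<parallel>p m\<parallel>)\<^sup>2"
        using K[OF p] by blast
    qed
    then show ?thesis
      using square_summable_mem[of "series_mult f h" "K * \<parallel>h\<parallel>"] norm_nonneg[OF h] by simp
  qed
  then show "multiplier \<H> f" unfolding multiplier_def by blast
qed

end

section \<open>Random operators\<close>

lemma borel_measurable_cnj:
  fixes f :: "'w \<Rightarrow> complex"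
  assumes "f \<in> borel_measurable N"
  shows "(\<lambda>\<omega>. cnj (f \<omega>)) \<in> borel_measurable N"
  by (rule measurable_compose[OF assms]) (intro borel_measurable_continuous_onI continuous_intros)

context indexed_committee_space
begin

text \<open>No sigma-algebra is put on \<open>elems \<H>\<close>. Measurability of all coefficients
  is an equivalent test for maps into \<open>elems \<H>\<close>, by
  \<open>weakly_measurable_coeff\<close> and \<open>weakly_measurable_of_coeff\<close>.\<close>

definition weakly_measurable :: "'w measure \<Rightarrow> ('w \<Rightarrow> 'm series) \<Rightarrow> bool" where
  "weakly_measurable N T \<longleftrightarrow> (\<forall>\<omega>\<in>space N. T \<omega> \<in> H) \<and> (\<forall>h\<in>H. (\<lambda>\<omega>. \<langle>T \<omega>, h\<rangle>) \<in> borel_measurable N)"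

text \<open>Measurability is demanded of \<open>A\<close> alone; that of \<open>B\<close> follows by
  conjugating inner products, so the notion is symmetric.\<close>

definition random_pair :: "'w measure \<Rightarrow> ('w \<Rightarrow> 'm operator) \<Rightarrow> ('w \<Rightarrow> 'm operator) \<Rightarrow> bool" where
  "random_pair N A B \<longleftrightarrow> (\<forall>\<omega>\<in>space N. adjoint_pair \<H> (A \<omega>) (B \<omega>)) \<and> (\<forall>h\<in>H. weakly_measurable N (\<lambda>\<omega>. A \<omega> h))"

lemma weakly_measurableD:
  assumes "weakly_measurable N T"
  shows "\<omega> \<in> space N \<Longrightarrow> T \<omega> \<in> H" "h \<in> H \<Longrightarrow> (\<lambda>\<omega>. \<langle>T \<omega>, h\<rangle>) \<in> borel_measurable N"
  using assms by (auto simp: weakly_measurable_def)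

lemma weakly_measurable_const: "h \<in> H \<Longrightarrow> weakly_measurable N (\<lambda>_. h)"
  by (simp add: weakly_measurable_def)

lemma weakly_measurable_coeff:
  assumes T: "weakly_measurable N T"
  shows "(\<lambda>\<omega>. T \<omega> \<alpha>) \<in> borel_measurable N"
proof -
  have "(\<lambda>\<omega>. \<langle>T \<omega>, monomial \<alpha>\<rangle> / of_real ((weight \<alpha>)\<^sup>2)) \<in> borel_measurable N"
    by (intro borel_measurable_divide weakly_measurableD[OF T] monomial_mem) simp
  also have "?this \<longleftrightarrow> ?thesis"
    by (intro measurable_cong) (use weakly_measurableD(1)[OF T] weight_pos[of \<alpha>] in \<open>simp add: ip_monomial\<close>)
  finally show ?thesis .
qed

text \<open>By Parseval, the inner product of two random vectors is a pointwise limit of finite sums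
  of products of coefficients.\<close>

lemma ip_measurable_of_coeff:
  assumes "\<And>\<omega>. \<omega> \<in> space N \<Longrightarrow> T \<omega> \<in> H" "\<And>\<omega>. \<omega> \<in> space N \<Longrightarrow> U \<omega> \<in> H"
    and "\<And>\<alpha>. (\<lambda>\<omega>. T \<omega> \<alpha>) \<in> borel_measurable N" "\<And>\<alpha>. (\<lambda>\<omega>. U \<omega> \<alpha>) \<in> borel_measurable N"
  shows "(\<lambda>\<omega>. \<langle>T \<omega>, U \<omega>\<rangle>) \<in> borel_measurable N"
proof (rule borel_measurable_LIMSEQ_metric)
  fix n
  have "(\<lambda>\<omega>. \<Sum>\<alpha>\<in>first_indices n. T \<omega> \<alpha> * cnj (U \<omega> \<alpha>) * of_real ((weight \<alpha>)\<^sup>2)) \<in> borel_measurable N"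
    by (intro borel_measurable_sum borel_measurable_times borel_measurable_cnj borel_measurable_const assms)
  also have "?this \<longleftrightarrow> (\<lambda>\<omega>. \<langle>T \<omega>, truncation (first_indices n) (U \<omega>)\<rangle>) \<in> borel_measurable N"
    by (intro measurable_cong) (simp add: ip_truncation assms(1))
  finally show "(\<lambda>\<omega>. \<langle>T \<omega>, truncation (first_indices n) (U \<omega>)\<rangle>) \<in> borel_measurable N" .
next
  fix \<omega> assume \<omega>: "\<omega> \<in> space N"
  show "(\<lambda>n. \<langle>T \<omega>, truncation (first_indices n) (U \<omega>)\<rangle>) \<longlonglongrightarrow> \<langle>T \<omega>, U \<omega>\<rangle>"
    using assms(1,2)[OF \<omega>] by (intro ip_tendsto_right truncation_tendsto truncation_mem) auto
qed

lemma weakly_measurable_of_coeff: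
  assumes "\<And>\<omega>. \<omega> \<in> space N \<Longrightarrow> T \<omega> \<in> H" "\<And>\<alpha>. (\<lambda>\<omega>. T \<omega> \<alpha>) \<in> borel_measurable N"
  shows "weakly_measurable N T"
  unfolding weakly_measurable_def
  using ip_measurable_of_coeff[OF assms(1) _ assms(2)] assms(1) by simp

lemma ip_measurable:
  assumes "weakly_measurable N T" "weakly_measurable N U"
  shows "(\<lambda>\<omega>. \<langle>T \<omega>, U \<omega>\<rangle>) \<in> borel_measurable N"
  by (intro ip_measurable_of_coeff weakly_measurable_coeff assms weakly_measurableD(1)[OF assms(1)]
      weakly_measurableD(1)[OF assms(2)])

lemma norm_measurable:
  assumes T: "weakly_measurable N T"
  shows "(\<lambda>\<omega>. \<parallel>T \<omega>\<parallel>) \<in> borel_measurable N"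
  unfolding ser_norm_def using ip_measurable[OF T T] by simp

lemma random_pairD:
  assumes "random_pair N A B"
  shows "\<omega> \<in> space N \<Longrightarrow> adjoint_pair \<H> (A \<omega>) (B \<omega>)" "h \<in> H \<Longrightarrow> weakly_measurable N (\<lambda>\<omega>. A \<omega> h)"
  using assms by (auto simp: random_pair_def)

lemma random_pair_sym:
  assumes AB: "random_pair N A B"
  shows "random_pair N B A"
proof -
  note D = random_pairD[OF AB]
  have "weakly_measurable N (\<lambda>\<omega>. B \<omega> h)" if h: "h \<in> H" for h
    unfolding weakly_measurable_def
  proof (intro conjI ballI)
    show "B \<omega> h \<in> H" if "\<omega> \<in> space N" for \<omega>
      using adjoint_pairD(2)[OF D(1)[OF that] h] .
    fix g assume g: "g \<in> H"
    have "(\<lambda>\<omega>. cnj \<langle>A \<omega> g, h\<rangle>) \<in> borel_measurable N"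
      by (rule borel_measurable_cnj[OF weakly_measurableD(2)[OF D(2)[OF g] h]])
    also have "?this \<longleftrightarrow> (\<lambda>\<omega>. \<langle>B \<omega> h, g\<rangle>) \<in> borel_measurable N"
    proof (rule measurable_cong)
      fix \<omega> assume \<omega>: "\<omega> \<in> space N"
      show "cnj \<langle>A \<omega> g, h\<rangle> = \<langle>B \<omega> h, g\<rangle>"
        using adjoint_pairD(1)[OF D(1)[OF \<omega>] g] adjoint_pairD(4)[OF D(1)[OF \<omega>] h g]
          ip_cnj[of "A \<omega> g" h] h by simp
    qed
    finally show "(\<lambda>\<omega>. \<langle>B \<omega> h, g\<rangle>) \<in> borel_measurable N" .
  qed
  then show ?thesis using D(1) adjoint_pair_sym by (simp add: random_pair_def)
qed

text \<open>Moving the random operator across turns the claim into one about the inner product of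
  two random vectors, \<open>T \<omega>\<close> and \<open>B \<omega> h\<close>.\<close>

lemma weakly_measurable_apply:
  assumes AB: "random_pair N A B" and T: "weakly_measurable N T"
  shows "weakly_measurable N (\<lambda>\<omega>. A \<omega> (T \<omega>))"
  unfolding weakly_measurable_def
proof (intro conjI ballI)
  note D = random_pairD[OF AB]
  show "A \<omega> (T \<omega>) \<in> H" if "\<omega> \<in> space N" for \<omega>
    using adjoint_pairD(1)[OF D(1)[OF that] weakly_measurableD(1)[OF T that]] .
  fix h assume h: "h \<in> H"
  have "(\<lambda>\<omega>. \<langle>T \<omega>, B \<omega> h\<rangle>) \<in> borel_measurable N"
    by (intro ip_measurable T random_pairD(2)[OF random_pair_sym[OF AB] h])
  also have "?this \<longleftrightarrow> (\<lambda>\<omega>. \<langle>A \<omega> (T \<omega>), h\<rangle>) \<in> borel_measurable N"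
    by (intro measurable_cong) (simp add: adjoint_pairD(3)[OF D(1)] weakly_measurableD(1)[OF T] h)
  finally show "(\<lambda>\<omega>. \<langle>A \<omega> (T \<omega>), h\<rangle>) \<in> borel_measurable N" .
qed

lemma random_pair_const: "adjoint_pair \<H> A B \<Longrightarrow> random_pair N (\<lambda>_. A) (\<lambda>_. B)"
  using adjoint_pairD(1)[of A B] by (simp add: random_pair_def weakly_measurable_const)

text \<open>That is, \<open>T = Q\<^sup>* Q\<close>, stated without mentioning the adjoint of \<open>Q\<close>.\<close>

definition gram :: "'w measure \<Rightarrow> real \<Rightarrow> ('w \<Rightarrow> 'm operator) \<Rightarrow> ('w \<Rightarrow> 'm operator) \<Rightarrow> bool" where
  "gram N C Q T \<longleftrightarrow> (\<forall>g\<in>H. weakly_measurable N (\<lambda>\<omega>. Q \<omega> g)) \<and> (AE \<omega> in N. \<forall>g\<in>H. \<parallel>Q \<omega> g\<parallel> \<le> C * \<parallel>g\<parallel>) \<and>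
     (\<forall>\<omega>\<in>space N. \<forall>g\<in>H. T \<omega> g \<in> H \<and> (\<forall>h\<in>H. \<langle>T \<omega> g, h\<rangle> = \<langle>Q \<omega> g, Q \<omega> h\<rangle>))"

definition energy :: "'w measure \<Rightarrow> ('w \<Rightarrow> 'm operator) \<Rightarrow> 'm series \<Rightarrow> real" where
  "energy N Q g = (\<integral>\<omega>. \<parallel>Q \<omega> g\<parallel>\<^sup>2 \<partial>N)"

section \<open>Weak expectations, their norms and their energies\<close>

lemma gramD:
  assumes "gram N C Q T"
  shows "g \<in> H \<Longrightarrow> weakly_measurable N (\<lambda>\<omega>. Q \<omega> g)" "AE \<omega> in N. \<forall>g\<in>H. \<parallel>Q \<omega> g\<parallel> \<le> C * \<parallel>g\<parallel>"
    "\<omega> \<in> space N \<Longrightarrow> g \<in> H \<Longrightarrow> T \<omega> g \<in> H"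
    "\<omega> \<in> space N \<Longrightarrow> g \<in> H \<Longrightarrow> h \<in> H \<Longrightarrow> \<langle>T \<omega> g, h\<rangle> = \<langle>Q \<omega> g, Q \<omega> h\<rangle>"
    "\<omega> \<in> space N \<Longrightarrow> g \<in> H \<Longrightarrow> Q \<omega> g \<in> H"
  using assms by (auto simp: gram_def weakly_measurable_def)

lemma gram_ip_bound:
  assumes G: "gram N C Q T" and g: "g \<in> H" and h: "h \<in> H"
  shows "AE \<omega> in N. cmod \<langle>Q \<omega> g, Q \<omega> h\<rangle> \<le> C\<^sup>2 * \<parallel>g\<parallel> * \<parallel>h\<parallel>"
  using gramD(2)[OF G] AE_space
proof eventually_elim
  case (elim \<omega>)
  have Q: "Q \<omega> g \<in> H" "Q \<omega> h \<in> H" using gramD(5)[OF G elim(2)] g h by auto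
  have b: "\<parallel>Q \<omega> g\<parallel> \<le> C * \<parallel>g\<parallel>" "\<parallel>Q \<omega> h\<parallel> \<le> C * \<parallel>h\<parallel>" using elim(1) g h by auto
  have "cmod \<langle>Q \<omega> g, Q \<omega> h\<rangle> \<le> \<parallel>Q \<omega> g\<parallel> * \<parallel>Q \<omega> h\<parallel>" by (rule Cauchy_Schwarz[OF Q])
  also have "\<dots> \<le> (C * \<parallel>g\<parallel>) * (C * \<parallel>h\<parallel>)"
    using b norm_nonneg[OF Q(1)] norm_nonneg[OF Q(2)] by (intro mult_mono) auto
  finally show ?case by (simp add: power2_eq_square mult_ac)
qed

lemma gram_integrable:
  assumes "prob_space N" and G: "gram N C Q T" and g: "g \<in> H" and h: "h \<in> H"
  shows "integrable N (\<lambda>\<omega>. \<langle>Q \<omega> g, Q \<omega> h\<rangle>)" "integrable N (\<lambda>\<omega>. \<langle>T \<omega> g, h\<rangle>)"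
    "(\<integral>\<omega>. \<langle>T \<omega> g, h\<rangle> \<partial>N) = (\<integral>\<omega>. \<langle>Q \<omega> g, Q \<omega> h\<rangle> \<partial>N)"
    "cmod (\<integral>\<omega>. \<langle>Q \<omega> g, Q \<omega> h\<rangle> \<partial>N) \<le> C\<^sup>2 * \<parallel>g\<parallel> * \<parallel>h\<parallel>"
proof -
  interpret prob_space N by fact
  note b = gram_ip_bound[OF G g h]
  have m: "(\<lambda>\<omega>. \<langle>Q \<omega> g, Q \<omega> h\<rangle>) \<in> borel_measurable N"
    using gramD(1)[OF G g] gramD(1)[OF G h] by (rule ip_measurable)
  show i: "integrable N (\<lambda>\<omega>. \<langle>Q \<omega> g, Q \<omega> h\<rangle>)"
    using b m by (rule integrable_const_bound)
  show "integrable N (\<lambda>\<omega>. \<langle>T \<omega> g, h\<rangle>)"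
    using i by (rule Bochner_Integration.integrable_cong[THEN iffD1, rotated -1])
      (simp_all add: gramD(4)[OF G _ g h])
  show "(\<integral>\<omega>. \<langle>T \<omega> g, h\<rangle> \<partial>N) = (\<integral>\<omega>. \<langle>Q \<omega> g, Q \<omega> h\<rangle> \<partial>N)"
    by (intro Bochner_Integration.integral_cong) (simp_all add: gramD(4)[OF G _ g h])
  have "norm (\<integral>\<omega>. \<langle>Q \<omega> g, Q \<omega> h\<rangle> \<partial>N) \<le> (\<integral>\<omega>. norm \<langle>Q \<omega> g, Q \<omega> h\<rangle> \<partial>N)"
    by (rule integral_norm_bound)
  also have "\<dots> \<le> (\<integral>\<omega>. C\<^sup>2 * \<parallel>g\<parallel> * \<parallel>h\<parallel> \<partial>N)"
    using b i by (intro integral_mono_AE) auto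
  finally show "cmod (\<integral>\<omega>. \<langle>Q \<omega> g, Q \<omega> h\<rangle> \<partial>N) \<le> C\<^sup>2 * \<parallel>g\<parallel> * \<parallel>h\<parallel>"
    by (simp add: prob_space)
qed

text \<open>The almost sure bound on \<open>Q\<close> makes the expected sesquilinear form bounded,
  so Riesz representation provides the vector described by \<open>weak_expectation\<close>.\<close>

lemma weak_expectation_gram:
  assumes N: "prob_space N" and G: "gram N C Q T" and g: "g \<in> H"
  defines "k \<equiv> weak_expectation \<H> N T g"
  shows "k \<in> H" "h \<in> H \<Longrightarrow> \<langle>k, h\<rangle> = (\<integral>\<omega>. \<langle>Q \<omega> g, Q \<omega> h\<rangle> \<partial>N)"
proof -
  note int = gram_integrable[OF N G g]
  \<comment> \<open>The conjugate makes the functional linear in \<open>h\<close>, since the inner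
    product is antilinear in its second argument.\<close>
  define \<phi> where "\<phi> h = cnj (\<integral>\<omega>. \<langle>T \<omega> g, h\<rangle> \<partial>N)" for h
  have "\<exists>k\<in>H. \<forall>h\<in>H. \<phi> h = \<langle>h, k\<rangle>"
  proof (rule Riesz_representation[where \<phi> = \<phi> and K = "C\<^sup>2 * \<parallel>g\<parallel>"])
    fix h assume h: "h \<in> H"
    show "cmod (\<phi> h) \<le> C\<^sup>2 * \<parallel>g\<parallel> * \<parallel>h\<parallel>"
      unfolding \<phi>_def complex_mod_cnj int(3)[OF h] by (rule int(4)[OF h])
    show "\<phi> (scale c h) = c * \<phi> h" for c
    proof -
      have "(\<integral>\<omega>. \<langle>T \<omega> g, scale c h\<rangle> \<partial>N) = (\<integral>\<omega>. cnj c * \<langle>T \<omega> g, h\<rangle> \<partial>N)"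
        by (intro Bochner_Integration.integral_cong)
          (simp_all add: ip_scale_right gramD(3)[OF G] g h)
      then show ?thesis by (simp add: \<phi>_def)
    qed
    fix f assume f: "f \<in> H"
    have "(\<integral>\<omega>. \<langle>T \<omega> g, h + f\<rangle> \<partial>N) = (\<integral>\<omega>. \<langle>T \<omega> g, h\<rangle> + \<langle>T \<omega> g, f\<rangle> \<partial>N)"
      by (intro Bochner_Integration.integral_cong)
        (simp_all add: ip_add_right gramD(3)[OF G] g h f)
    then show "\<phi> (h + f) = \<phi> h + \<phi> f"
      using int(2)[OF h] int(2)[OF f] by (simp add: \<phi>_def)
  qed
  then obtain l where l: "l \<in> H" "\<forall>h\<in>H. \<phi> h = \<langle>h, l\<rangle>" by blast
  have lh: "\<langle>l, h\<rangle> = (\<integral>\<omega>. \<langle>T \<omega> g, h\<rangle> \<partial>N)" if h: "h \<in> H" for h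
    using ip_cnj[OF h l(1)] l(2)[rule_format, OF h, symmetric] by (simp add: \<phi>_def)
  have "k = l"
    unfolding k_def weak_expectation_def
  proof (rule the_equality)
    show "l \<in> H \<and> (\<forall>h\<in>H. integrable N (\<lambda>\<omega>. \<langle>T \<omega> g, h\<rangle>) \<and> \<langle>l, h\<rangle> = (\<integral>\<omega>. \<langle>T \<omega> g, h\<rangle> \<partial>N))"
      using l(1) lh int(2) by blast
    fix l' assume l': "l' \<in> H \<and> (\<forall>h\<in>H. integrable N (\<lambda>\<omega>. \<langle>T \<omega> g, h\<rangle>) \<and> \<langle>l', h\<rangle> = (\<integral>\<omega>. \<langle>T \<omega> g, h\<rangle> \<partial>N))"
    show "l' = l"
    proof (rule eq_of_ip)
      show "\<langle>l', h\<rangle> = \<langle>l, h\<rangle>" if "h \<in> H" for h using l' lh[OF that] that by simp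
    qed (use l l' in auto)
  qed
  then show "k \<in> H" "h \<in> H \<Longrightarrow> \<langle>k, h\<rangle> = (\<integral>\<omega>. \<langle>Q \<omega> g, Q \<omega> h\<rangle> \<partial>N)"
    using l(1) lh[of h] int(3)[of h] by simp_all
qed

lemma gram_energy:
  assumes N: "prob_space N" and G: "gram N C Q T" and g: "g \<in> H"
  shows "integrable N (\<lambda>\<omega>. \<parallel>Q \<omega> g\<parallel>\<^sup>2)" "energy N Q g = Re \<langle>weak_expectation \<H> N T g, g\<rangle>" "0 \<le> energy N Q g"
proof -
  note int = gram_integrable(1)[OF N G g g]
  have e: "\<parallel>Q \<omega> g\<parallel>\<^sup>2 = Re \<langle>Q \<omega> g, Q \<omega> g\<rangle>" if "\<omega> \<in> space N" for \<omega>
    using gramD(5)[OF G that g] by (simp add: norm_sq)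
  have "integrable N (\<lambda>\<omega>. Re \<langle>Q \<omega> g, Q \<omega> g\<rangle>)" using int by (rule integrable_Re)
  then show "integrable N (\<lambda>\<omega>. \<parallel>Q \<omega> g\<parallel>\<^sup>2)"
    by (rule Bochner_Integration.integrable_cong[THEN iffD1, rotated -1]) (simp_all add: e)
  have "energy N Q g = (\<integral>\<omega>. Re \<langle>Q \<omega> g, Q \<omega> g\<rangle> \<partial>N)"
    unfolding energy_def by (intro Bochner_Integration.integral_cong) (simp_all add: e)
  then show "energy N Q g = Re \<langle>weak_expectation \<H> N T g, g\<rangle>"
    using int by (simp add: weak_expectation_gram(2)[OF N G g g])
  show "0 \<le> energy N Q g" unfolding energy_def by simp
qed

lemma energy_le_opnorm:
  assumes N: "prob_space N" and G: "gram N C Q T" and g: "g \<in> H" "\<parallel>g\<parallel> \<le> 1"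
  shows "energy N Q g \<le> opnorm \<H> (weak_expectation \<H> N T)"
proof -
  let ?W = "weak_expectation \<H> N T"
  have W: "?W h \<in> H" if "h \<in> H" for h using weak_expectation_gram(1)[OF N G that] .
  \<comment> \<open>This keeps the supremum in \<open>opnorm\<close> bounded, as required by
    \<open>le_opnorm\<close>.\<close>
  have bd: "\<parallel>?W h\<parallel> \<le> C\<^sup>2 * \<parallel>h\<parallel>" if h: "h \<in> H" for h
  proof (cases "?W h = 0")
    case True
    then show ?thesis using norm_nonneg[OF h] by simp
  next
    case False
    have "\<parallel>?W h\<parallel>\<^sup>2 \<le> cmod \<langle>?W h, ?W h\<rangle>"
      using complex_Re_le_cmod norm_sq[OF W[OF h]] by simp
    also have "\<dots> \<le> C\<^sup>2 * \<parallel>h\<parallel> * \<parallel>?W h\<parallel>"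
      unfolding weak_expectation_gram(2)[OF N G h W[OF h]] by (rule gram_integrable(4)[OF N G h W[OF h]])
    finally show ?thesis using norm_pos[OF W[OF h] False] by (simp add: power2_eq_square)
  qed
  have "energy N Q g \<le> cmod \<langle>?W g, g\<rangle>"
    unfolding gram_energy(2)[OF N G g(1)] by (rule complex_Re_le_cmod)
  also have "\<dots> \<le> \<parallel>?W g\<parallel> * \<parallel>g\<parallel>" by (rule Cauchy_Schwarz[OF W[OF g(1)] g(1)])
  also have "\<dots> \<le> \<parallel>?W g\<parallel>" using g norm_nonneg[OF W[OF g(1)]] mult_left_le by blast
  also have "\<dots> \<le> opnorm \<H> ?W" by (rule le_opnorm[OF bd _ g]) auto
  finally show ?thesis .
qed

text \<open>For a positive operator the quadratic form controls the norm. The image of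
  \<open>g\<close> is paired with its own normalization \<open>u\<close>, and
  \<open>Re (ip \<H> (Q \<omega> g) (Q \<omega> u))\<close> is at most the mean of the two squared
  norms, so both energies, and hence their mean, stay below \<open>c\<close>.\<close>

lemma opnorm_le_of_energy:
  assumes N: "prob_space N" and G: "gram N C Q T"
    and c: "\<And>g. g \<in> H \<Longrightarrow> \<parallel>g\<parallel> \<le> 1 \<Longrightarrow> energy N Q g \<le> c"
  shows "opnorm \<H> (weak_expectation \<H> N T) \<le> c"
proof (rule opnorm_le)
  let ?W = "weak_expectation \<H> N T"
  fix g assume g: "g \<in> H" "\<parallel>g\<parallel> \<le> 1"
  have W: "?W g \<in> H" using weak_expectation_gram(1)[OF N G g(1)] .
  show "\<parallel>?W g\<parallel> \<le> c"
  proof (cases "?W g = 0")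
    case True
    then show ?thesis using c[OF g] gram_energy(3)[OF N G g(1)] by simp
  next
    case False
    have p: "\<parallel>?W g\<parallel> > 0" using norm_pos[OF W False] .
    define u where "u = scale (of_real (inverse \<parallel>?W g\<parallel>)) (?W g)"
    have u: "u \<in> H" "\<parallel>u\<parallel> \<le> 1"
      unfolding u_def using W p by (simp_all add: scale_mem norm_scale norm_inverse)
    have "\<langle>?W g, u\<rangle> = of_real \<parallel>?W g\<parallel>"
      unfolding u_def using p by (simp add: ip_scale_right W ip_self power2_eq_square field_simps)
    then have "\<parallel>?W g\<parallel> = Re (\<integral>\<omega>. \<langle>Q \<omega> g, Q \<omega> u\<rangle> \<partial>N)"
      using weak_expectation_gram(2)[OF N G g(1) u(1)] by (metis Re_complex_of_real)
    also have "\<dots> = (\<integral>\<omega>. Re \<langle>Q \<omega> g, Q \<omega> u\<rangle> \<partial>N)"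
      using gram_integrable(1)[OF N G g(1) u(1)] by simp
    also have "\<dots> \<le> (\<integral>\<omega>. (\<parallel>Q \<omega> g\<parallel>\<^sup>2 + \<parallel>Q \<omega> u\<parallel>\<^sup>2) / 2 \<partial>N)"
    proof (rule integral_mono)
      show "integrable N (\<lambda>\<omega>. Re \<langle>Q \<omega> g, Q \<omega> u\<rangle>)"
        using gram_integrable(1)[OF N G g(1) u(1)] by (rule integrable_Re)
      show "integrable N (\<lambda>\<omega>. (\<parallel>Q \<omega> g\<parallel>\<^sup>2 + \<parallel>Q \<omega> u\<parallel>\<^sup>2) / 2)"
        using gram_energy(1)[OF N G g(1)] gram_energy(1)[OF N G u(1)] by simp
      fix \<omega> assume \<omega>: "\<omega> \<in> space N"
      have "0 \<le> \<parallel>Q \<omega> g - Q \<omega> u\<parallel>\<^sup>2" by simp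
      then show "Re \<langle>Q \<omega> g, Q \<omega> u\<rangle> \<le> (\<parallel>Q \<omega> g\<parallel>\<^sup>2 + \<parallel>Q \<omega> u\<parallel>\<^sup>2) / 2"
        using norm_diff_sq[OF gramD(5)[OF G \<omega> g(1)] gramD(5)[OF G \<omega> u(1)]] by simp
    qed
    also have "\<dots> = (energy N Q g + energy N Q u) / 2"
      using gram_energy(1)[OF N G g(1)] gram_energy(1)[OF N G u(1)] by (simp add: energy_def)
    also have "\<dots> \<le> c" using c[OF g] c[OF u] by simp
    finally show ?thesis .
  qed
qed

lemma energy_tendsto:
  assumes N: "prob_space N"
    and s: "\<And>n. weakly_measurable N (s n)" and u: "weakly_measurable N u"
    and lim: "AE \<omega> in N. (\<lambda>n. \<parallel>s n \<omega> - u \<omega>\<parallel>) \<longlonglongrightarrow> 0"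
    and bd: "\<And>n. AE \<omega> in N. \<parallel>s n \<omega>\<parallel> \<le> K"
  shows "(\<lambda>n. \<integral>\<omega>. \<parallel>s n \<omega>\<parallel>\<^sup>2 \<partial>N) \<longlonglongrightarrow> (\<integral>\<omega>. \<parallel>u \<omega>\<parallel>\<^sup>2 \<partial>N)"
proof (rule integral_dominated_convergence)
  interpret prob_space N by fact
  show "integrable N (\<lambda>\<omega>. K\<^sup>2)" by simp
  show "(\<lambda>\<omega>. \<parallel>u \<omega>\<parallel>\<^sup>2) \<in> borel_measurable N" "(\<lambda>\<omega>. \<parallel>s n \<omega>\<parallel>\<^sup>2) \<in> borel_measurable N" for n
    using norm_measurable[OF u] norm_measurable[OF s] by auto
  show "AE \<omega> in N. (\<lambda>n. \<parallel>s n \<omega>\<parallel>\<^sup>2) \<longlonglongrightarrow> \<parallel>u \<omega>\<parallel>\<^sup>2"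
    using lim AE_space
  proof eventually_elim
    case (elim \<omega>)
    show ?case
      using elim weakly_measurableD(1)[OF s elim(2)] weakly_measurableD(1)[OF u elim(2)]
      by (intro tendsto_power norm_tendsto) auto
  qed
  show "AE \<omega> in N. norm (\<parallel>s n \<omega>\<parallel>\<^sup>2) \<le> K\<^sup>2" for n
    using bd[of n] AE_space
  proof eventually_elim
    case (elim \<omega>)
    then show ?case
      using norm_nonneg[OF weakly_measurableD(1)[OF s elim(2)]] by (simp add: power_mono)
  qed
qed

section \<open>Compressions by projections\<close>

lemma gram_pair:
  assumes AB: "random_pair N A B" and bd: "AE \<omega> in N. \<forall>h\<in>H. \<parallel>A \<omega> h\<parallel> \<le> C * \<parallel>h\<parallel>"
  shows "gram N C A (\<lambda>\<omega>. B \<omega> \<circ> A \<omega>)"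
  unfolding gram_def
proof (intro conjI ballI)
  note D = random_pairD[OF AB]
  show "weakly_measurable N (\<lambda>\<omega>. A \<omega> g)" if "g \<in> H" for g using D(2)[OF that] .
  show "AE \<omega> in N. \<forall>h\<in>H. \<parallel>A \<omega> h\<parallel> \<le> C * \<parallel>h\<parallel>" by fact
  fix \<omega> g assume \<omega>: "\<omega> \<in> space N" and g: "g \<in> H"
  note P = adjoint_pairD[OF D(1)[OF \<omega>]]
  show "(B \<omega> \<circ> A \<omega>) g \<in> H" using P(2)[OF P(1)[OF g]] by simp
  show "\<langle>(B \<omega> \<circ> A \<omega>) g, h\<rangle> = \<langle>A \<omega> g, A \<omega> h\<rangle>" if "h \<in> H" for h
    using P(4)[OF P(1)[OF g] that] by simp
qed

text \<open>Idempotence lets the inner \<open>P\<close> be doubled: one copy goes to each side of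
  the inner product, which exhibits the operator as the square of
  \<open>P \<circ> A \<omega> \<circ> P\<close>.\<close>

lemma gram_compression:
  assumes AB: "random_pair N A B" and bd: "AE \<omega> in N. \<forall>h\<in>H. \<parallel>A \<omega> h\<parallel> \<le> C * \<parallel>h\<parallel>" and C: "C \<ge> 0"
    and L: "closed_subspace \<H> L"
  defines "P \<equiv> orth_proj \<H> L"
  shows "gram N C (\<lambda>\<omega>. P \<circ> A \<omega> \<circ> P) (\<lambda>\<omega>. P \<circ> B \<omega> \<circ> P \<circ> A \<omega> \<circ> P)"
  unfolding gram_def
proof (intro conjI ballI)
  note D = random_pairD[OF AB]
  have PP: "adjoint_pair \<H> P P" unfolding P_def by (rule orth_proj_self_adjoint[OF L])
  note P = adjoint_pairD(1,3)[OF PP]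
  show "weakly_measurable N (\<lambda>\<omega>. (P \<circ> A \<omega> \<circ> P) g)" if g: "g \<in> H" for g
    using weakly_measurable_apply[OF random_pair_const[OF PP] D(2)[OF P(1)[OF g]]] by simp
  show "AE \<omega> in N. \<forall>h\<in>H. \<parallel>(P \<circ> A \<omega> \<circ> P) h\<parallel> \<le> C * \<parallel>h\<parallel>"
    using bd AE_space
  proof eventually_elim
    case (elim \<omega>)
    show ?case
    proof
      fix h assume h: "h \<in> H"
      have "\<parallel>P (A \<omega> (P h))\<parallel> \<le> \<parallel>A \<omega> (P h)\<parallel>"
        unfolding P_def by (intro orth_proj_norm_le[OF L] adjoint_pairD(1)[OF D(1)[OF elim(2)]] P(1)[unfolded P_def] h)
      also have "\<dots> \<le> C * \<parallel>P h\<parallel>" using elim(1) P(1)[OF h] by simp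
      also have "\<dots> \<le> C * \<parallel>h\<parallel>" using orth_proj_norm_le[OF L h] C unfolding P_def by (rule mult_left_mono)
      finally show "\<parallel>(P \<circ> A \<omega> \<circ> P) h\<parallel> \<le> C * \<parallel>h\<parallel>" by simp
    qed
  qed
  fix \<omega> g assume \<omega>: "\<omega> \<in> space N" and g: "g \<in> H"
  note A = adjoint_pairD[OF D(1)[OF \<omega>]]
  have x: "A \<omega> (P g) \<in> H" "P (A \<omega> (P g)) \<in> H" "B \<omega> (P (A \<omega> (P g))) \<in> H"
    using A(1,2) P(1) g by auto
  show "(P \<circ> B \<omega> \<circ> P \<circ> A \<omega> \<circ> P) g \<in> H" using P(1)[OF x(3)] by simp
  fix h assume h: "h \<in> H"
  have y: "P h \<in> H" "A \<omega> (P h) \<in> H" using A(1) P(1) h by auto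
  have "\<langle>P (B \<omega> (P (A \<omega> (P g)))), h\<rangle> = \<langle>P (A \<omega> (P g)), A \<omega> (P h)\<rangle>"
    using P(2)[OF x(3) h] A(4)[OF x(2) y(1)] by simp
  also have "\<dots> = \<langle>P (P (A \<omega> (P g))), A \<omega> (P h)\<rangle>"
    unfolding P_def by (simp only: orth_proj_idem[OF L x(1)[unfolded P_def]])
  also have "\<dots> = \<langle>P (A \<omega> (P g)), P (A \<omega> (P h))\<rangle>" by (rule P(2)[OF x(2) y(2)])
  finally show "\<langle>(P \<circ> B \<omega> \<circ> P \<circ> A \<omega> \<circ> P) g, h\<rangle> = \<langle>(P \<circ> A \<omega> \<circ> P) g, (P \<circ> A \<omega> \<circ> P) h\<rangle>" by simp
qed

text \<open>No convergence in operator norm is involved. Each compressed norm is at most the full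
  one, and a single vector \<open>g\<close> of nearly maximal energy, whose compressed energies
  converge, forces the opposite inequality in the limit.\<close>

lemma opnorm_compression_tendsto:
  fixes L :: "nat \<Rightarrow> 'm series set"
  assumes N: "prob_space N" and AB: "random_pair N A B"
    and bd: "AE \<omega> in N. \<forall>h\<in>H. \<parallel>A \<omega> h\<parallel> \<le> C * \<parallel>h\<parallel>" and C: "C \<ge> 0"
    and L: "\<And>n. closed_subspace \<H> (L n)" and mono: "incseq L"
    and dense: "\<And>g. g \<in> H \<Longrightarrow> (\<And>n. g \<in> orth_compl \<H> (L n)) \<Longrightarrow> g = 0"
  defines "P n \<equiv> orth_proj \<H> (L n)"
  shows "(\<lambda>n. opnorm \<H> (weak_expectation \<H> N (\<lambda>\<omega>. P n \<circ> B \<omega> \<circ> P n \<circ> A \<omega> \<circ> P n)))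
    \<longlonglongrightarrow> opnorm \<H> (weak_expectation \<H> N (\<lambda>\<omega>. B \<omega> \<circ> A \<omega>))"
proof -
  interpret prob_space N by fact
  let ?Wn = "\<lambda>n. weak_expectation \<H> N (\<lambda>\<omega>. P n \<circ> B \<omega> \<circ> P n \<circ> A \<omega> \<circ> P n)"
  let ?W = "weak_expectation \<H> N (\<lambda>\<omega>. B \<omega> \<circ> A \<omega>)"
  note G = gram_pair[OF AB bd]
  have Gn: "gram N C (\<lambda>\<omega>. P n \<circ> A \<omega> \<circ> P n) (\<lambda>\<omega>. P n \<circ> B \<omega> \<circ> P n \<circ> A \<omega> \<circ> P n)" for n
    unfolding P_def by (rule gram_compression[OF AB bd C L])
  have PH: "P n h \<in> H" if "h \<in> H" for n h
    unfolding P_def using adjoint_pairD(1)[OF orth_proj_self_adjoint[OF L] that] .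
  have Pn: "\<parallel>P n h\<parallel> \<le> \<parallel>h\<parallel>" if "h \<in> H" for n h
    unfolding P_def by (rule orth_proj_norm_le[OF L that])
  have Plim: "(\<lambda>n. \<parallel>P n h - h\<parallel>) \<longlonglongrightarrow> 0" if "h \<in> H" for h
    unfolding P_def by (rule orth_proj_tendsto[OF L mono dense that])
  note D = random_pairD[OF AB]
  have upper: "opnorm \<H> (?Wn n) \<le> opnorm \<H> ?W" for n
  proof (rule opnorm_le_of_energy[OF N Gn])
    fix g assume g: "g \<in> H" "\<parallel>g\<parallel> \<le> 1"
    have "energy N (\<lambda>\<omega>. P n \<circ> A \<omega> \<circ> P n) g \<le> energy N A (P n g)"
      unfolding energy_def
    proof (rule integral_mono)
      show "integrable N (\<lambda>\<omega>. \<parallel>(P n \<circ> A \<omega> \<circ> P n) g\<parallel>\<^sup>2)" using gram_energy(1)[OF N Gn g(1)] .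
      show "integrable N (\<lambda>\<omega>. \<parallel>A \<omega> (P n g)\<parallel>\<^sup>2)" using gram_energy(1)[OF N G PH[OF g(1)]] .
      fix \<omega> assume \<omega>: "\<omega> \<in> space N"
      have x: "A \<omega> (P n g) \<in> H" using adjoint_pairD(1)[OF D(1)[OF \<omega>] PH[OF g(1)]] .
      show "\<parallel>(P n \<circ> A \<omega> \<circ> P n) g\<parallel>\<^sup>2 \<le> \<parallel>A \<omega> (P n g)\<parallel>\<^sup>2"
        using power_mono[OF Pn[OF x] norm_nonneg[OF PH[OF x]]] by simp
    qed
    also have "\<dots> \<le> opnorm \<H> ?W"
      using Pn[OF g(1), of n] g by (intro energy_le_opnorm[OF N G] PH) auto
    finally show "energy N (\<lambda>\<omega>. P n \<circ> A \<omega> \<circ> P n) g \<le> opnorm \<H> ?W" .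
  qed
  have lim: "(\<lambda>n. energy N (\<lambda>\<omega>. P n \<circ> A \<omega> \<circ> P n) g) \<longlonglongrightarrow> energy N A g" if g: "g \<in> H" for g
    unfolding energy_def
  proof (rule energy_tendsto[OF N gramD(1)[OF Gn g] gramD(1)[OF G g]])
    show "AE \<omega> in N. \<parallel>(P n \<circ> A \<omega> \<circ> P n) g\<parallel> \<le> C * \<parallel>g\<parallel>" for n
      using gramD(2)[OF Gn[of n]] by eventually_elim (use g in blast)
    show "AE \<omega> in N. (\<lambda>n. \<parallel>(P n \<circ> A \<omega> \<circ> P n) g - A \<omega> g\<parallel>) \<longlonglongrightarrow> 0"
      using bd AE_space
    proof eventually_elim
      case (elim \<omega>)
      note pair = D(1)[OF elim(2)]
      note A = adjoint_pairD(1)[OF pair]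
      show ?case
      proof (rule Lim_null_comparison)
        \<comment> \<open>The inner projection is replaced by the identity at the cost
          \<open>C * \<parallel>P n g - g\<parallel>\<close>, since the outer one is a contraction;
          then the outer projection is removed.\<close>
        have "\<parallel>P n (A \<omega> (P n g)) - A \<omega> g\<parallel> \<le> C * \<parallel>P n g - g\<parallel> + \<parallel>P n (A \<omega> g) - A \<omega> g\<parallel>" for n
        proof -
          have d: "P n g - g \<in> H" using PH g by (intro diff_mem)
          have "P n (A \<omega> (P n g)) - P n (A \<omega> g) = P n (A \<omega> (P n g - g))"
            unfolding adjoint_pair_diff[OF pair PH[OF g] g]
            unfolding P_def
            by (rule adjoint_pair_diff[OF orth_proj_self_adjoint[OF L] A[OF PH[OF g, unfolded P_def]] A[OF g], symmetric])
          then have "\<parallel>P n (A \<omega> (P n g)) - P n (A \<omega> g)\<parallel> \<le> C * \<parallel>P n g - g\<parallel>"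
            using order_trans[OF Pn[OF A[OF d]] elim(1)[rule_format, OF d]] by simp
          then show ?thesis
            using norm_diff_triangle[OF PH[OF A[OF PH[OF g]]] PH[OF A[OF g]] A[OF g]] by (meson add_right_mono order_trans)
        qed
        then show "\<forall>\<^sub>F n in sequentially. norm \<parallel>(P n \<circ> A \<omega> \<circ> P n) g - A \<omega> g\<parallel>
            \<le> C * \<parallel>P n g - g\<parallel> + \<parallel>P n (A \<omega> g) - A \<omega> g\<parallel>"
          using norm_nonneg[OF diff_mem[OF PH[OF A[OF PH[OF g]]] A[OF g]]] by (intro always_eventually) simp
        have "(\<lambda>n. C * \<parallel>P n g - g\<parallel> + \<parallel>P n (A \<omega> g) - A \<omega> g\<parallel>) \<longlonglongrightarrow> C * 0 + 0"
          by (intro tendsto_add tendsto_mult tendsto_const Plim A g)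
        then show "(\<lambda>n. C * \<parallel>P n g - g\<parallel> + \<parallel>P n (A \<omega> g) - A \<omega> g\<parallel>) \<longlonglongrightarrow> 0" by simp
      qed
    qed
  qed
  show ?thesis
  proof (rule order_tendstoI)
    fix a assume a: "a < opnorm \<H> ?W"
    have "\<exists>g. g \<in> H \<and> \<parallel>g\<parallel> \<le> 1 \<and> a < energy N A g"
    proof (rule ccontr)
      assume "\<not> ?thesis"
      then have "energy N A g \<le> a" if "g \<in> H" "\<parallel>g\<parallel> \<le> 1" for g using that by force
      then have "opnorm \<H> ?W \<le> a" by (rule opnorm_le_of_energy[OF N G])
      then show False using a by simp
    qed
    then obtain g where g: "g \<in> H" "\<parallel>g\<parallel> \<le> 1" "a < energy N A g" by blast
    have "\<forall>\<^sub>F n in sequentially. a < energy N (\<lambda>\<omega>. P n \<circ> A \<omega> \<circ> P n) g"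
      using lim[OF g(1)] g(3) by (rule order_tendstoD)
    then show "\<forall>\<^sub>F n in sequentially. a < opnorm \<H> (?Wn n)"
      by eventually_elim (use energy_le_opnorm[OF N Gn g(1,2)] in \<open>meson less_le_trans\<close>)
  next
    fix a assume "opnorm \<H> ?W < a"
    then show "\<forall>\<^sub>F n in sequentially. opnorm \<H> (?Wn n) < a"
      by (intro always_eventually allI le_less_trans[OF upper])
  qed
qed

end

section \<open>Random multipliers\<close>

lemma integrable_cnj_mult:
  fixes f g :: "'w \<Rightarrow> complex"
  assumes "f \<in> borel_measurable N" "g \<in> borel_measurable N"
    and "integrable N (\<lambda>\<omega>. (cmod (f \<omega>))\<^sup>2)" "integrable N (\<lambda>\<omega>. (cmod (g \<omega>))\<^sup>2)"
  shows "integrable N (\<lambda>\<omega>. cnj (f \<omega>) * g \<omega>)"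
proof (rule Bochner_Integration.integrable_bound)
  show "integrable N (\<lambda>\<omega>. (cmod (f \<omega>))\<^sup>2 + (cmod (g \<omega>))\<^sup>2)" using assms by simp
  show "(\<lambda>\<omega>. cnj (f \<omega>) * g \<omega>) \<in> borel_measurable N"
    by (intro borel_measurable_times borel_measurable_cnj assms)
  have "x * y \<le> x\<^sup>2 + y\<^sup>2" if "x \<ge> 0" "y \<ge> 0" for x y :: real
    using sum_squares_bound[of x y] mult_nonneg_nonneg[OF that] by linarith
  then show "AE \<omega> in N. norm (cnj (f \<omega>) * g \<omega>) \<le> norm ((cmod (f \<omega>))\<^sup>2 + (cmod (g \<omega>))\<^sup>2)"
    by (simp add: norm_mult)
qed

text \<open>Expanding the square, all cross terms vanish in expectation. The conjugates fit the
  adjoint, whose coefficients depend antilinearly on those of the series.\<close>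

lemma second_moment_orthogonal_sum:
  fixes Y :: "'i \<Rightarrow> 'w \<Rightarrow> complex"
  assumes I: "finite I" and Y: "\<And>i. Y i \<in> borel_measurable N" "\<And>i. integrable N (\<lambda>\<omega>. (cmod (Y i \<omega>))\<^sup>2)"
    and orth: "\<And>i j. i \<noteq> j \<Longrightarrow> (\<integral>\<omega>. cnj (Y i \<omega>) * Y j \<omega> \<partial>N) = 0"
  shows "integrable N (\<lambda>\<omega>. (cmod (\<Sum>i\<in>I. a i * cnj (Y i \<omega>)))\<^sup>2)"
    and "(\<integral>\<omega>. (cmod (\<Sum>i\<in>I. a i * cnj (Y i \<omega>)))\<^sup>2 \<partial>N) = (\<Sum>i\<in>I. (cmod (a i))\<^sup>2 * (\<integral>\<omega>. (cmod (Y i \<omega>))\<^sup>2 \<partial>N))"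
proof -
  let ?S = "\<lambda>\<omega>. \<Sum>i\<in>I. \<Sum>j\<in>I. (a i * cnj (a j)) * (cnj (Y i \<omega>) * Y j \<omega>)"
  have e: "of_real ((cmod (\<Sum>i\<in>I. a i * cnj (Y i \<omega>)))\<^sup>2) = ?S \<omega>" for \<omega>
    unfolding complex_norm_square cnj_sum sum_product
    by (intro sum.cong refl) (simp add: mult_ac)
  have i: "integrable N (\<lambda>\<omega>. cnj (Y i \<omega>) * Y j \<omega>)" for i j
    by (intro integrable_cnj_mult Y)
  have iS: "integrable N ?S"
    by (intro Bochner_Integration.integrable_sum integrable_mult_right i)
  have "integrable N (\<lambda>\<omega>. Re (?S \<omega>))" using iS by (rule integrable_Re)
  then show "integrable N (\<lambda>\<omega>. (cmod (\<Sum>i\<in>I. a i * cnj (Y i \<omega>)))\<^sup>2)"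
    unfolding e[symmetric] Re_complex_of_real .
  have d: "(\<integral>\<omega>. cnj (Y i \<omega>) * Y i \<omega> \<partial>N) = of_real (\<integral>\<omega>. (cmod (Y i \<omega>))\<^sup>2 \<partial>N)" for i
  proof -
    have "(\<integral>\<omega>. cnj (Y i \<omega>) * Y i \<omega> \<partial>N) = (\<integral>\<omega>. of_real ((cmod (Y i \<omega>))\<^sup>2) \<partial>N)"
      by (simp add: complex_norm_square mult.commute del: of_real_power)
    then show ?thesis by (simp only: integral_complex_of_real)
  qed
  have "of_real (\<integral>\<omega>. (cmod (\<Sum>i\<in>I. a i * cnj (Y i \<omega>)))\<^sup>2 \<partial>N) = (\<integral>\<omega>. ?S \<omega> \<partial>N)"
    unfolding e[symmetric] by (rule integral_complex_of_real[symmetric])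
  also have "\<dots> = (\<Sum>i\<in>I. \<Sum>j\<in>I. (a i * cnj (a j)) * (\<integral>\<omega>. cnj (Y i \<omega>) * Y j \<omega> \<partial>N))"
    by (simp add: Bochner_Integration.integral_sum Bochner_Integration.integrable_sum i del: integral_mult_right_zero)
  also have "\<dots> = (\<Sum>i\<in>I. \<Sum>j\<in>I. if j = i then (a i * cnj (a i)) * of_real (\<integral>\<omega>. (cmod (Y i \<omega>))\<^sup>2 \<partial>N) else 0)"
    by (intro sum.cong refl) (auto simp: orth d)
  also have "\<dots> = of_real (\<Sum>i\<in>I. (cmod (a i))\<^sup>2 * (\<integral>\<omega>. (cmod (Y i \<omega>))\<^sup>2 \<partial>N))"
    using I by (simp add: complex_norm_square[symmetric])
  finally show "(\<integral>\<omega>. (cmod (\<Sum>i\<in>I. a i * cnj (Y i \<omega>)))\<^sup>2 \<partial>N) = (\<Sum>i\<in>I. (cmod (a i))\<^sup>2 * (\<integral>\<omega>. (cmod (Y i \<omega>))\<^sup>2 \<partial>N))"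
    unfolding of_real_eq_iff .
qed

context indexed_committee_space
begin

text \<open>Since \<open>mult_op\<close> switches to the zero operator off this event, measurability
  of the random operator rests on it.\<close>

lemma pred_multiplier:
  assumes v: "\<And>\<gamma>. v \<gamma> \<in> borel_measurable N"
  shows "Measurable.pred N (\<lambda>\<omega>. multiplier \<H> (\<lambda>\<gamma>. v \<gamma> \<omega>))"
proof -
  have "(\<lambda>\<omega>. \<Sum>\<alpha>\<in>first_indices n. (cmod (series_mult (\<lambda>\<gamma>. v \<gamma> \<omega>) p \<alpha>))\<^sup>2 * (weight \<alpha>)\<^sup>2) \<in> borel_measurable N" for n p
    unfolding series_mult_alt
    by (intro borel_measurable_sum borel_measurable_times borel_measurable_power measurable_compose[OF _ borel_measurable_norm]
        borel_measurable_const v)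
  then have "Measurable.pred N (\<lambda>\<omega>. (\<Sum>\<alpha>\<in>first_indices n. (cmod (series_mult (\<lambda>\<gamma>. v \<gamma> \<omega>) p \<alpha>))\<^sup>2 * (weight \<alpha>)\<^sup>2)
      \<le> (real K * \<parallel>p\<parallel>)\<^sup>2)" for n p K
    unfolding pred_def by (rule borel_measurable_le[OF _ borel_measurable_const])
  then show ?thesis
    unfolding multiplier_iff pred_def
    by (intro sets.sets_Collect_countable_Ex sets.sets_Collect_countable_All'
        sets.sets_Collect_countable_All countable_dense_polys countable_indices)
qed

lemma random_pair_mult_op:
  assumes v: "\<And>\<gamma>. v \<gamma> \<in> borel_measurable N"
  defines "M \<equiv> \<lambda>\<omega>. mult_op \<H> (\<lambda>\<gamma>. v \<gamma> \<omega>)"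
  shows "random_pair N M (\<lambda>\<omega>. adj \<H> (M \<omega>))"
  unfolding random_pair_def
proof (intro conjI ballI)
  show "adjoint_pair \<H> (M \<omega>) (adj \<H> (M \<omega>))" for \<omega>
    unfolding M_def by (rule mult_op_pair)
  fix h assume h: "h \<in> H"
  show "weakly_measurable N (\<lambda>\<omega>. M \<omega> h)"
  proof (rule weakly_measurable_of_coeff)
    show "M \<omega> h \<in> H" for \<omega> unfolding M_def by (rule mult_op_mem[OF h])
    fix \<alpha>
    have "(\<lambda>\<omega>. if multiplier \<H> (\<lambda>\<gamma>. v \<gamma> \<omega>) then series_mult (\<lambda>\<gamma>. v \<gamma> \<omega>) h \<alpha> else 0) \<in> borel_measurable N"
      unfolding series_mult_alt
      by (intro measurable_If borel_measurable_sum borel_measurable_times borel_measurable_const v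
          pred_multiplier[OF v, unfolded pred_def])
    also have "?this \<longleftrightarrow> (\<lambda>\<omega>. M \<omega> h \<alpha>) \<in> borel_measurable N"
      by (intro measurable_cong) (simp add: M_def mult_op_def)
    finally show "(\<lambda>\<omega>. M \<omega> h \<alpha>) \<in> borel_measurable N" .
  qed
qed

text \<open>The left-hand side is the inner product of the adjoint's value with
  \<open>z^\<beta>\<close>, that is, of the polynomial with \<open>f z^\<beta>\<close>, whose
  coefficient at \<open>\<gamma> + \<beta>\<close> is \<open>f \<gamma>\<close>.\<close>

lemma adj_mult_op_coeff:
  assumes f: "multiplier \<H> f" and F: "finite F"
  shows "adj \<H> (mult_op \<H> f) (truncation F p) \<beta> * of_real ((weight \<beta>)\<^sup>2) =
    (\<Sum>\<gamma>\<in>{\<gamma>. \<gamma> + \<beta> \<in> F}. (p (\<gamma> + \<beta>) * of_real ((weight (\<gamma> + \<beta>))\<^sup>2)) * cnj (f \<gamma>))"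
proof -
  let ?M = "mult_op \<H> f"
  note P = adjoint_pairD[OF mult_op_pair[of f]]
  have z: "?M (monomial \<beta>) \<in> H" "truncation F p \<in> H" using P(1)[OF monomial_mem] truncation_mem[OF F] by auto
  have "adj \<H> ?M (truncation F p) \<beta> * of_real ((weight \<beta>)\<^sup>2) = \<langle>truncation F p, ?M (monomial \<beta>)\<rangle>"
    using ip_monomial[OF P(2)[OF z(2)]] P(4)[OF z(2) monomial_mem] by simp
  also have "\<dots> = cnj \<langle>?M (monomial \<beta>), truncation F p\<rangle>" by (rule ip_cnj[OF z])
  also have "\<dots> = (\<Sum>\<alpha>\<in>F. (p \<alpha> * of_real ((weight \<alpha>)\<^sup>2)) * cnj (series_mult f (monomial \<beta>) \<alpha>))"
    unfolding ip_truncation[OF F z(1)] cnj_sum using f by (intro sum.cong refl) (simp add: mult_op_def)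
  also have "\<dots> = (\<Sum>\<alpha>\<in>(\<lambda>\<gamma>. \<gamma> + \<beta>) ` {\<gamma>. \<gamma> + \<beta> \<in> F}. (p \<alpha> * of_real ((weight \<alpha>)\<^sup>2)) * cnj (series_mult f (monomial \<beta>) \<alpha>))"
  proof (rule sum.mono_neutral_right[OF F])
    show "\<forall>\<alpha>\<in>F - (\<lambda>\<gamma>. \<gamma> + \<beta>) ` {\<gamma>. \<gamma> + \<beta> \<in> F}.
        (p \<alpha> * of_real ((weight \<alpha>)\<^sup>2)) * cnj (series_mult f (monomial \<beta>) \<alpha>) = 0"
    proof
      fix \<alpha> assume "\<alpha> \<in> F - (\<lambda>\<gamma>. \<gamma> + \<beta>) ` {\<gamma>. \<gamma> + \<beta> \<in> F}"
      then have "series_mult f (monomial \<beta>) \<alpha> = 0"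
        by (intro series_mult_monomial_eq_0) blast
      then show "(p \<alpha> * of_real ((weight \<alpha>)\<^sup>2)) * cnj (series_mult f (monomial \<beta>) \<alpha>) = 0" by simp
    qed
  qed auto
  also have "\<dots> = (\<Sum>\<gamma>\<in>{\<gamma>. \<gamma> + \<beta> \<in> F}. (p (\<gamma> + \<beta>) * of_real ((weight (\<gamma> + \<beta>))\<^sup>2)) * cnj (f \<gamma>))"
    using cancel_right by (subst sum.reindex) (auto simp: inj_on_def series_mult_monomial)
  finally show ?thesis .
qed

text \<open>This is where the committee inequality enters: the quotient is the one that occurs in
  the diagonal entries of \<open>R_v\<close>.\<close>

lemma weight_add_div: "(weight (\<gamma> + \<beta>))\<^sup>2 / (weight \<beta>)\<^sup>2 \<le> (weight \<gamma>)\<^sup>2"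
proof -
  have "(weight (\<gamma> + \<beta>))\<^sup>2 \<le> (weight \<gamma> * weight \<beta>)\<^sup>2"
    using committee_inequality[of \<gamma> \<beta>] norm_nonneg[OF monomial_mem] by (intro power_mono)
  then show ?thesis using weight_pos[of \<beta>] by (simp add: divide_le_eq power_mult_distrib)
qed

end

locale random_multiplier = indexed_committee_space \<H>
  for \<H> :: "('m::monoid_add) series_space" +
  fixes N :: "'w measure" and v :: "'m \<Rightarrow> 'w \<Rightarrow> complex"
  assumes model: "random_multiplier_model \<H> N v"
begin

definition M :: "'w \<Rightarrow> 'm operator" where "M \<omega> = mult_op \<H> (\<lambda>\<gamma>. v \<gamma> \<omega>)"

definition second_moment :: "'m \<Rightarrow> real" where "second_moment \<gamma> = (\<integral>\<omega>. (cmod (v \<gamma> \<omega>))\<^sup>2 \<partial>N)"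

lemma modelD:
  shows "prob_space N" "v \<gamma> \<in> borel_measurable N" "integrable N (\<lambda>\<omega>. (cmod (v \<gamma> \<omega>))\<^sup>2)"
    "\<gamma> \<noteq> \<gamma>' \<Longrightarrow> (\<integral>\<omega>. cnj (v \<gamma> \<omega>) * v \<gamma>' \<omega> \<partial>N) = 0"
    "\<exists>C>0. AE \<omega> in N. multiplier \<H> (\<lambda>\<gamma>. v \<gamma> \<omega>) \<and> opnorm \<H> (M \<omega>) \<le> C"
  using model by (auto simp: random_multiplier_model_def M_def)

lemma M_pair: "random_pair N M (\<lambda>\<omega>. adj \<H> (M \<omega>))"
  unfolding M_def by (rule random_pair_mult_op[OF modelD(2)])

lemma AE_multiplier: "AE \<omega> in N. multiplier \<H> (\<lambda>\<gamma>. v \<gamma> \<omega>)"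
  using modelD(5) by (auto elim: eventually_mono)

lemma M_bound:
  obtains C where "C > 0" "AE \<omega> in N. \<forall>h\<in>H. \<parallel>M \<omega> h\<parallel> \<le> C * \<parallel>h\<parallel>"
    "AE \<omega> in N. \<forall>h\<in>H. \<parallel>adj \<H> (M \<omega>) h\<parallel> \<le> C * \<parallel>h\<parallel>"
proof -
  obtain C where C: "C > 0" "AE \<omega> in N. multiplier \<H> (\<lambda>\<gamma>. v \<gamma> \<omega>) \<and> opnorm \<H> (M \<omega>) \<le> C"
    using modelD(5) by blast
  have b: "AE \<omega> in N. \<forall>h\<in>H. \<parallel>M \<omega> h\<parallel> \<le> C * \<parallel>h\<parallel>"
    using C(2)
  proof eventually_elim
    case (elim \<omega>)
    show ?case
    proof
      fix h assume h: "h \<in> H"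
      have "\<parallel>M \<omega> h\<parallel> \<le> opnorm \<H> (M \<omega>) * \<parallel>h\<parallel>" unfolding M_def by (rule mult_op_le_opnorm[OF h])
      also have "\<dots> \<le> C * \<parallel>h\<parallel>" using elim norm_nonneg[OF h] by (intro mult_right_mono) auto
      finally show "\<parallel>M \<omega> h\<parallel> \<le> C * \<parallel>h\<parallel>" .
    qed
  qed
  moreover have "AE \<omega> in N. \<forall>h\<in>H. \<parallel>adj \<H> (M \<omega>) h\<parallel> \<le> C * \<parallel>h\<parallel>"
    using b
  proof eventually_elim
    case (elim \<omega>)
    have "adjoint_pair \<H> (M \<omega>) (adj \<H> (M \<omega>))" unfolding M_def by (rule mult_op_pair)
    from adjoint_bound[OF this] elim show ?case by blast
  qed
  ultimately show thesis using that C(1) by blast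
qed

text \<open>Almost surely \<open>M \<omega> (monomial 0)\<close> is the random series itself, and
  the left-hand side is the expected squared norm of its truncation to \<open>F\<close>.\<close>

lemma sum_second_moment_le_energy:
  assumes F: "finite F"
  shows "(\<Sum>\<gamma>\<in>F. second_moment \<gamma> * (weight \<gamma>)\<^sup>2) \<le> energy N M (monomial 0)"
proof -
  obtain C where C: "AE \<omega> in N. \<forall>h\<in>H. \<parallel>M \<omega> h\<parallel> \<le> C * \<parallel>h\<parallel>" using M_bound by blast
  note i = gram_energy(1)[OF modelD(1) gram_pair[OF M_pair C] monomial_mem, of 0]
  have "(\<Sum>\<gamma>\<in>F. second_moment \<gamma> * (weight \<gamma>)\<^sup>2) = (\<integral>\<omega>. (\<Sum>\<gamma>\<in>F. (cmod (v \<gamma> \<omega>))\<^sup>2 * (weight \<gamma>)\<^sup>2) \<partial>N)"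
    using modelD(3) by (simp add: second_moment_def)
  also have "\<dots> \<le> (\<integral>\<omega>. \<parallel>M \<omega> (monomial 0)\<parallel>\<^sup>2 \<partial>N)"
  proof (rule integral_mono_AE)
    show "integrable N (\<lambda>\<omega>. \<Sum>\<gamma>\<in>F. (cmod (v \<gamma> \<omega>))\<^sup>2 * (weight \<gamma>)\<^sup>2)" using modelD(3) by simp
    show "AE \<omega> in N. (\<Sum>\<gamma>\<in>F. (cmod (v \<gamma> \<omega>))\<^sup>2 * (weight \<gamma>)\<^sup>2) \<le> \<parallel>M \<omega> (monomial 0)\<parallel>\<^sup>2"
      using AE_multiplier
    proof eventually_elim
      case (elim \<omega>)
      have e: "M \<omega> (monomial 0) = (\<lambda>\<gamma>. v \<gamma> \<omega>)" using elim by (simp add: M_def mult_op_def series_mult_one)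
      then have m: "(\<lambda>\<gamma>. v \<gamma> \<omega>) \<in> H" using mult_op_mem[OF monomial_mem] unfolding M_def by metis
      have "\<parallel>truncation F (\<lambda>\<gamma>. v \<gamma> \<omega>)\<parallel>\<^sup>2 \<le> \<parallel>\<lambda>\<gamma>. v \<gamma> \<omega>\<parallel>\<^sup>2"
        using norm_truncation_le[OF F m] norm_nonneg[OF truncation_mem[OF F]] by (rule power_mono)
      then show ?case unfolding e norm_truncation_sq[OF F] .
    qed
  qed (rule i)
  finally show ?thesis by (simp add: energy_def)
qed

text \<open>The coefficient at \<open>\<beta>\<close> of the adjoint's value is a sum over
  \<open>\<gamma>\<close> of conjugated \<open>v \<gamma>\<close>, so uncorrelatedness reduces the
  energy to a sum over pairs. Grouped by \<open>\<alpha> = \<gamma> + \<beta>\<close>, it is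
  diagonal in the coefficients of \<open>p\<close>, and the committee inequality bounds each
  diagonal entry by \<open>c\<close>.\<close>

lemma energy_adj_truncation_le:
  assumes F: "finite F" and c: "\<And>G. finite G \<Longrightarrow> (\<Sum>\<gamma>\<in>G. second_moment \<gamma> * (weight \<gamma>)\<^sup>2) \<le> c"
  shows "energy N (\<lambda>\<omega>. adj \<H> (M \<omega>)) (truncation F p) \<le> c * \<parallel>truncation F p\<parallel>\<^sup>2"
proof -
  define \<Gamma> where "\<Gamma> \<beta> = {\<gamma>. \<gamma> + \<beta> \<in> F}" for \<beta> :: 'm
  \<comment> \<open>The contributing pairs; they are finite in number because each index in
    \<open>F\<close> has finitely many decompositions.\<close>
  define E where "E = {(\<beta>, \<gamma>). \<gamma> + \<beta> \<in> F}"
  \<comment> \<open>For \<open>\<beta>\<close> outside \<open>B\<close> the sum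
    \<open>T \<beta>\<close> is empty, so the image of the truncation is supported in this finite
    set.\<close>
  define B where "B = fst ` E"
  define a where "a \<beta> \<gamma> = p (\<gamma> + \<beta>) * of_real ((weight (\<gamma> + \<beta>))\<^sup>2)" for \<beta> \<gamma>
  define T where "T \<beta> \<omega> = (\<Sum>\<gamma>\<in>\<Gamma> \<beta>. a \<beta> \<gamma> * cnj (v \<gamma> \<omega>))" for \<beta> \<omega>
  have "E = (\<Union>\<alpha>\<in>F. prod.swap ` {(\<gamma>, \<beta>). \<gamma> + \<beta> = \<alpha>})" by (force simp: E_def)
  then have finE: "finite E" using F finite_decompositions by simp
  have finB: "finite B" unfolding B_def using finE by simp
  have E_Sigma: "E = Sigma B \<Gamma>" by (force simp: E_def B_def \<Gamma>_def)
  have finG: "finite (\<Gamma> \<beta>)" for \<beta>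
    by (rule finite_subset[of _ "snd ` E"]) (use finE in \<open>force simp: \<Gamma>_def E_def\<close>)+
  note T = second_moment_orthogonal_sum[where Y = v and N = N and I = "\<Gamma> \<beta>" and a = "a \<beta>" for \<beta>,
      OF finG modelD(2) modelD(3) modelD(4), folded T_def second_moment_def]
  have norm_eq: "\<parallel>adj \<H> (M \<omega>) (truncation F p)\<parallel>\<^sup>2 = (\<Sum>\<beta>\<in>B. (cmod (T \<beta> \<omega>))\<^sup>2 / (weight \<beta>)\<^sup>2)"
    if m: "multiplier \<H> (\<lambda>\<gamma>. v \<gamma> \<omega>)" for \<omega>
  proof -
    let ?u = "adj \<H> (M \<omega>) (truncation F p)"
    have coeff: "?u \<beta> * of_real ((weight \<beta>)\<^sup>2) = T \<beta> \<omega>" for \<beta>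
      using adj_mult_op_coeff[OF m F, of p \<beta>] by (simp add: M_def T_def a_def \<Gamma>_def)
    have "?u \<beta> = 0" if "\<beta> \<notin> B" for \<beta>
    proof -
      have "\<Gamma> \<beta> = {}" using that by (force simp: B_def E_def \<Gamma>_def)
      then show ?thesis using coeff[of \<beta>] weight_pos[of \<beta>] by (simp add: T_def)
    qed
    then have "truncation B ?u = ?u" by (auto simp: truncation_def fun_eq_iff)
    then have "\<parallel>?u\<parallel>\<^sup>2 = (\<Sum>\<beta>\<in>B. (cmod (?u \<beta>))\<^sup>2 * (weight \<beta>)\<^sup>2)"
      using norm_truncation_sq[OF finB, of ?u] by simp
    also have "\<dots> = (\<Sum>\<beta>\<in>B. (cmod (T \<beta> \<omega>))\<^sup>2 / (weight \<beta>)\<^sup>2)"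
    proof (intro sum.cong refl)
      fix \<beta>
      have "cmod (T \<beta> \<omega>) = cmod (?u \<beta>) * (weight \<beta>)\<^sup>2"
        unfolding coeff[symmetric] by (simp add: norm_mult norm_power norm_nonneg monomial_mem)
      then show "(cmod (?u \<beta>))\<^sup>2 * (weight \<beta>)\<^sup>2 = (cmod (T \<beta> \<omega>))\<^sup>2 / (weight \<beta>)\<^sup>2"
        using weight_pos[of \<beta>] by (simp add: power_mult_distrib power2_eq_square)
    qed
    finally show ?thesis .
  qed
  obtain C where C: "AE \<omega> in N. \<forall>h\<in>H. \<parallel>adj \<H> (M \<omega>) h\<parallel> \<le> C * \<parallel>h\<parallel>" using M_bound by blast
  note i = gram_energy(1)[OF modelD(1) gram_pair[OF random_pair_sym[OF M_pair] C] truncation_mem[OF F]]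
  have "energy N (\<lambda>\<omega>. adj \<H> (M \<omega>)) (truncation F p) = (\<integral>\<omega>. (\<Sum>\<beta>\<in>B. (cmod (T \<beta> \<omega>))\<^sup>2 / (weight \<beta>)\<^sup>2) \<partial>N)"
    unfolding energy_def
  proof (rule integral_cong_AE)
    show "AE \<omega> in N. \<parallel>adj \<H> (M \<omega>) (truncation F p)\<parallel>\<^sup>2 = (\<Sum>\<beta>\<in>B. (cmod (T \<beta> \<omega>))\<^sup>2 / (weight \<beta>)\<^sup>2)"
      using AE_multiplier by eventually_elim (rule norm_eq)
    show "(\<lambda>\<omega>. \<parallel>adj \<H> (M \<omega>) (truncation F p)\<parallel>\<^sup>2) \<in> borel_measurable N"
      using i by (rule borel_measurable_integrable)
    show "(\<lambda>\<omega>. \<Sum>\<beta>\<in>B. (cmod (T \<beta> \<omega>))\<^sup>2 / (weight \<beta>)\<^sup>2) \<in> borel_measurable N"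
      using borel_measurable_integrable[OF T(1)]
      by (intro borel_measurable_sum borel_measurable_divide borel_measurable_const)
  qed
  also have "\<dots> = (\<Sum>\<beta>\<in>B. (\<Sum>\<gamma>\<in>\<Gamma> \<beta>. (cmod (a \<beta> \<gamma>))\<^sup>2 * second_moment \<gamma>) / (weight \<beta>)\<^sup>2)"
    by (simp add: T Bochner_Integration.integral_sum)
  also have "\<dots> = (\<Sum>\<beta>\<in>B. \<Sum>\<gamma>\<in>\<Gamma> \<beta>. (cmod (a \<beta> \<gamma>))\<^sup>2 * second_moment \<gamma> / (weight \<beta>)\<^sup>2)"
    by (simp add: sum_divide_distrib)
  also have "\<dots> = (\<Sum>(\<beta>, \<gamma>)\<in>E. (cmod (a \<beta> \<gamma>))\<^sup>2 * second_moment \<gamma> / (weight \<beta>)\<^sup>2)"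
    unfolding E_Sigma using finB finG by (intro sum.Sigma) auto
  also have "\<dots> \<le> (\<Sum>(\<beta>, \<gamma>)\<in>E. ((cmod (p (\<gamma> + \<beta>)))\<^sup>2 * (weight (\<gamma> + \<beta>))\<^sup>2) * (second_moment \<gamma> * (weight \<gamma>)\<^sup>2))"
  proof (intro sum_mono, clarify)
    fix \<beta> \<gamma>
    have "(cmod (a \<beta> \<gamma>))\<^sup>2 * second_moment \<gamma> / (weight \<beta>)\<^sup>2
        = (cmod (p (\<gamma> + \<beta>)))\<^sup>2 * (weight (\<gamma> + \<beta>))\<^sup>2 * second_moment \<gamma> * ((weight (\<gamma> + \<beta>))\<^sup>2 / (weight \<beta>)\<^sup>2)"
      by (simp add: a_def norm_mult norm_power power_mult_distrib power2_eq_square)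
    also have "\<dots> \<le> (cmod (p (\<gamma> + \<beta>)))\<^sup>2 * (weight (\<gamma> + \<beta>))\<^sup>2 * second_moment \<gamma> * (weight \<gamma>)\<^sup>2"
      by (rule mult_left_mono[OF weight_add_div]) (simp add: second_moment_def)
    finally show "(cmod (a \<beta> \<gamma>))\<^sup>2 * second_moment \<gamma> / (weight \<beta>)\<^sup>2
        \<le> ((cmod (p (\<gamma> + \<beta>)))\<^sup>2 * (weight (\<gamma> + \<beta>))\<^sup>2) * (second_moment \<gamma> * (weight \<gamma>)\<^sup>2)" by (simp only: mult.assoc)
  qed
  \<comment> \<open>The pairs are regrouped according to the index \<open>\<gamma> + \<beta>\<close>
    in \<open>F\<close>.\<close>
  also have "\<dots> = (\<Sum>\<alpha>\<in>F. \<Sum>x\<in>{x\<in>E. snd x + fst x = \<alpha>}.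
      ((cmod (p (snd x + fst x)))\<^sup>2 * (weight (snd x + fst x))\<^sup>2) * (second_moment (snd x) * (weight (snd x))\<^sup>2))"
    by (subst sum.group[OF finE F]) (auto simp: E_def split_beta)
  also have "\<dots> = (\<Sum>\<alpha>\<in>F. ((cmod (p \<alpha>))\<^sup>2 * (weight \<alpha>)\<^sup>2) * (\<Sum>x\<in>{x\<in>E. snd x + fst x = \<alpha>}. second_moment (snd x) * (weight (snd x))\<^sup>2))"
    by (simp add: sum_distrib_left)
  also have "\<dots> \<le> (\<Sum>\<alpha>\<in>F. ((cmod (p \<alpha>))\<^sup>2 * (weight \<alpha>)\<^sup>2) * c)"
  proof (intro sum_mono mult_left_mono)
    fix \<alpha>
    \<comment> \<open>For fixed \<open>\<alpha>\<close>, left cancellation recovers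
      \<open>\<beta>\<close> from \<open>\<gamma>\<close>; hence no second moment is counted twice
      and the hypothesis on finite sums applies.\<close>
    have inj: "inj_on snd {x\<in>E. snd x + fst x = \<alpha>}"
      using cancel_left by (force simp: inj_on_def)
    have "(\<Sum>x\<in>{x\<in>E. snd x + fst x = \<alpha>}. second_moment (snd x) * (weight (snd x))\<^sup>2)
        = (\<Sum>\<gamma>\<in>snd ` {x\<in>E. snd x + fst x = \<alpha>}. second_moment \<gamma> * (weight \<gamma>)\<^sup>2)"
      by (simp add: sum.reindex[OF inj])
    also have "\<dots> \<le> c" using finE by (intro c) simp
    finally show "(\<Sum>x\<in>{x\<in>E. snd x + fst x = \<alpha>}. second_moment (snd x) * (weight (snd x))\<^sup>2) \<le> c" .
  qed simp
  also have "\<dots> = c * \<parallel>truncation F p\<parallel>\<^sup>2" by (simp add: norm_truncation_sq[OF F] sum_distrib_left mult.commute)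
  finally show ?thesis .
qed

text \<open>The column energy \<open>c\<close> of the constant series 1 separates the two norms. The
  row energy is at most \<open>c\<close> on truncations of vectors in the unit ball, and dominated
  convergence carries this to the whole unit ball.\<close>

lemma row_le_col:
  assumes one: "\<parallel>monomial 0\<parallel> = 1"
  shows "opnorm \<H> (weak_expectation \<H> N (\<lambda>\<omega>. M \<omega> \<circ> adj \<H> (M \<omega>)))
    \<le> opnorm \<H> (weak_expectation \<H> N (\<lambda>\<omega>. adj \<H> (M \<omega>) \<circ> M \<omega>))"
proof -
  obtain C where C: "C > 0" "AE \<omega> in N. \<forall>h\<in>H. \<parallel>M \<omega> h\<parallel> \<le> C * \<parallel>h\<parallel>"
    "AE \<omega> in N. \<forall>h\<in>H. \<parallel>adj \<H> (M \<omega>) h\<parallel> \<le> C * \<parallel>h\<parallel>" using M_bound by blast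
  note N = modelD(1)
  note M' = random_pair_sym[OF M_pair]
  note col = gram_pair[OF M_pair C(2)] and row = gram_pair[OF M' C(3)]
  let ?A = "\<lambda>\<omega>. adj \<H> (M \<omega>)"
  define c where "c = energy N M (monomial 0)"
  have c0: "0 \<le> c" unfolding c_def by (rule gram_energy(3)[OF N col monomial_mem])
  have truncation: "energy N ?A (truncation (first_indices n) g) \<le> c" if g: "g \<in> H" "\<parallel>g\<parallel> \<le> 1" for g n
  proof -
    have "energy N ?A (truncation (first_indices n) g) \<le> c * \<parallel>truncation (first_indices n) g\<parallel>\<^sup>2"
      by (rule energy_adj_truncation_le) (simp_all add: sum_second_moment_le_energy c_def)
    also have "\<dots> \<le> c * 1"
      using order_trans[OF norm_truncation_le[OF finite_first_indices g(1)] g(2), of n] norm_nonneg[OF truncation_mem[OF finite_first_indices]] c0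
      by (intro mult_left_mono power_le_one) auto
    finally show ?thesis by simp
  qed
  have "energy N ?A g \<le> c" if g: "g \<in> H" "\<parallel>g\<parallel> \<le> 1" for g
  proof (rule LIMSEQ_le_const2)
    show "(\<lambda>n. energy N ?A (truncation (first_indices n) g)) \<longlonglongrightarrow> energy N ?A g"
      unfolding energy_def
    proof (rule energy_tendsto[OF N gramD(1)[OF row truncation_mem[OF finite_first_indices]] gramD(1)[OF row g(1)]])
      show "AE \<omega> in N. \<parallel>?A \<omega> (truncation (first_indices n) g)\<parallel> \<le> C" for n
        using C(3)
      proof eventually_elim
        case (elim \<omega>)
        have "\<parallel>?A \<omega> (truncation (first_indices n) g)\<parallel> \<le> C * \<parallel>truncation (first_indices n) g\<parallel>" using elim truncation_mem[OF finite_first_indices] by blast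
        also have "\<dots> \<le> C * 1"
          using order_trans[OF norm_truncation_le[OF finite_first_indices g(1)] g(2), of n] C(1) by (intro mult_left_mono) auto
        finally show ?case by simp
      qed
      show "AE \<omega> in N. (\<lambda>n. \<parallel>?A \<omega> (truncation (first_indices n) g) - ?A \<omega> g\<parallel>) \<longlonglongrightarrow> 0"
        using C(3) AE_space
      proof eventually_elim
        case (elim \<omega>)
        note P = random_pairD(1)[OF M' elim(2)]
        show ?case
        proof (rule Lim_null_comparison)
          have d: "truncation (first_indices n) g - g \<in> H" for n using truncation_mem[OF finite_first_indices] g(1) by (rule diff_mem)
          show "\<forall>\<^sub>F n in sequentially. norm \<parallel>?A \<omega> (truncation (first_indices n) g) - ?A \<omega> g\<parallel> \<le> C * \<parallel>truncation (first_indices n) g - g\<parallel>"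
            unfolding adjoint_pair_diff[OF P truncation_mem[OF finite_first_indices] g(1), symmetric]
            using norm_nonneg[OF adjoint_pairD(1)[OF P d]] elim(1)[rule_format, OF d]
            by (intro always_eventually) simp
          show "(\<lambda>n. C * \<parallel>truncation (first_indices n) g - g\<parallel>) \<longlonglongrightarrow> 0"
            using tendsto_mult_right_zero[OF truncation_tendsto[OF g(1)]] .
        qed
      qed
    qed
    show "\<exists>K. \<forall>n\<ge>K. energy N ?A (truncation (first_indices n) g) \<le> c" using truncation[OF g] by blast
  qed
  then have "opnorm \<H> (weak_expectation \<H> N (\<lambda>\<omega>. M \<omega> \<circ> ?A \<omega>)) \<le> c"
    by (rule opnorm_le_of_energy[OF N row])
  \<comment> \<open>The normalization puts \<open>monomial 0\<close> into the unit ball, so its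
    energy is one of those bounded by the column norm.\<close>
  also have "c \<le> opnorm \<H> (weak_expectation \<H> N (\<lambda>\<omega>. ?A \<omega> \<circ> M \<omega>))"
    unfolding c_def using one by (intro energy_le_opnorm[OF N col monomial_mem]) simp
  finally show ?thesis .
qed

end

section \<open>Evaluation at points\<close>

text \<open>Sorting points by size turns \<open>point_dim\<close> into a fixed number and keeps all
  matrix indices in range; with countably many labels each such set is measurable.\<close>

definition square_points :: "nat \<Rightarrow> 'i point set" where
  "square_points n = {x. \<forall>i. x i \<in> carrier_mat n n}"

lemma point_dim_eq: "x \<in> square_points n \<Longrightarrow> point_dim x = n"
  unfolding point_dim_def square_points_def
  by (rule the_equality) (simp, metis carrier_matD(1) mem_Collect_eq)

lemma mat_mult_entry:
  assumes "A \<in> carrier_mat n n" "B \<in> carrier_mat n n" "a < n" "b < n"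
  shows "(A * B) $$ (a, b) = (\<Sum>j<n. A $$ (a, j) * B $$ (j, b))"
  using assms by (auto simp: scalar_prod_def atLeast0LessThan intro!: sum.cong)

lemma word_at_simps:
  assumes x: "x \<in> square_points n"
  shows "word_at x [] = 1\<^sub>m n" "word_at x (i # w) = x i * word_at x w" "word_at x w \<in> carrier_mat n n"
proof -
  show e: "word_at x [] = 1\<^sub>m n" "word_at x (i # w) = x i * word_at x w" for i w
    by (simp_all add: word_at_def point_dim_eq[OF x])
  show "word_at x w \<in> carrier_mat n n"
  proof (induction w)
    case (Cons i w)
    then show ?case using x by (auto simp: e square_points_def intro!: mult_carrier_mat)
  qed (simp add: e)
qed

lemma sets_point_space_Basic:
  "{x :: 'i point. x i \<in> carrier_mat m n} \<in> sets point_space"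
  "a < m \<Longrightarrow> b < n \<Longrightarrow> open B \<Longrightarrow> {x :: 'i point. x i \<in> carrier_mat m n \<and> x i $$ (a, b) \<in> B} \<in> sets point_space"
  unfolding point_space_def by (subst sets_measure_of; (intro sigma_sets.Basic)?; blast)+

lemma space_point_space [simp]: "space point_space = UNIV"
  by (simp add: point_space_def space_measure_of_conv)

lemma sets_square_points: "square_points n \<in> sets (point_space :: 'i::countable point measure)"
proof -
  have "square_points n = (\<Inter>i::'i. {x. x i \<in> carrier_mat n n})" by (auto simp: square_points_def)
  also have "\<dots> \<in> sets point_space"
    using sets_point_space_Basic(1) by (intro sets.countable_INT'') (auto simp flip: space_point_space)
  finally show ?thesis .
qed

text \<open>The value \<open>0\<close> off the measurable set \<open>square_points n\<close> replaces the junk values of matrix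
  entries that are out of range.\<close>

lemma measurable_coordinate:
  fixes i :: "'i::countable"
  assumes "a < n" "b < n"
  shows "(\<lambda>x. if x \<in> square_points n then x i $$ (a, b) else 0) \<in> borel_measurable (point_space :: 'i point measure)"
proof (rule borel_measurableI)
  fix B :: "complex set" assume B: "open B"
  let ?f = "\<lambda>x :: 'i point. if x \<in> square_points n then x i $$ (a, b) else 0"
  have "?f -` B \<inter> space point_space
      = (square_points n \<inter> {x. x i \<in> carrier_mat n n \<and> x i $$ (a, b) \<in> B}) \<union> (if 0 \<in> B then space point_space - square_points n else {})"
    by (auto simp: square_points_def split: if_splits)
  also have "\<dots> \<in> sets point_space"
    using sets_point_space_Basic(2)[OF assms B, of i]
    by (cases "0 \<in> B") (simp_all only: if_True if_False sets_square_points sets.Un sets.Int sets.Diff sets.top sets.empty_sets)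
  finally show "?f -` B \<inter> space point_space \<in> sets point_space" .
qed

lemma measurable_word_at:
  assumes "a < n" "b < n"
  shows "(\<lambda>x. if x \<in> square_points n then word_at x w $$ (a, b) else 0)
    \<in> borel_measurable (point_space :: 'i::countable point measure)"
  using assms
proof (induction w arbitrary: a b)
  case Nil
  have "(\<lambda>x. if x \<in> square_points n then 1\<^sub>m n $$ (a, b) else 0) \<in> borel_measurable (point_space :: 'i point measure)"
    using sets_square_points by (intro measurable_If_set) auto
  then show ?case by (simp add: word_at_simps(1) cong: if_cong)
next
  case (Cons i w)
  have "(\<lambda>x. \<Sum>j<n. (if x \<in> square_points n then x i $$ (a, j) else 0) *
      (if x \<in> square_points n then word_at x w $$ (j, b) else 0)) \<in> borel_measurable (point_space :: 'i point measure)"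
    using Cons by (intro borel_measurable_sum borel_measurable_times measurable_coordinate Cons.IH) auto
  also have "(\<lambda>x. \<Sum>j<n. (if x \<in> square_points n then x i $$ (a, j) else 0) *
      (if x \<in> square_points n then word_at x w $$ (j, b) else 0))
    = (\<lambda>x. if x \<in> square_points n then word_at x (i # w) $$ (a, b) else 0)"
  proof
    fix x :: "'i point"
    show "(\<Sum>j<n. (if x \<in> square_points n then x i $$ (a, j) else 0) *
        (if x \<in> square_points n then word_at x w $$ (j, b) else 0))
      = (if x \<in> square_points n then word_at x (i # w) $$ (a, b) else 0)"
    proof (cases "x \<in> square_points n")
      case True
      have "(x i * word_at x w) $$ (a, b) = (\<Sum>j<n. x i $$ (a, j) * word_at x w $$ (j, b))"
        using True Cons.prems word_at_simps(3)[OF True] by (intro mat_mult_entry) (auto simp: square_points_def)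
      then show ?thesis using True by (simp add: word_at_simps(2)[OF True])
    qed simp
  qed
  finally show ?case .
qed

lemma l2_norm_vec_entry: "j < dim_vec u \<Longrightarrow> cmod (vec_index u j) \<le> l2_norm_vec u"
  unfolding l2_norm_vec_def by (rule real_le_rsqrt) (rule member_le_sum, auto)

text \<open>The test vector is the \<open>b\<close>-th unit vector. The first half only shows that
  the supremum defining \<open>mat_opnorm\<close> is bounded above.\<close>

lemma entry_le_mat_opnorm:
  assumes A: "A \<in> carrier_mat n n" and ab: "a < n" "b < n"
  shows "cmod (A $$ (a, b)) \<le> mat_opnorm A"
proof -
  let ?U = "{u \<in> carrier_vec (dim_col A). l2_norm_vec u \<le> 1}"
  have "l2_norm_vec (A *\<^sub>v u) \<le> sqrt (\<Sum>i<n. (\<Sum>j<n. cmod (A $$ (i, j)))\<^sup>2)" if u: "u \<in> ?U" for u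
  proof -
    have "cmod (vec_index (A *\<^sub>v u) i) \<le> (\<Sum>j<n. cmod (A $$ (i, j)))" if i: "i < n" for i
    proof -
      have "vec_index (A *\<^sub>v u) i = (\<Sum>j<n. A $$ (i, j) * vec_index u j)"
        using A u i by (auto simp: scalar_prod_def atLeast0LessThan intro!: sum.cong)
      then have "cmod (vec_index (A *\<^sub>v u) i) \<le> (\<Sum>j<n. cmod (A $$ (i, j)) * cmod (vec_index u j))"
        by (simp add: norm_sum[THEN order_trans] norm_mult)
      also have "\<dots> \<le> (\<Sum>j<n. cmod (A $$ (i, j)) * 1)"
      proof (intro sum_mono mult_left_mono)
        fix j assume "j \<in> {..<n}"
        then show "cmod (vec_index u j) \<le> 1" using l2_norm_vec_entry[of j u] u A by auto
      qed simp
      finally show ?thesis by simp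
    qed
    then show ?thesis
      unfolding l2_norm_vec_def using A by (intro real_sqrt_le_mono) (auto intro!: sum_mono power_mono)
  qed
  then have bdd: "bdd_above ((\<lambda>u. l2_norm_vec (A *\<^sub>v u)) ` ?U)" by (intro bdd_aboveI) auto
  have "l2_norm_vec (unit_vec n b) = 1"
  proof -
    have "(\<Sum>j<n. (cmod (vec_index (unit_vec n b) j))\<^sup>2) = (\<Sum>j<n. if j = b then 1 else 0)"
      using ab by (intro sum.cong) (auto simp: unit_vec_def)
    then show ?thesis using ab by (simp add: l2_norm_vec_def)
  qed
  then have u: "unit_vec n b \<in> ?U" using A by auto
  have "vec_index (A *\<^sub>v unit_vec n b) a = (\<Sum>j<n. A $$ (a, j) * (if j = b then 1 else 0))"
    using A ab by (simp add: scalar_prod_def unit_vec_def atLeast0LessThan)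
  also have "\<dots> = A $$ (a, b)" using ab by (simp add: if_distrib[of "\<lambda>x. _ * x"] cong: if_cong)
  finally have "vec_index (A *\<^sub>v unit_vec n b) a = A $$ (a, b)" .
  then have "cmod (A $$ (a, b)) \<le> l2_norm_vec (A *\<^sub>v unit_vec n b)"
    using l2_norm_vec_entry[of a "A *\<^sub>v unit_vec n b"] A ab by simp
  also have "\<dots> \<le> mat_opnorm A"
    unfolding mat_opnorm_def using bdd u by (intro cSUP_upper)
  finally show ?thesis .
qed

context indexed_committee_space
begin

context
  fixes var :: "'i::countable \<Rightarrow> 'm"
begin

text \<open>Matrix values are handled entry by entry, so that evaluation at a point becomes a finite
  family of scalar functionals.\<close>

definition series_entry :: "nat \<Rightarrow> nat \<Rightarrow> 'i point \<Rightarrow> 'm series \<Rightarrow> complex" where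
  "series_entry a b x h = (\<Sum>\<^sub>\<infinity>\<alpha>. h \<alpha> * monomial_at var x \<alpha> $$ (a, b))"

lemma vanishes_at_iff:
  assumes "x \<in> square_points n"
  shows "vanishes_at var h x \<longleftrightarrow> (\<forall>a<n. \<forall>b<n. series_entry a b x h = 0)"
proof -
  have entry: "series_at var h x $$ (a, b) = series_entry a b x h" if "a < n" "b < n" for a b
    using that by (simp add: series_at_def point_dim_eq[OF assms] series_entry_def)
  have dims: "series_at var h x \<in> carrier_mat n n"
    by (simp add: series_at_def point_dim_eq[OF assms])
  have "series_at var h x = 0\<^sub>m n n \<longleftrightarrow> (\<forall>a<n. \<forall>b<n. series_entry a b x h = 0)"
  proof
    assume z: "series_at var h x = 0\<^sub>m n n"
    show "\<forall>a<n. \<forall>b<n. series_entry a b x h = 0"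
      by (simp add: entry[symmetric] z)
  next
    assume "\<forall>a<n. \<forall>b<n. series_entry a b x h = 0"
    then show "series_at var h x = 0\<^sub>m n n"
      using dims by (intro eq_matI) (simp_all add: entry)
  qed
  then show ?thesis by (simp only: vanishes_at_def point_dim_eq[OF assms])
qed

lemma series_entry_polynomial:
  assumes "finite F" "{\<alpha>. p \<alpha> \<noteq> 0} \<subseteq> F"
  shows "series_entry a b x p = (\<Sum>\<alpha>\<in>F. p \<alpha> * monomial_at var x \<alpha> $$ (a, b))"
proof -
  have "series_entry a b x p = (\<Sum>\<^sub>\<infinity>\<alpha>\<in>F. p \<alpha> * monomial_at var x \<alpha> $$ (a, b))"
    unfolding series_entry_def using assms(2) by (intro infsum_cong_neutral) auto
  then show ?thesis using assms(1) by simp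
qed

lemma measurable_series_entry_polynomial:
  assumes "a < n" "b < n" "polynomial p"
  shows "(\<lambda>x. if x \<in> square_points n then series_entry a b x p else 0) \<in> borel_measurable point_space"
proof -
  let ?F = "{\<alpha>. p \<alpha> \<noteq> 0}"
  have F: "finite ?F" using assms(3) by (simp add: polynomial_def)
  have "(\<lambda>x. \<Sum>\<alpha>\<in>?F. p \<alpha> * (if x \<in> square_points n then monomial_at var x \<alpha> $$ (a, b) else 0)) \<in> borel_measurable point_space"
    unfolding monomial_at_def
    using assms by (intro borel_measurable_sum borel_measurable_times borel_measurable_const measurable_word_at)
  also have "(\<lambda>x. \<Sum>\<alpha>\<in>?F. p \<alpha> * (if x \<in> square_points n then monomial_at var x \<alpha> $$ (a, b) else 0))
      = (\<lambda>x. if x \<in> square_points n then series_entry a b x p else 0)"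
    by (auto simp: series_entry_polynomial[OF F order_refl])
  finally show ?thesis .
qed

context
  fixes n a b :: nat and x :: "'i point"
  assumes x: "x \<in> square_points n" "bounded_evaluation \<H> var x" and ab: "a < n" "b < n"
begin

lemma series_entry_summable: "h \<in> H \<Longrightarrow> (\<lambda>\<alpha>. h \<alpha> * monomial_at var x \<alpha> $$ (a, b)) summable_on UNIV"
  using x(2) ab unfolding bounded_evaluation_def point_dim_eq[OF x(1)] by blast

lemma series_entry_add: "g \<in> H \<Longrightarrow> h \<in> H \<Longrightarrow> series_entry a b x (g + h) = series_entry a b x g + series_entry a b x h"
  unfolding series_entry_def using infsum_add[OF series_entry_summable series_entry_summable, of g h] by (simp add: algebra_simps)

lemma series_entry_scale: "h \<in> H \<Longrightarrow> series_entry a b x (scale c h) = c * series_entry a b x h"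
  unfolding series_entry_def scale_def using infsum_cmult_right[of c "\<lambda>\<alpha>. h \<alpha> * monomial_at var x \<alpha> $$ (a, b)" UNIV] series_entry_summable[of h]
  by (simp add: mult.assoc)

lemma series_entry_diff: "g \<in> H \<Longrightarrow> h \<in> H \<Longrightarrow> series_entry a b x (g - h) = series_entry a b x g - series_entry a b x h"
  using series_entry_add[of g "scale (-1) h"] series_entry_scale[of h "-1"] by (simp add: scale_mem scale_minus_1 minus_mem)

lemma series_entry_bounded: "\<exists>K. \<forall>h\<in>H. cmod (series_entry a b x h) \<le> K * \<parallel>h\<parallel>"
proof -
  obtain K where K: "\<forall>h\<in>H. mat_opnorm (series_at var h x) \<le> K * \<parallel>h\<parallel>"
    using x(2) unfolding bounded_evaluation_def by blast
  have "cmod (series_entry a b x h) \<le> K * \<parallel>h\<parallel>" if h: "h \<in> H" for h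
  proof -
    have "series_entry a b x h = series_at var h x $$ (a, b)"
      using ab by (simp add: series_at_def point_dim_eq[OF x(1)] series_entry_def)
    also have "cmod \<dots> \<le> mat_opnorm (series_at var h x)"
      using ab by (intro entry_le_mat_opnorm[of _ n]) (simp_all add: series_at_def point_dim_eq[OF x(1)])
    finally show ?thesis using K h by fastforce
  qed
  then show ?thesis by blast
qed

lemma series_entry_tendsto:
  assumes "\<And>k. s k \<in> H" "h \<in> H" "(\<lambda>k. \<parallel>s k - h\<parallel>) \<longlonglongrightarrow> 0"
  shows "(\<lambda>k. series_entry a b x (s k)) \<longlonglongrightarrow> series_entry a b x h"
proof -
  obtain K where K: "\<forall>h\<in>H. cmod (series_entry a b x h) \<le> K * \<parallel>h\<parallel>" using series_entry_bounded by blast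
  have "(\<lambda>k. series_entry a b x (s k) - series_entry a b x h) \<longlonglongrightarrow> 0"
  proof (rule Lim_null_comparison)
    show "\<forall>\<^sub>F k in sequentially. cmod (series_entry a b x (s k) - series_entry a b x h) \<le> K * \<parallel>s k - h\<parallel>"
      unfolding series_entry_diff[OF assms(1,2), symmetric]
      using K[rule_format, OF diff_mem[OF assms(1,2)]] by (intro always_eventually) blast
    show "(\<lambda>k. K * \<parallel>s k - h\<parallel>) \<longlonglongrightarrow> 0"
      using tendsto_mult_right_zero[OF assms(3)] .
  qed
  then show ?thesis by (simp add: LIM_zero_iff)
qed

text \<open>A bound tested on countably many polynomials is a measurable condition on the point;
  continuity extends it to the whole space.\<close>

lemma series_entry_bound_of_dense:
  assumes bd: "\<And>p. p \<in> dense_polys \<Longrightarrow> cmod (series_entry a b x p) \<le> K * \<parallel>p\<parallel>" and h: "h \<in> H"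
  shows "cmod (series_entry a b x h) \<le> K * \<parallel>h\<parallel>"
proof -
  obtain p where p: "\<And>k. p k \<in> dense_polys" and pH: "\<And>k. p k \<in> H" and lim: "(\<lambda>k. \<parallel>p k - h\<parallel>) \<longlonglongrightarrow> 0"
    using approximating_sequence[OF _ dense_polys_dense[OF h] h] dense_polys_mem by blast
  show ?thesis
  proof (rule LIMSEQ_le)
    show "(\<lambda>k. cmod (series_entry a b x (p k))) \<longlonglongrightarrow> cmod (series_entry a b x h)"
      by (intro tendsto_norm series_entry_tendsto pH h lim)
    show "(\<lambda>k. K * \<parallel>p k\<parallel>) \<longlonglongrightarrow> K * \<parallel>h\<parallel>"
      by (intro tendsto_mult tendsto_const norm_tendsto pH h lim)
  qed (use bd[OF p] in blast)
qed

end

text \<open>Every entry of the value at an admissible point is a bounded linear functional, so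
  vanishing is a closed linear condition.\<close>

lemma vanishing_closed_subspace:
  assumes "\<And>y. y \<in> X \<Longrightarrow> (\<exists>n. y \<in> square_points n) \<and> bounded_evaluation \<H> var y"
  shows "closed_subspace \<H> {h \<in> H. \<forall>y\<in>X. vanishes_at var h y}"
proof -
  have *: "vanishes_at var 0 y \<and>
      (\<forall>g\<in>H. \<forall>h\<in>H. vanishes_at var g y \<longrightarrow> vanishes_at var h y \<longrightarrow> vanishes_at var (g + h) y) \<and>
      (\<forall>c. \<forall>h\<in>H. vanishes_at var h y \<longrightarrow> vanishes_at var (scale c h) y) \<and>
      (\<forall>s h. (\<forall>n. s n \<in> H \<and> vanishes_at var (s n) y) \<longrightarrow> h \<in> H \<longrightarrow> (\<lambda>n. \<parallel>s n - h\<parallel>) \<longlonglongrightarrow> 0 \<longrightarrow> vanishes_at var h y)"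
    if y: "y \<in> X" for y
  proof -
    obtain n where n: "y \<in> square_points n" and b: "bounded_evaluation \<H> var y" using assms[OF y] by blast
    note iff = vanishes_at_iff[OF n]
    show ?thesis unfolding iff
    proof (intro conjI ballI allI impI)
      fix s h i j
      assume s: "\<forall>k. s k \<in> H \<and> (\<forall>a<n. \<forall>b<n. series_entry a b y (s k) = 0)" and h: "h \<in> H"
        and lim: "(\<lambda>k. \<parallel>s k - h\<parallel>) \<longlonglongrightarrow> 0" and ij: "i < n" "j < n"
      have "(\<lambda>k. series_entry i j y (s k)) \<longlonglongrightarrow> series_entry i j y h"
        using s by (intro series_entry_tendsto[OF n b ij _ h lim]) simp
      then show "series_entry i j y h = 0" using s ij by (simp add: LIMSEQ_const_iff)
    qed (simp_all add: series_entry_add[OF n b] series_entry_scale[OF n b] series_entry_polynomial[of "{}"])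
  qed
  then show ?thesis
    unfolding closed_subspace_def
  proof (intro conjI ballI allI impI)
    fix s h
    assume s: "\<forall>n. s n \<in> {h \<in> H. \<forall>y\<in>X. vanishes_at var h y}" and h: "h \<in> H"
      and lim: "(\<lambda>n. \<parallel>s n - h\<parallel>) \<longlonglongrightarrow> 0"
    have "vanishes_at var h y" if y: "y \<in> X" for y
    proof -
      have "\<forall>n. s n \<in> H \<and> vanishes_at var (s n) y" using s y by blast
      then show ?thesis using *[OF y] h lim by blast
    qed
    then show "h \<in> {h \<in> H. \<forall>y\<in>X. vanishes_at var h y}" using h by blast
  next
    fix g h assume "g \<in> {h \<in> H. \<forall>y\<in>X. vanishes_at var h y}" "h \<in> {h \<in> H. \<forall>y\<in>X. vanishes_at var h y}"
    then show "g + h \<in> {h \<in> H. \<forall>y\<in>X. vanishes_at var h y}" using * by (simp add: add_mem)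
  next
    fix c h assume "h \<in> {h \<in> H. \<forall>y\<in>X. vanishes_at var h y}"
    then show "scale c h \<in> {h \<in> H. \<forall>y\<in>X. vanishes_at var h y}" using * by (simp add: scale_mem)
  next
    show "0 \<in> {h \<in> H. \<forall>y\<in>X. vanishes_at var h y}" using * by (simp add: zero_mem)
  qed blast
qed

end

end

section \<open>Random points\<close>

text \<open>The first \<open>n\<close> variables all miss \<open>A\<close> with probability
  \<open>q ^ n\<close>, where \<open>q < 1\<close> is the probability that one of them does.\<close>

lemma (in prob_space) AE_hits:
  fixes x :: "nat \<Rightarrow> 'a \<Rightarrow> 'b"
  assumes indep: "indep_vars (\<lambda>_. P) x UNIV"
    and ident: "\<And>k. distr M P (x k) = distr M P (x 0)"
    and A: "A \<in> sets P" and pos: "prob (x 0 -` A \<inter> space M) \<noteq> 0"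
  shows "AE \<omega> in M. \<exists>k. x k \<omega> \<in> A"
proof -
  have x: "x k \<in> measurable M P" for k using indep by (simp add: indep_vars_def)
  let ?A' = "space P - A"
  define q where "q = prob (x 0 -` ?A' \<inter> space M)"
  have A': "?A' \<in> sets P" using A by blast
  have q: "prob (x k -` ?A' \<inter> space M) = q" for k
  proof -
    have "prob (x k -` ?A' \<inter> space M) = measure (distr M P (x k)) ?A'"
      using measure_distr[OF x A'] by simp
    also have "\<dots> = measure (distr M P (x 0)) ?A'" by (simp add: ident[of k])
    also have "\<dots> = q" unfolding q_def using measure_distr[OF x A'] by simp
    finally show ?thesis .
  qed
  have "x 0 -` ?A' \<inter> space M = space M - (x 0 -` A \<inter> space M)"
    using measurable_space[OF x] by auto
  then have "q = 1 - prob (x 0 -` A \<inter> space M)"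
    unfolding q_def using prob_compl[OF measurable_sets[OF x A]] by simp
  moreover have "prob (x 0 -` A \<inter> space M) > 0" using pos by (simp add: zero_less_measure_iff)
  ultimately have q1: "0 \<le> q" "q < 1" by (simp_all add: q_def)
  let ?Z = "\<Inter>k. x k -` ?A' \<inter> space M"
  have Zm: "?Z \<in> events" using measurable_sets[OF x A'] by (intro sets.countable_INT) auto
  have "prob ?Z \<le> q ^ n" if "n > 0" for n
  proof -
    have "prob ?Z \<le> prob (\<Inter>k\<in>{..<n}. x k -` ?A' \<inter> space M)"
      using measurable_sets[OF x A'] that by (intro finite_measure_mono sets.finite_INT) auto
    also have "\<dots> = (\<Prod>k<n. prob (x k -` ?A' \<inter> space M))"
      using A' that by (intro indep_varsD[OF indep]) auto
    also have "\<dots> = q ^ n" by (simp add: q)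
    finally show ?thesis .
  qed
  then have "\<exists>k. \<forall>n\<ge>k. prob ?Z \<le> q ^ n" by (intro exI[of _ 1]) simp
  then have "prob ?Z \<le> 0" by (rule LIMSEQ_le_const[OF LIMSEQ_realpow_zero[OF q1]])
  then have "prob ?Z = 0" using measure_nonneg[of M ?Z] by linarith
  then have "?Z \<in> null_sets M" using Zm by (simp add: null_sets_def emeasure_eq_measure)
  then have "AE \<omega> in M. \<omega> \<notin> ?Z" by (rule AE_not_in)
  then show ?thesis using AE_space
    by eventually_elim (use measurable_space[OF x] in auto)
qed

locale random_points = indexed_committee_space \<H>
  for \<H> :: "('m::monoid_add) series_space" +
  fixes var :: "'i::countable \<Rightarrow> 'm" and S :: "'s measure" and x :: "nat \<Rightarrow> 's \<Rightarrow> 'i point"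
  assumes points: "\<And>k. random_point \<H> var S (x k)"
    and indep: "prob_space.indep_vars S (\<lambda>k. point_space) x UNIV"
    and ident: "\<And>k. distr S point_space (x k) = distr S point_space (x 0)"
begin

lemma
  shows prob_S: "prob_space S" and x_measurable: "x k \<in> measurable S point_space"
    and x_bounded: "\<omega> \<in> space S \<Longrightarrow> bounded_evaluation \<H> var (x k \<omega>)"
    and x_nonvanishing: "h \<in> H \<Longrightarrow> h \<noteq> 0 \<Longrightarrow> measure S {\<omega>\<in>space S. vanishes_at var h (x k \<omega>)} < 1"
  using points[of k] unfolding random_point_def by blast+

lemma x_square:
  assumes "\<omega> \<in> space S"
  shows "\<exists>n. x k \<omega> \<in> square_points n"
proof -
  have "x k \<omega> \<in> natural_domain \<H> var" using points[of k] assms unfolding random_point_def by blast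
  then show ?thesis unfolding natural_domain_def square_points_def by blast
qed

text \<open>An entry at a general \<open>h\<close> is the pointwise limit of the entries at its
  truncations, by boundedness of the evaluation. The size of the matrices is random too, hence the
  union over \<open>n\<close>.\<close>

lemma vanishes_measurable:
  assumes h: "h \<in> H"
  shows "{\<omega>\<in>space S. vanishes_at var h (x k \<omega>)} \<in> sets S"
proof -
  let ?f = "\<lambda>n a b g \<omega>. if x k \<omega> \<in> square_points n then series_entry var a b (x k \<omega>) g else 0"
  have poly: "?f n a b p \<in> borel_measurable S" if "a < n" "b < n" "polynomial p" for n a b p
    using measurable_compose[OF x_measurable measurable_series_entry_polynomial[OF that]] .
  have meas: "?f n a b h \<in> borel_measurable S" if ab: "a < n" "b < n" for n a b
  proof (rule borel_measurable_LIMSEQ_metric)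
    show "?f n a b (truncation (first_indices i) h) \<in> borel_measurable S" for i
      by (rule poly[OF ab]) (rule polynomial_truncation, simp)
    fix \<omega> assume \<omega>: "\<omega> \<in> space S"
    show "(\<lambda>i. ?f n a b (truncation (first_indices i) h) \<omega>) \<longlonglongrightarrow> ?f n a b h \<omega>"
      using series_entry_tendsto[OF _ x_bounded[OF \<omega>] ab truncation_mem[OF finite_first_indices] h truncation_tendsto[OF h]]
      by (cases "x k \<omega> \<in> square_points n") auto
  qed
  have sq: "x k -` square_points n \<inter> space S \<in> sets S" for n
    by (rule measurable_sets[OF x_measurable sets_square_points])
  have "{\<omega>\<in>space S. vanishes_at var h (x k \<omega>)}
      = (\<Union>n. (x k -` square_points n \<inter> space S) \<inter> {\<omega>\<in>space S. \<forall>a\<in>{..<n}. \<forall>b\<in>{..<n}. ?f n a b h \<omega> = 0})"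
    (is "?L = ?R")
  proof
    show "?L \<subseteq> ?R"
    proof
      fix \<omega> assume \<omega>: "\<omega> \<in> ?L"
      then obtain n where n: "x k \<omega> \<in> square_points n" using x_square by blast
      show "\<omega> \<in> ?R" using \<omega> n vanishes_at_iff[OF n, of var h] by (intro UN_I[of n]) auto
    qed
    show "?R \<subseteq> ?L" using vanishes_at_iff by fastforce
  qed
  also have "\<dots> \<in> sets S"
  proof (intro sets.countable_UN image_subsetI sets.Int[OF sq])
    fix n
    have "{\<omega> \<in> space S. ?f n a b h \<omega> = 0} \<in> sets S" if "a \<in> {..<n}" "b \<in> {..<n}" for a b
      using measurable_sets[OF meas[of a n b], of "{0}"] that by (simp add: vimage_def Int_def conj_commute)
    then show "{\<omega>\<in>space S. \<forall>a\<in>{..<n}. \<forall>b\<in>{..<n}. ?f n a b h \<omega> = 0} \<in> sets S"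
      by (intro sets.sets_Collect_countable_All') auto
  qed
  finally show ?thesis .
qed

text \<open>Measurability of the vanishing event turns almost sure vanishing into probability 1,
  contradicting the definition of a random point.\<close>

lemma eq_zero_of_AE_vanishes:
  assumes "h \<in> H" "AE \<omega> in S. vanishes_at var h (x 0 \<omega>)"
  shows "h = 0"
proof (rule ccontr)
  interpret S: prob_space S by (rule prob_S)
  assume "h \<noteq> 0"
  moreover have "S.prob {\<omega>\<in>space S. vanishes_at var h (x 0 \<omega>)} = 1"
    using assms(2) S.prob_Collect_eq_1[OF vanishes_measurable[OF assms(1)]] by simp
  ultimately show False using x_nonvanishing[OF assms(1), of 0] by simp
qed

text \<open>Countably many cells suffice to control the evaluation of every \<open>h\<close>, since the bound \<open>l\<close> on the
  evaluation functional turns a dense polynomial \<open>p\<close> near \<open>h\<close> into one whose value is near that of \<open>h\<close>.\<close>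

definition cell :: "nat \<Rightarrow> nat \<times> nat \<Rightarrow> nat \<Rightarrow> 'm series \<times> complex \<Rightarrow> nat \<Rightarrow> 'i point set" where
  "cell n ab l pq m = (case (ab, pq) of ((a, b), (p, q)) \<Rightarrow>
     {y \<in> square_points n. (\<forall>p'\<in>dense_polys. cmod (series_entry var a b y p') \<le> real l * \<parallel>p'\<parallel>) \<and>
        cmod (series_entry var a b y p - q) < inverse (real (Suc m))})"

text \<open>The bound in a cell runs over the countable set of dense polynomials, which is what
  keeps the cell measurable.\<close>

lemma cell_sets:
  assumes ab: "a < n" "b < n" and p: "p \<in> dense_polys"
  shows "cell n (a, b) l (p, q) m \<in> sets point_space"
proof -
  let ?f = "\<lambda>g y. if y \<in> square_points n then series_entry var a b y g else 0"
  have f: "?f g \<in> borel_measurable point_space" if "g \<in> dense_polys" for g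
    by (rule measurable_series_entry_polynomial[OF ab dense_polys_polynomial[OF that]])
  have "{y \<in> space point_space. \<forall>p'\<in>dense_polys. cmod (?f p' y) \<le> real l * \<parallel>p'\<parallel>} \<in> sets point_space"
    using borel_measurable_le[OF measurable_compose[OF f borel_measurable_norm] borel_measurable_const]
    by (intro sets.sets_Collect_countable_All' countable_dense_polys countable_indices)
  moreover have "{y \<in> space point_space. cmod (?f p y - q) < inverse (real (Suc m))} \<in> sets point_space"
    by (intro borel_measurable_less borel_measurable_const
        measurable_compose[OF borel_measurable_diff[OF f[OF p] borel_measurable_const] borel_measurable_norm])
  moreover have "cell n (a, b) l (p, q) m = square_points n \<inter>
      ({y \<in> space point_space. \<forall>p'\<in>dense_polys. cmod (?f p' y) \<le> real l * \<parallel>p'\<parallel>} \<inter>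
       {y \<in> space point_space. cmod (?f p y - q) < inverse (real (Suc m))})"
    by (auto simp: cell_def)
  ultimately show ?thesis by (simp only: sets_square_points sets.Int)
qed

text \<open>The estimate is uniform over the cell: its right-hand side does not involve
  \<open>y\<close>. It therefore transfers smallness of the value of \<open>h\<close> from one point
  of the cell to another.\<close>

lemma series_entry_near_of_cell:
  assumes ab: "a < n" "b < n" and p: "p \<in> dense_polys" and y: "y \<in> cell n (a, b) l (p, q) m" "bounded_evaluation \<H> var y"
    and h: "h \<in> H"
  shows "cmod (series_entry var a b y h - q) \<le> real l * \<parallel>h - p\<parallel> + inverse (real (Suc m))"
proof -
  have y': "y \<in> square_points n" "\<And>p'. p' \<in> dense_polys \<Longrightarrow> cmod (series_entry var a b y p') \<le> real l * \<parallel>p'\<parallel>"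
    "cmod (series_entry var a b y p - q) < inverse (real (Suc m))"
    using y(1) by (auto simp: cell_def)
  have pH: "p \<in> H" using dense_polys_mem[OF p] .
  have "cmod (series_entry var a b y (h - p)) \<le> real l * \<parallel>h - p\<parallel>"
    by (rule series_entry_bound_of_dense[OF y'(1) y(2) ab y'(2) diff_mem[OF h pH]])
  moreover have e: "series_entry var a b y h - q = series_entry var a b y (h - p) + (series_entry var a b y p - q)"
    by (simp add: series_entry_diff[OF y'(1) y(2) ab h pH])
  have "cmod (series_entry var a b y h - q) \<le> cmod (series_entry var a b y (h - p)) + cmod (series_entry var a b y p - q)"
    unfolding e by (rule norm_triangle_ineq)
  ultimately show ?thesis using y'(3) by linarith
qed

text \<open>The bound \<open>l\<close> comes first, from the norm of the evaluation functional;
  \<open>p\<close> is then chosen close to \<open>h\<close> relative to \<open>l\<close>, and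
  \<open>q\<close> close to the value at \<open>p\<close>.\<close>

lemma exists_cell:
  assumes ab: "a < n" "b < n" and y: "y \<in> square_points n" "bounded_evaluation \<H> var y"
    and h: "h \<in> H" and e: "e > 0"
  obtains l p q m where "p \<in> dense_polys" "q \<in> dense_coeffs" "y \<in> cell n (a, b) l (p, q) m"
    "real l * \<parallel>h - p\<parallel> + inverse (real (Suc m)) < e"
proof -
  obtain K where K: "\<forall>h\<in>H. cmod (series_entry var a b y h) \<le> K * \<parallel>h\<parallel>"
    using series_entry_bounded[OF y ab] by blast
  obtain l0 :: nat where l0: "K \<le> real l0" using real_arch_simple by blast
  \<comment> \<open>The successor makes \<open>l\<close> positive, so that
    \<open>e / (2 * real l)\<close> is a legitimate tolerance.\<close>
  define l where "l = Suc l0"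
  have l: "K \<le> real l" "real l > 0" using l0 by (auto simp: l_def)
  obtain p where p: "p \<in> dense_polys" "\<parallel>h - p\<parallel> < e / (2 * real l)"
    using dense_polys_dense[OF h, of "e / (2 * real l)"] e l by auto
  obtain m where m: "inverse (real (Suc m)) < e / 2"
    using reals_Archimedean[of "e / 2"] e by auto
  obtain q where q: "q \<in> dense_coeffs" "cmod (series_entry var a b y p - q) < inverse (real (Suc m))"
    using dense_coeffs_near[of "inverse (real (Suc m))" "series_entry var a b y p"] by auto
  have "cmod (series_entry var a b y p') \<le> real l * \<parallel>p'\<parallel>" if "p' \<in> dense_polys" for p'
    using K[rule_format, OF dense_polys_mem[OF that]] mult_right_mono[OF l(1) norm_nonneg[OF dense_polys_mem[OF that]]]
    by linarith
  then have "y \<in> cell n (a, b) l (p, q) m" using y q by (simp add: cell_def)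
  moreover have "real l * \<parallel>h - p\<parallel> < e / 2"
    using p(2) l(2) by (simp add: field_simps)
  then have "real l * \<parallel>h - p\<parallel> + inverse (real (Suc m)) < e"
    using m by linarith
  ultimately show thesis using that p q by blast
qed

text \<open>Two almost sure statements, both independent of \<open>h\<close>, are combined: the
  sequence hits every cell of positive probability, and a generic point lies in no cell of
  probability zero. Hence a generic point shares each of its cells with some member of the
  sequence.\<close>

lemma AE_points_separate:
  "AE \<omega> in S. \<forall>h\<in>H. (\<forall>k. vanishes_at var h (x k \<omega>)) \<longrightarrow> h = 0"
proof -
  interpret S: prob_space S by (rule prob_S)
  define I :: "(nat \<times> (nat \<times> nat) \<times> nat \<times> ('m series \<times> complex) \<times> nat) set" where
    "I = {(n, (a, b), l, (p, q), m). a < n \<and> b < n \<and> p \<in> dense_polys \<and> q \<in> dense_coeffs}"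
  define A where "A t = (case t of (n, ab, l, pq, m) \<Rightarrow> cell n ab l pq m)" for t
  have "I \<subseteq> UNIV \<times> UNIV \<times> UNIV \<times> (dense_polys \<times> dense_coeffs) \<times> UNIV" by (auto simp: I_def)
  moreover have "countable (UNIV \<times> UNIV \<times> UNIV \<times> (dense_polys \<times> dense_coeffs) \<times> UNIV
      :: (nat \<times> (nat \<times> nat) \<times> nat \<times> ('m series \<times> complex) \<times> nat) set)"
    by (intro countable_SIGMA countable_dense_polys countable_indices dense_coeffs(1) countableI_type)
  ultimately have I: "countable I" by (rule countable_subset)
  have A: "A t \<in> sets point_space" if "t \<in> I" for t
    using that by (auto simp: I_def A_def intro: cell_sets)
  let ?pos = "\<lambda>t. S.prob (x 0 -` A t \<inter> space S) \<noteq> 0"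
  have "AE \<omega> in S. \<forall>t\<in>I. ?pos t \<longrightarrow> (\<exists>k. x k \<omega> \<in> A t)"
  proof (rule AE_ball_countable[OF I, THEN iffD2], rule ballI)
    fix t assume t: "t \<in> I"
    show "AE \<omega> in S. ?pos t \<longrightarrow> (\<exists>k. x k \<omega> \<in> A t)"
      using S.AE_hits[OF indep ident A[OF t]] by (cases "?pos t") auto
  qed
  \<comment> \<open>Countably many cells of probability zero form a null set together.\<close>
  moreover have null: "AE \<omega> in S. \<forall>t\<in>I. x 0 \<omega> \<in> A t \<longrightarrow> ?pos t"
  proof (rule AE_ball_countable[OF I, THEN iffD2], rule ballI)
    fix t assume t: "t \<in> I"
    have m: "x 0 -` A t \<inter> space S \<in> sets S" by (rule measurable_sets[OF x_measurable A[OF t]])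
    show "AE \<omega> in S. x 0 \<omega> \<in> A t \<longrightarrow> ?pos t"
    proof (cases "?pos t")
      case False
      then have "x 0 -` A t \<inter> space S \<in> null_sets S"
        using m by (simp add: null_sets_def S.emeasure_eq_measure)
      then have "AE \<omega> in S. \<omega> \<notin> x 0 -` A t \<inter> space S" by (rule AE_not_in)
      then show ?thesis using AE_space by eventually_elim auto
    qed simp
  qed
  ultimately show ?thesis using AE_space
  proof eventually_elim
    case (elim \<omega>)
    show ?case
    proof (intro ballI impI)
      fix h assume h: "h \<in> H" and van: "\<forall>k. vanishes_at var h (x k \<omega>)"
      \<comment> \<open>The sequence at \<open>\<omega>\<close> is now fixed, and
        \<open>x 0 \<omega>'\<close> at a second sample plays the generic point of the common
        distribution.\<close>
      have "AE \<omega>' in S. vanishes_at var h (x 0 \<omega>')"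
        using null AE_space
      proof eventually_elim
        case (elim \<omega>')
        note hit = elim(1) and y = x_bounded[OF elim(2), of 0]
        obtain n where n: "x 0 \<omega>' \<in> square_points n" using x_square[OF elim(2)] by blast
        have "series_entry var a b (x 0 \<omega>') h = 0" if ab: "a < n" "b < n" for a b
        proof (rule ccontr)
          assume "series_entry var a b (x 0 \<omega>') h \<noteq> 0"
          \<comment> \<open>Half of the supposed nonzero value: it exceeds both
            \<open>cmod q\<close>, by a point of the sequence where \<open>h\<close> vanishes, and
            the distance from the value to \<open>q\<close>, which contradicts the triangle
            inequality.\<close>
          then have c: "cmod (series_entry var a b (x 0 \<omega>') h) / 2 > 0" by simp
          obtain l p q m where cell: "p \<in> dense_polys" "q \<in> dense_coeffs" "x 0 \<omega>' \<in> cell n (a, b) l (p, q) m"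
            and small: "real l * \<parallel>h - p\<parallel> + inverse (real (Suc m)) < cmod (series_entry var a b (x 0 \<omega>') h) / 2"
            by (rule exists_cell[OF ab n y h c]) (rule that; assumption)
          define t where "t = (n, (a, b), l, (p, q), m)"
          have t: "t \<in> I" "A t = cell n (a, b) l (p, q) m"
            using ab cell by (simp_all add: t_def I_def A_def)
          have "?pos t" using hit t cell(3) by blast
          then obtain k where k: "x k \<omega> \<in> cell n (a, b) l (p, q) m"
            using \<open>\<forall>t\<in>I. ?pos t \<longrightarrow> (\<exists>k. x k \<omega> \<in> A t)\<close> t by blast
          have "x k \<omega> \<in> square_points n" using k by (simp add: cell_def)
          then have "series_entry var a b (x k \<omega>) h = 0" using vanishes_at_iff van ab by blast
          then have "cmod q \<le> real l * \<parallel>h - p\<parallel> + inverse (real (Suc m))"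
            using series_entry_near_of_cell[OF ab cell(1) k x_bounded[OF \<open>\<omega> \<in> space S\<close>] h] by simp
          moreover have "cmod (series_entry var a b (x 0 \<omega>') h - q) \<le> real l * \<parallel>h - p\<parallel> + inverse (real (Suc m))"
            by (rule series_entry_near_of_cell[OF ab cell(1,3) y h])
          moreover have "cmod (series_entry var a b (x 0 \<omega>') h) \<le> cmod (series_entry var a b (x 0 \<omega>') h - q) + cmod q"
            using norm_triangle_ineq[of "series_entry var a b (x 0 \<omega>') h - q" q] by simp
          ultimately show False using small by linarith
        qed
        then show ?case using vanishes_at_iff[OF n] by blast
      qed
      then show "h = 0" by (rule eq_zero_of_AE_vanishes[OF h])
    qed
  qed
qed

end

theorem corollary5p2:
  fixes \<H> :: "('m::monoid_add) series_space"
    and var :: "'i::countable \<Rightarrow> 'm"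
    and S :: "'s measure" and x :: "nat \<Rightarrow> 's \<Rightarrow> 'i point"
    and N :: "'w measure" and v :: "'m \<Rightarrow> 'w \<Rightarrow> complex"
  assumes "multi_indices var"
    and "committee_space \<H>"
    and "ser_norm \<H> (monomial 0) = 1"
    and "\<And>k. random_point \<H> var S (x k)"
    and "prob_space.indep_vars S (\<lambda>k. point_space) x UNIV"
    and "\<And>k. distr S point_space (x k) = distr S point_space (x 0)"
    and "random_multiplier_model \<H> N v"
  shows "AE \<omega> in S.
    (\<lambda>n. opnorm \<H> (row_op_at \<H> var N v (map (\<lambda>k. x k \<omega>) [0..<n]))) \<longlonglongrightarrow> opnorm \<H> (row_op \<H> N v) \<and>
    opnorm \<H> (row_op \<H> N v) \<le> opnorm \<H> (col_op \<H> N v) \<and>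
    (\<lambda>n. opnorm \<H> (col_op_at \<H> var N v (map (\<lambda>k. x k \<omega>) [0..<n]))) \<longlonglongrightarrow> opnorm \<H> (col_op \<H> N v)"
proof -
  have indexed: "indexed_committee_space \<H>"
  proof (intro indexed_committee_space.intro indexed_committee_space_axioms.intro assms(2))
    show "countable (UNIV :: 'm set)" by (rule multi_indices_countable[OF assms(1)])
  next
    fix \<gamma> :: 'm
    show "finite {(\<alpha>, \<beta>). \<alpha> + \<beta> = \<gamma>}" by (rule multi_indices_finite_decompositions[OF assms(1)])
  next
    fix \<gamma> \<gamma>' \<beta> :: 'm
    show "\<gamma> + \<beta> = \<gamma>' + \<beta> \<Longrightarrow> \<gamma> = \<gamma>'" by (rule multi_indices_cancel_right[OF assms(1)])
  next
    fix \<gamma> \<beta> \<beta>' :: 'm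
    show "\<gamma> + \<beta> = \<gamma> + \<beta>' \<Longrightarrow> \<beta> = \<beta>'" by (rule multi_indices_cancel_left[OF assms(1)])
  qed
  interpret points: random_points \<H> var S x
    by (intro random_points.intro random_points_axioms.intro indexed assms(4-6))
  interpret model: random_multiplier \<H> N v
    by (intro random_multiplier.intro random_multiplier_axioms.intro indexed assms(7))
  obtain C where C: "C > 0" "AE \<omega> in N. \<forall>h\<in>elems \<H>. ser_norm \<H> (model.M \<omega> h) \<le> C * ser_norm \<H> h"
    "AE \<omega> in N. \<forall>h\<in>elems \<H>. ser_norm \<H> (adj \<H> (model.M \<omega>) h) \<le> C * ser_norm \<H> h"
    using model.M_bound by blast
  have row: "row_op \<H> N v = weak_expectation \<H> N (\<lambda>\<omega>. model.M \<omega> \<circ> adj \<H> (model.M \<omega>))"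
    and col: "col_op \<H> N v = weak_expectation \<H> N (\<lambda>\<omega>. adj \<H> (model.M \<omega>) \<circ> model.M \<omega>)"
    by (simp_all add: row_op_def col_op_def model.M_def Let_def)
  show ?thesis
    using points.AE_points_separate AE_space
  proof eventually_elim
    case (elim \<omega>)
    define X where "X n = map (\<lambda>k. x k \<omega>) [0..<n]" for n
    define V where "V n = {h \<in> elems \<H>. \<forall>y\<in>set (X n). vanishes_at var h y}" for n
    \<comment> \<open>The range of the projection. The vanishing subspaces \<open>V n\<close>
      decrease with \<open>n\<close>, so their complements \<open>L n\<close> increase.\<close>
    define L where "L n = orth_compl \<H> (V n)" for n
    have V: "closed_subspace \<H> (V n)" for n
      unfolding V_def using points.x_bounded[OF elim(2)] points.x_square[OF elim(2)]
      by (intro points.vanishing_closed_subspace) (auto simp: X_def)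
    have L: "closed_subspace \<H> (L n)" for n
      unfolding L_def by (rule points.orth_compl_closed) (auto simp: V_def)
    have mono: "incseq L"
      by (rule monoI) (auto simp: L_def V_def X_def orth_compl_def)
    \<comment> \<open>Because \<open>V n\<close> is closed, it equals its double complement; so a
      \<open>g\<close> orthogonal to all \<open>L n\<close> vanishes at every point of the
      sequence.\<close>
    have dense: "g = 0" if g: "g \<in> elems \<H>" "\<And>n. g \<in> orth_compl \<H> (L n)" for g
    proof -
      have "g \<in> V n" for n
        using g(2)[of n] unfolding L_def points.orth_compl_orth_compl[OF V] .
      \<comment> \<open>\<open>X n\<close> lists the points with index below \<open>n\<close>, so
        the point with index \<open>k\<close> first appears in \<open>X (Suc k)\<close>.\<close>
      then have "vanishes_at var g (x k \<omega>)" for k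
        using \<open>\<And>n. g \<in> V n\<close>[of "Suc k"] by (auto simp: V_def X_def)
      then show "g = 0" using elim(1) g(1) by blast
    qed
    have proj: "proj_points \<H> var (X n) = orth_proj \<H> (L n)" for n
      by (simp add: proj_points_def L_def V_def)
    \<comment> \<open>For the rows the symmetric pair is used: the adjoint takes the place of
      \<open>A\<close> and \<open>M\<close> that of \<open>B\<close>.\<close>
    have "(\<lambda>n. opnorm \<H> (row_op_at \<H> var N v (X n))) \<longlonglongrightarrow> opnorm \<H> (row_op \<H> N v)"
      unfolding row row_op_at_def Let_def proj model.M_def[symmetric]
      by (rule points.opnorm_compression_tendsto[OF model.modelD(1) points.random_pair_sym[OF model.M_pair]
            C(3) less_imp_le[OF C(1)] L mono dense])
    moreover have "(\<lambda>n. opnorm \<H> (col_op_at \<H> var N v (X n))) \<longlonglongrightarrow> opnorm \<H> (col_op \<H> N v)"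
      unfolding col col_op_at_def Let_def proj model.M_def[symmetric]
      by (rule points.opnorm_compression_tendsto[OF model.modelD(1) model.M_pair
            C(2) less_imp_le[OF C(1)] L mono dense])
    moreover have "opnorm \<H> (row_op \<H> N v) \<le> opnorm \<H> (col_op \<H> N v)"
      unfolding row col by (rule model.row_le_col[OF assms(3)])
    ultimately show ?case unfolding X_def by blast
  qed
qed

end
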